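(* Let $m_1\ge m_2\ge 2$ be integers such that $m_2$ divides $m_1$. Then $$N_b(m_1,m_2)=N_e(m_1,m_2)=\frac{m_1}{m_2},\qquad N_u(m_1,m_2)=\begin{cases}3 & \text{if } m_1=m_2,\\ \frac{m_1}{m_2}+1 & \text{if } m_1>m_2.\end{cases}$$
   Context: Let $\mathit{PD}(m)$ be the cone of real symmetric positive definite $m\times m$ matrices. For $\Sigma_1\in\mathit{PD}(m_1)$, $\Sigma_2\in\mathit{PD}(m_2)$, a random matrix $Y\in\mathbb{R}^{m_1\times m_2}$ has the (regular, mean-zero) matrix normal distribution $\mathcal N(0,\Sigma_2\otimes\Sigma_1)$ if $Y\stackrel{d}{=}AZB^T$ where $Z$ is $m_1\times m_2$ with i.i.d. standard normal entries, $\Sigma_1=AA^T$, $\Sigma_2=BB^T$; equivalently, the vectorization of $Y$ is centered Gaussian with covariance $\Sigma_2\otimes\Sigma_1$. Let $Y_1,\dots,Y_n$ be i.i.d. from such a distribution. Up to an additive constant, twice the log-likelihood as a function of the precision matrices $\Psi_j=\Sigma_j^{-1}$ is $$\ell(\Psi_1,\Psi_2)=nm_2\log\det(\Psi_1)+nm_1\log\det(\Psi_2)-\operatorname{tr}\Big(\Psi_1\sum_{i=1}^nY_i\Psi_2Y_i^T\Big),\quad (\Psi_1,\Psi_2)\in\mathit{PD}(m_1)\times\mathit{PD}(m_2).$$ The Kronecker MLE exists if $\ell$ achieves its maximum over $\mathit{PD}(m_1)\times\mathit{PD}(m_2)$. It exists uniquely if in addition all local maxima of $\ell$ have the same Kronecker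 product $\Psi_2\otimes\Psi_1$. The existence threshold $N_e(m_1,m_2)$, uniqueness threshold $N_u(m_1,m_2)$ and boundedness threshold $N_b(m_1,m_2)$ are the positive integers such that: the Kronecker MLE exists almost surely if and only if $n\ge N_e(m_1,m_2)$; the Kronecker MLE exists uniquely almost surely if and only if $n\ge N_u(m_1,m_2)$; $\ell$ is bounded above almost surely if and only if $n\ge N_b(m_1,m_2)$. *)

theory Defs
  imports "HOL-Probability.Probability"
begin

text \<open>An \<open>m1 \<times> m2\<close> real matrix is an element of \<^typ>\<open>real^'m2^'m1\<close>; the dimensions are
  \<open>CARD('m1)\<close> and \<open>CARD('m2)\<close>.\<close>

definition PD :: "(real^'m^'m) set" where
  "PD = {P. transpose P = P \<and> (\<forall>x. x \<noteq> 0 \<longrightarrow> x \<bullet> (P *v x) > 0)}"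

text \<open>Rows and columns of \<open>A \<otimes> B\<close> are indexed by pairs; the block at position \<open>(i, j)\<close> is
  \<open>A $ i $ j\<close> times \<open>B\<close>.\<close>

definition kronecker :: "real^'a^'a \<Rightarrow> real^'b^'b \<Rightarrow> real^('a \<times> 'b)^('a \<times> 'b)" where
  "kronecker A B = (\<chi> p q. A $ fst p $ fst q * B $ snd p $ snd q)"

definition std_normal_matrix :: "(real^'m2^'m1) measure" where
  "std_normal_matrix =
     distr (\<Pi>\<^sub>M p\<in>(UNIV :: ('m1 \<times> 'm2) set). std_normal_distribution) borel
       (\<lambda>z. \<chi> i j. z (i, j))"

text \<open>\<open>mu\<close> is the law \<open>N(0, \<Sigma>2 \<otimes> \<Sigma>1)\<close> of \<open>A Z B\<^sup>T\<close>; it does not depend on the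
  choice of the factors \<open>A\<close>, \<open>B\<close>.\<close>

definition matrix_normal ::
  "(real^'m2^'m1) measure \<Rightarrow> real^'m1^'m1 \<Rightarrow> real^'m2^'m2 \<Rightarrow> bool" where
  "matrix_normal mu \<Sigma>1 \<Sigma>2 \<longleftrightarrow>
     \<Sigma>1 \<in> PD \<and> \<Sigma>2 \<in> PD \<and>
     (\<exists>(A :: real^'m1^'m1) (B :: real^'m2^'m2). \<Sigma>1 = A ** transpose A \<and> \<Sigma>2 = B ** transpose B \<and>
        mu = distr (std_normal_matrix :: (real^'m2^'m1) measure) borel (\<lambda>Z. A ** Z ** transpose B))"

text \<open>The sample \<open>Y\<^sub>1, \<dots>, Y\<^sub>n\<close> is represented by \<open>Y 0, \<dots>, Y (n - 1)\<close>.\<close>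

definition loglik ::
  "nat \<Rightarrow> (nat \<Rightarrow> real^'m2^'m1) \<Rightarrow> (real^'m1^'m1) \<times> (real^'m2^'m2) \<Rightarrow> real" where
  "loglik n Y = (\<lambda>(\<Psi>1, \<Psi>2).
     real n * real CARD('m2) * ln (det \<Psi>1) + real n * real CARD('m1) * ln (det \<Psi>2)
     - trace (\<Psi>1 ** (\<Sum>i<n. Y i ** \<Psi>2 ** transpose (Y i))))"

definition loglik_bounded :: "nat \<Rightarrow> (nat \<Rightarrow> real^'m2^'m1) \<Rightarrow> bool" where
  "loglik_bounded n Y \<longleftrightarrow> bdd_above (loglik n Y ` (PD \<times> PD))"

definition mle_exists :: "nat \<Rightarrow> (nat \<Rightarrow> real^'m2^'m1) \<Rightarrow> bool" where
  "mle_exists n Y \<longleftrightarrow>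
     (\<exists>\<Psi> \<in> PD \<times> PD. \<forall>\<Phi> \<in> PD \<times> PD. loglik n Y \<Phi> \<le> loglik n Y \<Psi>)"

definition local_max_on :: "('a::topological_space \<Rightarrow> real) \<Rightarrow> 'a set \<Rightarrow> 'a \<Rightarrow> bool" where
  "local_max_on f S x \<longleftrightarrow> x \<in> S \<and> (\<forall>\<^sub>F y in at x within S. f y \<le> f x)"

definition mle_exists_uniquely :: "nat \<Rightarrow> (nat \<Rightarrow> real^'m2^'m1) \<Rightarrow> bool" where
  "mle_exists_uniquely n Y \<longleftrightarrow>
     mle_exists n Y \<and>
     (\<forall>\<Psi>1 \<Psi>2 \<Phi>1 \<Phi>2.
        local_max_on (loglik n Y) (PD \<times> PD) (\<Psi>1, \<Psi>2) \<and>
        local_max_on (loglik n Y) (PD \<times> PD) (\<Phi>1, \<Phi>2) \<longrightarrow>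
        kronecker \<Psi>2 \<Psi>1 = kronecker \<Phi>2 \<Phi>1)"

text \<open>\<open>N\<close> is the threshold for a property of samples of size \<open>n\<close>: whatever the underlying
  matrix normal law, for each sample size \<open>n \<ge> 1\<close> the property holds almost surely (with
  respect to the joint law of \<open>n\<close> i.i.d. observations) iff \<open>n \<ge> N\<close>. At most one \<open>N\<close>
  satisfies this; its existence is part of the assertion.\<close>

definition is_threshold ::
  "(nat \<Rightarrow> (nat \<Rightarrow> real^'m2^'m1) \<Rightarrow> bool) \<Rightarrow> nat \<Rightarrow> bool" where
  "is_threshold Q N \<longleftrightarrow>
     N > 0 \<and>
     (\<forall>mu \<Sigma>1 \<Sigma>2. matrix_normal mu \<Sigma>1 \<Sigma>2 \<longrightarrow>
        (\<forall>n>0. (AE Y in (\<Pi>\<^sub>M i\<in>{..<n}. mu). Q n Y) \<longleftrightarrow> N \<le> n))"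

definition boundedness_threshold :: "'m1::finite itself \<Rightarrow> 'm2::finite itself \<Rightarrow> nat \<Rightarrow> bool" where
  "boundedness_threshold m1 m2 =
     is_threshold (loglik_bounded :: nat \<Rightarrow> (nat \<Rightarrow> real^'m2^'m1) \<Rightarrow> bool)"

definition existence_threshold :: "'m1::finite itself \<Rightarrow> 'm2::finite itself \<Rightarrow> nat \<Rightarrow> bool" where
  "existence_threshold m1 m2 =
     is_threshold (mle_exists :: nat \<Rightarrow> (nat \<Rightarrow> real^'m2^'m1) \<Rightarrow> bool)"

definition uniqueness_threshold :: "'m1::finite itself \<Rightarrow> 'm2::finite itself \<Rightarrow> nat \<Rightarrow> bool" where
  "uniqueness_threshold m1 m2 =
     is_threshold (mle_exists_uniquely :: nat \<Rightarrow> (nat \<Rightarrow> real^'m2^'m1) \<Rightarrow> bool)"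

end

theory Submission
  imports Defs "HOL-Computational_Algebra.Fundamental_Theorem_Algebra"
begin

text \<open>
  Let \<open>k = m\<^sub>1 / m\<^sub>2\<close>. Any two points of the parameter space can be written as \<open>(C C\<^sup>T, A A\<^sup>T)\<close>
  and \<open>(C diag(exp c) C\<^sup>T, A diag(exp d) A\<^sup>T)\<close>. Along the curve \<open>t \<mapsto> (t c, t d)\<close> between them the
  log-likelihood is affine in \<open>t\<close> minus the sum of the exponentials \<open>exp(t (c\<^sub>a + d\<^sub>b))\<close>, weighted
  by the squared entries of \<open>C\<^sup>T Y\<^sub>i A\<close>. This concavity is used in two forms. A solution of the
  likelihood equations is a global maximum (\<open>likelihood_equations_imp_max\<close>). Two local maxima
  satisfy \<open>X Y\<^sub>i + Y\<^sub>i Z = 0\<close> for all \<open>i\<close>, with \<open>X\<close> and \<open>Z\<close> recording the difference of the two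
  maxima (\<open>two_local_maxima\<close>).

  With \<open>n < k\<close> observations the columns of the sample do not span the column space, and \<open>\<Psi>\<^sub>1\<close> can
  grow for free in an orthogonal direction (\<open>unbounded_if_small_sample\<close>). With \<open>n = k\<close>
  observations the matrix \<open>W = [Y\<^sub>0, ..., Y\<^sub>k\<^sub>-\<^sub>1]\<close> is square and almost surely invertible.
  Multiplication by \<open>W\<^sup>-\<^sup>1\<close> turns the observations into the inclusions of the \<open>k\<close> coordinate
  blocks, and for those every \<open>\<Psi>\<^sub>2\<close> belongs to a solution (\<open>likelihood_equations_square\<close>): a
  maximum exists and is not unique.

  Each further observation contributes \<open>k\<close> square blocks of \<open>W\<^sup>-\<^sup>1 Y\<^sub>i\<close>. After maximising over
  \<open>\<Psi>\<^sub>1\<close>, what remains is to minimise \<open>det(1 + \<Sum> N\<^sub>i N\<^sub>i\<^sup>T)\<close>, where the blocks of \<open>N\<^sub>i\<close> are those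
  of \<open>W\<^sup>-\<^sup>1 Y\<^sub>i\<close> conjugated by \<open>B\<close> and \<open>\<Psi>\<^sub>2 = B B\<^sup>T\<close>. If the blocks generate the full matrix
  algebra, a bound on their conjugates bounds the condition number of \<open>B\<close>
  (\<open>condition_number_bounded\<close>), so the minimum is attained; and the matrix \<open>Z\<close> above commutes with
  all blocks, hence is a scalar, which gives uniqueness (\<open>mle_exists_uniquely_if_generating\<close>). Two
  generic blocks generate the algebra, and two blocks are available once \<open>n \<ge> k + 1\<close> if \<open>k \<ge> 2\<close>,
  and once \<open>n \<ge> 3\<close> if \<open>k = 1\<close>.

  In the remaining case \<open>k = 1\<close>, \<open>n = 2\<close> there is a single block \<open>M\<close>, almost surely with simple
  spectrum. If the columns of \<open>V\<close> are eigenvectors of \<open>M\<close>, chosen closed under complex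
  conjugation, then \<open>V diag(w) V\<^sup>*\<close> belongs to a solution for all positive weights that respect
  conjugation (\<open>eigenbasis_solves\<close>). Hence a maximum exists, and as soon as \<open>M\<close> has a real
  eigenvalue the freedom of its weight destroys uniqueness. That happens whenever \<open>det M < 0\<close>, an
  event of positive probability.

  The almost sure statements concern polynomials in Gaussian entries: such a polynomial is almost
  surely nonzero unless it vanishes identically, and is almost surely nonnegative only if it is
  nonnegative everywhere (\<open>sample_polynomial_zero_one\<close>).
\<close>

section \<open>Matrix algebra\<close>

lemma matrix_add_rdistrib: "(A + B) ** C = A ** C + B ** (C :: 'a::semiring_1^'n^'m)"
  by (simp add: vec_eq_iff matrix_matrix_mult_def sum.distrib[symmetric] distrib_right)

lemma matrix_mult_lzero [simp]: "0 ** A = (0 :: 'a::semiring_1^'n^'m)"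
  by (vector matrix_matrix_mult_def)

lemma matrix_mult_rzero [simp]: "A ** 0 = (0 :: 'a::semiring_1^'n^'m)"
  by (vector matrix_matrix_mult_def)

lemma matrix_sum_ldistrib: "A ** (\<Sum>i\<in>S. f i) = (\<Sum>i\<in>S. A ** (f i :: 'a::semiring_1^'n^'m))"
  by (induction S rule: infinite_finite_induct) (auto simp: matrix_add_ldistrib)

lemma matrix_sum_rdistrib: "(\<Sum>i\<in>S. f i) ** A = (\<Sum>i\<in>S. f i ** (A :: 'a::semiring_1^'n^'m))"
  by (induction S rule: infinite_finite_induct) (auto simp: matrix_add_rdistrib)

lemma matrix_scaleR_left [simp]: "(c *\<^sub>R A) ** B = c *\<^sub>R (A ** (B :: real^'n^'m))"
  by (vector matrix_matrix_mult_def) (simp add: sum_distrib_left mult.assoc)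

lemma matrix_scaleR_right [simp]: "A ** (c *\<^sub>R B) = c *\<^sub>R (A ** (B :: real^'n^'m))"
  by (vector matrix_matrix_mult_def) (simp add: sum_distrib_left ac_simps)

lemma transpose_add: "transpose (A + B) = transpose A + transpose (B :: 'a::plus^'n^'m)"
  by (vector transpose_def)

lemma transpose_0 [simp]: "transpose (0 :: 'a::zero^'n^'m) = 0"
  by (vector transpose_def)

lemma transpose_sum:
  "transpose (\<Sum>i\<in>S. f i) = (\<Sum>i\<in>S. transpose (f i :: 'a::comm_monoid_add^'n^'m))"
  by (induction S rule: infinite_finite_induct) (auto simp: transpose_add)

lemma trace_sum: "trace (\<Sum>i\<in>S. f i) = (\<Sum>i\<in>S. trace (f i :: 'a::comm_semiring_1^'n^'n))"
  by (induction S rule: infinite_finite_induct) (auto simp: trace_add, auto simp: trace_def)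

lemma trace_scaleR: "trace (c *\<^sub>R A) = c * trace (A :: real^'n^'n)"
  by (simp add: trace_def sum_distrib_left)

lemma trace_transpose_mult:
  "trace (transpose A ** A) = (\<Sum>i\<in>UNIV. \<Sum>j\<in>UNIV. ((A :: real^'n^'m) $ i $ j)\<^sup>2)"
proof -
  have "trace (transpose A ** A) = (\<Sum>j\<in>UNIV. \<Sum>i\<in>UNIV. (A $ i $ j)\<^sup>2)"
    by (simp add: trace_def matrix_matrix_mult_def transpose_def power2_eq_square)
  then show ?thesis by (subst sum.swap) simp
qed

lemma norm_matrix_power2: "(norm (A :: real^'n^'m))\<^sup>2 = trace (transpose A ** A)"
  by (simp add: trace_transpose_mult norm_vec_def L2_set_def sum_nonneg)

lemma invertible_obtain_inverse:
  fixes A :: "'a::field^'n^'n"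
  assumes "det A \<noteq> 0"
  obtains B where "A ** B = mat 1" "B ** A = mat 1" "det B \<noteq> 0"
  using assms invertible_det_nz[of A] det_mul[of A] unfolding invertible_def
  by (metis det_I mult_zero_right zero_neq_one)

lemma matrix_vector_mult_eq_0_iff:
  fixes A :: "'a::field^'n^'n"
  assumes "det A \<noteq> 0"
  shows "A *v x = 0 \<longleftrightarrow> x = 0"
proof
  obtain B where B: "B ** A = mat 1" using invertible_obtain_inverse[OF assms] by blast
  assume "A *v x = 0"
  then have "(B ** A) *v x = 0" by (simp add: matrix_vector_mul_assoc[symmetric])
  then show "x = 0" by (simp add: B)
qed auto

lemma matrix_right_inverse_commute:
  "A ** B = mat 1 \<longleftrightarrow> B ** A = mat 1" for A B :: "'a::field^'n^'n"
  using matrix_left_right_inverse by metis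

lemma det_scaleR: "det (c *\<^sub>R A) = c ^ CARD('n) * det (A :: real^'n^'n)"
proof -
  have "c *\<^sub>R A = (\<chi> i. c *s (A $ i))"
    by (vector)
  then show ?thesis
    using det_rows_mul[of "\<lambda>_. c" "\<lambda>i. A $ i"] by simp
qed

definition diagm :: "('n \<Rightarrow> 'a) \<Rightarrow> 'a::zero^'n^'n" where
  "diagm d = (\<chi> i j. if i = j then d i else 0)"

lemma diagm_nth: "diagm d $ i $ j = (if i = j then d i else 0)"
  by (simp add: diagm_def)

lemma matrix_mult_diagm_nth: "(A ** diagm d) $ i $ j = A $ i $ j * (d j :: 'a::comm_semiring_1)"
  by (simp add: matrix_matrix_mult_def diagm_nth if_distrib cong: if_cong)

lemma diagm_mult_nth: "(diagm d ** A) $ i $ j = d i * (A $ i $ j :: 'a::comm_semiring_1)"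
  by (simp add: matrix_matrix_mult_def diagm_nth if_distrib if_distribR cong: if_cong)

lemma diagm_mult_vec_nth: "(diagm d *v x) $ i = d i * (x $ i :: 'a::comm_semiring_1)"
  by (simp add: matrix_vector_mult_def diagm_nth if_distrib if_distribR cong: if_cong)

lemma diagm_mult_diagm: "diagm d ** diagm e = diagm (\<lambda>i. d i * (e i :: 'a::comm_semiring_1))"
  by (simp add: vec_eq_iff diagm_mult_nth diagm_nth)

lemma transpose_diagm [simp]: "transpose (diagm d) = diagm d"
  by (simp add: vec_eq_iff transpose_def diagm_def)

lemma diagm_1: "diagm (\<lambda>_. 1) = mat (1::'a::semiring_1)"
  by (vector diagm_def mat_def)

lemma det_diagm [simp]: "det (diagm d) = (\<Prod>i\<in>UNIV. d i :: 'a::comm_ring_1)"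
  by (subst det_diagonal) (auto simp: diagm_nth)

lemma trace_diagm [simp]: "trace (diagm d) = (\<Sum>i\<in>UNIV. d i :: 'a::comm_semiring_1)"
  by (simp add: trace_def diagm_nth)

lemma diagm_add: "diagm d + diagm e = diagm (\<lambda>i. d i + (e i :: 'a::comm_semiring_1))"
  by (vector diagm_def)

lemma inner_matrix_vector_transpose: "x \<bullet> (A *v y) = (transpose A *v x) \<bullet> (y :: real^'n)"
  by (simp add: dot_lmul_matrix)

section \<open>Symmetric and positive definite matrices\<close>

text \<open>A maximiser \<open>u\<close> of the Rayleigh quotient on the orthogonal complement of the eigenvectors
  already found is an eigenvector: \<open>M u - \<lambda> u\<close> lies in that complement, is orthogonal to \<open>u\<close>, and
  by maximality \<open>M u\<close> is orthogonal to every such vector.\<close>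

lemma symmetric_orthonormal_eigenvectors:
  fixes M :: "real^'n^'n"
  assumes sym: "transpose M = M" and "k \<le> CARD('n)"
  shows "\<exists>B. finite B \<and> card B = k \<and> pairwise orthogonal B \<and>
    (\<forall>b\<in>B. norm b = 1 \<and> (\<exists>c. M *v b = c *\<^sub>R b))"
  using assms(2)
proof (induction k)
  case 0
  show ?case by (rule exI[of _ "{}"]) auto
next
  case (Suc k)
  then obtain B where B: "finite B" "card B = k" "pairwise orthogonal B"
    "\<And>b. b \<in> B \<Longrightarrow> norm b = 1" "\<And>b. b \<in> B \<Longrightarrow> \<exists>c. M *v b = c *\<^sub>R b"
    by auto
  have Msym: "x \<bullet> (M *v y) = (M *v x) \<bullet> y" for x y
    using inner_matrix_vector_transpose[of x M y] sym by simp
  define W where "W = {x. \<forall>b\<in>B. b \<bullet> x = 0}"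
  have subW: "x + t *\<^sub>R y \<in> W" if "x \<in> W" "y \<in> W" for x y t
    using that by (auto simp: W_def inner_right_distrib)
  have "dim B < DIM(real^'n)"
    using dim_le_card'[OF B(1)] B(2) Suc.prems by simp
  then obtain x0 where x0: "x0 \<noteq> 0" "\<And>y. y \<in> span B \<Longrightarrow> orthogonal x0 y"
    using orthogonal_to_subspace_exists by blast
  have x0W: "x0 \<in> W"
    using x0(2) span_base by (fastforce simp: W_def orthogonal_def inner_commute)
  have "closed W"
  proof -
    have "W = (\<Inter>b\<in>B. {x. b \<bullet> x = 0})" by (auto simp: W_def)
    then show ?thesis by (auto simp: closed_hyperplane)
  qed
  then have comp: "compact (W \<inter> sphere 0 1)"
    by (simp add: closed_Int_compact)
  have "(1 / norm x0) *\<^sub>R x0 \<in> W \<inter> sphere 0 1"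
    using x0 x0W by (auto simp: W_def)
  then have ne: "W \<inter> sphere 0 1 \<noteq> {}" by blast
  have "continuous_on (W \<inter> sphere 0 1) (\<lambda>x. x \<bullet> (M *v x))"
    by (intro continuous_intros linear_continuous_on) (simp add: linear_linear)
  from continuous_attains_sup[OF comp ne this] obtain u where
    u: "u \<in> W" "norm u = 1" and
    umax: "\<And>x. x \<in> W \<Longrightarrow> norm x = 1 \<Longrightarrow> x \<bullet> (M *v x) \<le> u \<bullet> (M *v u)"
    by auto
  define l where "l = u \<bullet> (M *v u)"
  have umax': "x \<bullet> (M *v x) \<le> l * (x \<bullet> x)" if "x \<in> W" for x
  proof (cases "x = 0")
    case False
    have "(1 / norm x) *\<^sub>R x \<in> W" using that by (auto simp: W_def)
    from umax[OF this] False have "(x \<bullet> (M *v x)) / (norm x)^2 \<le> l"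
      by (simp add: l_def matrix_vector_mult_scaleR power2_eq_square field_simps)
    then show ?thesis using False by (simp add: field_simps power2_norm_eq_inner)
  qed auto
  have orth: "w \<bullet> (M *v u) = 0" if w: "w \<in> W" "w \<bullet> u = 0" for w
  proof (rule ccontr)
    assume n0: "w \<bullet> (M *v u) \<noteq> 0"
    have uu: "u \<bullet> u = 1" using u(2) by (simp add: norm_eq_1)
    have ineq: "2 * t * (w \<bullet> (M *v u)) \<le> t\<^sup>2 * (l * (w \<bullet> w) - w \<bullet> (M *v w))" for t
    proof -
      have "(u + t *\<^sub>R w) \<bullet> (M *v (u + t *\<^sub>R w)) \<le> l * ((u + t *\<^sub>R w) \<bullet> (u + t *\<^sub>R w))"
        by (intro umax' subW u w)
      moreover have "u \<bullet> (M *v w) = w \<bullet> (M *v u)"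
        using Msym[of u w] by (simp add: inner_commute)
      ultimately show ?thesis
        using w(2) uu
        by (simp add: matrix_vector_right_distrib matrix_vector_mult_scaleR inner_left_distrib
            inner_right_distrib l_def[symmetric] inner_commute[of u w] algebra_simps power2_eq_square)
    qed
    define p where "p = w \<bullet> (M *v u)"
    define q where "q = l * (w \<bullet> w) - w \<bullet> (M *v w)"
    have *: "2 * t * p \<le> t\<^sup>2 * q" for t using ineq[of t] by (simp add: p_def q_def)
    \<comment> \<open>For this small \<open>t\<close> the quadratic term is at most half of the linear one.\<close>
    define t where "t = p / (\<bar>q\<bar> + 1)"
    have tp: "t * (\<bar>q\<bar> + 1) = p" by (simp add: t_def)
    have "t\<^sup>2 * q \<le> t\<^sup>2 * (\<bar>q\<bar> + 1)" by (intro mult_left_mono) auto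
    also have "\<dots> = t * p" by (simp add: power2_eq_square mult.assoc tp)
    finally have "t * p \<le> 0" using *[of t] by simp
    moreover have "t * p = p\<^sup>2 / (\<bar>q\<bar> + 1)" by (simp add: t_def power2_eq_square)
    moreover have "p\<^sup>2 / (\<bar>q\<bar> + 1) > 0"
      using n0 by (intro divide_pos_pos) (auto simp: p_def)
    ultimately show False by simp
  qed
  define w where "w = M *v u - l *\<^sub>R u"
  have wu: "w \<bullet> u = 0"
    using u(2) by (subst inner_commute) (simp add: w_def l_def inner_diff_right norm_eq_1)
  have wW: "w \<in> W"
    unfolding W_def
  proof safe
    fix b assume b: "b \<in> B"
    then obtain c where c: "M *v b = c *\<^sub>R b" using B(5) by blast
    have "b \<bullet> u = 0" using u(1) b by (auto simp: W_def)
    then show "b \<bullet> w = 0" using Msym[of b u] c by (simp add: w_def inner_diff_right)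
  qed
  have "w \<bullet> w = w \<bullet> (M *v u) - l * (w \<bullet> u)"
    by (subst (2) w_def) (simp add: inner_diff_right)
  then have "w = 0" using orth[OF wW wu] wu by simp
  then have ev: "M *v u = l *\<^sub>R u" by (simp add: w_def)
  have "u \<notin> B" using u by (auto simp: W_def)
  show ?case
  proof (intro exI[of _ "insert u B"] conjI)
    show "pairwise orthogonal (insert u B)"
      using B(3) u(1) by (auto simp: pairwise_insert W_def orthogonal_def inner_commute)
  qed (use B \<open>u \<notin> B\<close> u ev in auto)
qed

text \<open>The spectral theorem for real symmetric matrices.\<close>

lemma symmetric_diagonalizable:
  fixes M :: "real^'n^'n"
  assumes sym: "transpose M = M"
  obtains Q d where "orthogonal_matrix Q" "M = Q ** diagm d ** transpose Q"
proof -
  obtain B where B: "finite B" "card B = CARD('n)" "pairwise orthogonal B"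
    "\<And>b. b \<in> B \<Longrightarrow> norm b = 1" "\<And>b. b \<in> B \<Longrightarrow> \<exists>c. M *v b = c *\<^sub>R b"
    using symmetric_orthonormal_eigenvectors[OF sym order_refl] by auto
  obtain e where e: "bij_betw e (UNIV :: 'n set) B"
    using finite_same_card_bij[OF finite B(1)] B(2) by auto
  define Q where "Q = (\<chi> i j. e j $ i)"
  have eB: "e j \<in> B" for j using e by (auto simp: bij_betw_def)
  obtain d where d: "M *v e j = d j *\<^sub>R e j" for j
    using B(5)[OF eB] by metis
  have "transpose Q ** Q = mat 1"
  proof -
    have "e i \<bullet> e j = (if i = j then 1 else 0)" for i j
    proof (cases "i = j")
      case True then show ?thesis using B(4)[OF eB] by (simp add: norm_eq_1)
    next
      case False
      then have "e i \<noteq> e j" using e by (auto simp: bij_betw_def inj_on_def)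
      then show ?thesis using B(3) eB False by (auto simp: pairwise_def orthogonal_def)
    qed
    then show ?thesis
      by (simp add: vec_eq_iff matrix_matrix_mult_def transpose_def Q_def mat_def inner_vec_def)
  qed
  then have orth: "orthogonal_matrix Q" by (simp add: orthogonal_matrix)
  have MQ: "M ** Q = Q ** diagm d"
  proof -
    have "(M ** Q) $ i $ j = (M *v e j) $ i" for i j
      by (simp add: matrix_matrix_mult_def matrix_vector_mult_def Q_def)
    then show ?thesis by (simp add: vec_eq_iff matrix_mult_diagm_nth d) (simp add: Q_def)
  qed
  have "M = M ** (Q ** transpose Q)"
    using orth by (simp add: orthogonal_matrix_def)
  then have "M = Q ** diagm d ** transpose Q"
    by (simp add: matrix_mul_assoc MQ)
  with orth show thesis using that by blast
qed

lemma PD_D: assumes "P \<in> PD" shows "transpose P = P" "x \<noteq> 0 \<Longrightarrow> x \<bullet> (P *v x) > 0"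
  using assms by (auto simp: PD_def)

lemma inner_congruence:
  "x \<bullet> ((transpose A ** P ** A) *v x) = (A *v x) \<bullet> (P *v (A *v x))" for P :: "real^'n^'n"
proof -
  have "x \<bullet> ((transpose A ** P ** A) *v x) = x \<bullet> (transpose A *v (P *v (A *v x)))"
    by (simp only: matrix_vector_mul_assoc matrix_mul_assoc)
  also have "\<dots> = (transpose (transpose A) *v x) \<bullet> (P *v (A *v x))"
    by (rule inner_matrix_vector_transpose)
  finally show ?thesis by (simp only: transpose_transpose)
qed

lemma congruence_PD:
  fixes P :: "real^'n^'n"
  assumes "P \<in> PD" "det A \<noteq> 0"
  shows "transpose A ** P ** A \<in> PD"
proof -
  have "x \<bullet> ((transpose A ** P ** A) *v x) > 0" if "x \<noteq> 0" for x
    unfolding inner_congruence using PD_D(2)[OF assms(1)] that assms(2)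
    by (simp add: matrix_vector_mult_eq_0_iff)
  moreover have "transpose (transpose A ** P ** A) = transpose A ** P ** A"
    by (simp add: matrix_transpose_mul matrix_mul_assoc PD_D(1)[OF assms(1)])
  ultimately show ?thesis unfolding PD_def by blast
qed

lemma congruence_PD':
  fixes P :: "real^'n^'n"
  assumes "P \<in> PD" "det A \<noteq> 0"
  shows "A ** P ** transpose A \<in> PD"
  using congruence_PD[of P "transpose A"] assms by simp

lemma diagm_PD: assumes "\<And>i. d i > 0" shows "diagm d \<in> PD"
proof -
  have "x \<bullet> (diagm d *v x) > 0" if "x \<noteq> 0" for x
  proof -
    have "x \<bullet> (diagm d *v x) = (\<Sum>i\<in>UNIV. d i * (x $ i)\<^sup>2)"
      by (simp add: inner_vec_def diagm_mult_vec_nth power2_eq_square ac_simps)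
    moreover obtain i where "x $ i \<noteq> 0" using \<open>x \<noteq> 0\<close> by (auto simp: vec_eq_iff)
    ultimately show ?thesis
      using assms by (auto intro!: sum_pos2[of _ i] simp: less_imp_le)
  qed
  then show ?thesis by (auto simp: PD_def)
qed

lemma mat_1_PD: "mat 1 \<in> PD"
  using diagm_PD[of "\<lambda>_. 1"] by (simp add: diagm_1)

lemma gram_PD: assumes "det A \<noteq> 0" shows "A ** transpose A \<in> PD"
  using congruence_PD'[OF mat_1_PD assms] by simp

lemma scaleR_PD: "P \<in> PD \<Longrightarrow> c > 0 \<Longrightarrow> c *\<^sub>R P \<in> PD"
  by (auto simp: PD_def transpose_scalar scaleR_matrix_vector_assoc[symmetric])

lemma PD_diagonalizable:
  fixes P :: "real^'n^'n"
  assumes "P \<in> PD"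
  obtains Q d where "orthogonal_matrix Q" "P = Q ** diagm d ** transpose Q" "\<And>i. d i > 0"
proof -
  obtain Q d where Q: "orthogonal_matrix Q" "P = Q ** diagm d ** transpose Q"
    using symmetric_diagonalizable[OF PD_D(1)[OF assms]] by blast
  have QQ: "transpose Q ** Q = mat 1" using Q(1) by (simp add: orthogonal_matrix)
  then have "det Q \<noteq> 0" by (metis det_I det_mul mult_zero_right zero_neq_one)
  have "transpose Q ** P ** Q = (transpose Q ** Q) ** diagm d ** (transpose Q ** Q)"
    by (simp add: Q(2) matrix_mul_assoc)
  then have PD: "diagm d \<in> PD"
    using congruence_PD[OF assms \<open>det Q \<noteq> 0\<close>] by (simp add: QQ)
  have "d i > 0" for i
    using PD_D(2)[OF PD, of "axis i 1"]
    by (simp add: matrix_vector_mult_basis inner_axis' column_def diagm_nth)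
  with Q show thesis using that by blast
qed

lemma PD_factor:
  fixes P :: "real^'n^'n"
  assumes "P \<in> PD"
  obtains B where "det B \<noteq> 0" "P = B ** transpose B"
proof -
  obtain Q d where Q: "orthogonal_matrix Q" "P = Q ** diagm d ** transpose Q" "\<And>i. d i > 0"
    using PD_diagonalizable[OF assms] by blast
  have "det Q \<noteq> 0" using det_orthogonal_matrix[OF Q(1)] by auto
  have "diagm d = diagm (\<lambda>i. sqrt (d i)) ** diagm (\<lambda>i. sqrt (d i))"
    using Q(3) by (simp add: diagm_mult_diagm less_imp_le)
  then have "P = (Q ** diagm (\<lambda>i. sqrt (d i))) ** transpose (Q ** diagm (\<lambda>i. sqrt (d i)))"
    by (simp add: Q(2) matrix_transpose_mul matrix_mul_assoc)
  moreover have "det (Q ** diagm (\<lambda>i. sqrt (d i))) \<noteq> 0"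
    using Q(3) \<open>det Q \<noteq> 0\<close> by (simp add: det_mul) (metis less_irrefl)
  ultimately show thesis using that by blast
qed

lemma PD_det_pos: fixes P :: "real^'n^'n" assumes "P \<in> PD" shows "det P > 0"
  using PD_factor[OF assms] by (metis det_mul det_transpose not_real_square_gt_zero)

lemma PD_inverse:
  fixes P :: "real^'n^'n"
  assumes "P \<in> PD"
  obtains R where "R \<in> PD" "P ** R = mat 1" "R ** P = mat 1"
proof -
  obtain R where R: "P ** R = mat 1" "R ** P = mat 1" "det R \<noteq> 0"
    using invertible_obtain_inverse[of P] PD_det_pos[OF assms] by auto
  have "transpose R ** P = mat 1"
    using R(1) PD_D(1)[OF assms] by (metis matrix_transpose_mul transpose_mat)
  then have "transpose R ** P ** R = R" by simp
  with congruence_PD[OF assms R(3)] R show thesis using that by simp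
qed

text \<open>Diagonalising \<open>B\<^sup>-\<^sup>1 Q B\<^sup>-\<^sup>T\<close> orthogonally, where \<open>P = B B\<^sup>T\<close>.\<close>

lemma PD_simultaneous_diagonalization:
  fixes P Q :: "real^'n^'n"
  assumes "P \<in> PD" "Q \<in> PD"
  obtains C v where "det C \<noteq> 0" "P = C ** transpose C"
    "Q = C ** diagm (\<lambda>i. exp (v i)) ** transpose C"
proof -
  obtain B where B: "det B \<noteq> 0" "P = B ** transpose B"
    using PD_factor[OF assms(1)] by blast
  obtain B' where B': "B ** B' = mat 1" "B' ** B = mat 1" "det B' \<noteq> 0"
    using invertible_obtain_inverse[OF B(1)] by blast
  obtain V d where V: "orthogonal_matrix V" "B' ** Q ** transpose B' = V ** diagm d ** transpose V"
    "\<And>i. d i > 0"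
    using PD_diagonalizable[OF congruence_PD'[OF assms(2) B'(3)]] by blast
  have VV: "V ** transpose V = mat 1" using V(1) by (simp add: orthogonal_matrix_def)
  have tB: "transpose B' ** transpose B = mat 1"
    by (metis B'(1) matrix_transpose_mul transpose_mat)
  have "Q = (B ** B') ** Q ** (transpose B' ** transpose B)" by (simp add: B' tB)
  also have "\<dots> = B ** (B' ** Q ** transpose B') ** transpose B"
    by (simp add: matrix_mul_assoc)
  also have "\<dots> = (B ** V) ** diagm (\<lambda>i. exp (ln (d i))) ** transpose (B ** V)"
    using V(3) by (simp add: V(2) matrix_transpose_mul matrix_mul_assoc)
  finally have "Q = (B ** V) ** diagm (\<lambda>i. exp (ln (d i))) ** transpose (B ** V)" .
  moreover have "P = (B ** V) ** transpose (B ** V)"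
  proof -
    have "(B ** V) ** transpose (B ** V) = B ** (V ** transpose V) ** transpose B"
      by (simp add: matrix_transpose_mul matrix_mul_assoc)
    then show ?thesis by (simp add: B(2) VV)
  qed
  moreover have "det (B ** V) \<noteq> 0"
    using B(1) det_orthogonal_matrix[OF V(1)] by (auto simp: det_mul)
  ultimately show thesis using that[of "B ** V" "\<lambda>i. ln (d i)"] by simp
qed

lemma one_plus_sum_le_prod:
  fixes d :: "'a \<Rightarrow> real"
  assumes "\<And>i. i \<in> S \<Longrightarrow> d i \<ge> 0"
  shows "1 + (\<Sum>i\<in>S. d i) \<le> (\<Prod>i\<in>S. 1 + d i)"
  using assms
proof (induction S rule: infinite_finite_induct)
  case (insert x S)
  have "1 + (\<Sum>i\<in>insert x S. d i) \<le> (1 + d x) * (1 + sum d S)"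
    using insert by (simp add: algebra_simps sum_nonneg)
  also have "\<dots> \<le> (1 + d x) * (\<Prod>i\<in>S. 1 + d i)"
    using insert by (intro mult_left_mono) auto
  finally show ?case using insert by simp
qed auto

text \<open>The eigenvalues \<open>d\<^sub>i\<close> of \<open>X\<close> are nonnegative and \<open>\<Prod> (1 + d\<^sub>i) \<ge> 1 + \<Sum> d\<^sub>i\<close>.\<close>

lemma det_one_plus_ge_trace:
  fixes X :: "real^'n^'n"
  assumes sym: "transpose X = X" and psd: "\<And>x. x \<bullet> (X *v x) \<ge> 0"
  shows "1 + trace X \<le> det (mat 1 + X)"
proof -
  obtain Q d where Q: "orthogonal_matrix Q" "X = Q ** diagm d ** transpose Q"
    using symmetric_diagonalizable[OF sym] by blast
  have QQ: "transpose Q ** Q = mat 1" "Q ** transpose Q = mat 1"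
    using Q(1) by (simp_all add: orthogonal_matrix_def)
  have d: "d i \<ge> 0" for i
  proof -
    have "transpose Q ** X ** Q = (transpose Q ** Q) ** diagm d ** (transpose Q ** Q)"
      by (simp add: Q(2) matrix_mul_assoc)
    then have "transpose Q ** X ** Q = diagm d" by (simp add: QQ)
    then have "d i = axis i 1 \<bullet> ((transpose Q ** X ** Q) *v axis i 1)"
      by (simp add: matrix_vector_mult_basis inner_axis' column_def diagm_nth)
    also have "\<dots> = (Q *v axis i 1) \<bullet> (X *v (Q *v axis i 1))" by (rule inner_congruence)
    finally show ?thesis using psd[of "Q *v axis i 1"] by simp
  qed
  have tr: "trace X = (\<Sum>i\<in>UNIV. d i)"
    unfolding Q(2) by (subst trace_mul_sym) (simp add: matrix_mul_assoc QQ)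
  have "mat 1 + X = Q ** diagm (\<lambda>i. 1 + d i) ** transpose Q"
    using QQ(2)
    by (simp add: Q(2) diagm_add[of "\<lambda>_. 1" d, symmetric] diagm_1 matrix_add_ldistrib
        matrix_add_rdistrib)
  then have "det (mat 1 + X) = (det Q * det Q) * (\<Prod>i\<in>UNIV. 1 + d i)"
    by (simp add: det_mul mult_ac)
  also have "det Q * det Q = 1"
    using arg_cong[OF QQ(1), of det] by (simp add: det_mul)
  finally show ?thesis using one_plus_sum_le_prod[of UNIV d] d by (simp add: tr)
qed

section \<open>The likelihood along a common diagonalisation\<close>

lemma trace_diagm_congruence:
  fixes X :: "real^'b^'a"
  shows "trace (diagm u ** X ** diagm v ** transpose X) = (\<Sum>a\<in>UNIV. \<Sum>b\<in>UNIV. u a * v b * (X $ a $ b)\<^sup>2)"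
proof -
  have "(diagm u ** X ** diagm v ** transpose X) $ a $ a = (\<Sum>b\<in>UNIV. u a * v b * (X $ a $ b)\<^sup>2)" for a
  proof -
    have "(diagm u ** X ** diagm v ** transpose X) $ a $ a
        = (\<Sum>b\<in>UNIV. (diagm u ** X ** diagm v) $ a $ b * X $ a $ b)"
      by (simp add: matrix_matrix_mult_def transpose_def)
    then show ?thesis
      by (simp add: matrix_mult_diagm_nth diagm_mult_nth power2_eq_square mult_ac)
  qed
  then show ?thesis by (simp add: trace_def)
qed

lemma trace_factored:
  fixes Y :: "real^'b^'a"
  shows "trace (C ** diagm u ** transpose C ** (Y ** (A ** diagm v ** transpose A) ** transpose Y))
    = (\<Sum>a\<in>UNIV. \<Sum>b\<in>UNIV. u a * v b * ((transpose C ** Y ** A) $ a $ b)\<^sup>2)"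
proof -
  have "trace (C ** (diagm u ** transpose C ** Y ** A ** diagm v ** transpose A ** transpose Y))
      = trace (diagm u ** (transpose C ** Y ** A) ** diagm v ** transpose (transpose C ** Y ** A))"
    by (subst trace_mul_sym) (simp add: matrix_transpose_mul matrix_mul_assoc)
  then show ?thesis
    unfolding trace_diagm_congruence by (simp add: matrix_mul_assoc)
qed

lemma ln_det_factored:
  fixes C :: "real^'n^'n"
  assumes "det C \<noteq> 0"
  shows "ln (det (C ** diagm (\<lambda>a. exp (c a)) ** transpose C)) = ln ((det C)\<^sup>2) + (\<Sum>a\<in>UNIV. c a)"
proof -
  have "det (C ** diagm (\<lambda>a. exp (c a)) ** transpose C) = (det C)\<^sup>2 * exp (\<Sum>a\<in>UNIV. c a)"
    by (simp add: det_mul exp_sum power2_eq_square)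
  also have "ln \<dots> = ln ((det C)\<^sup>2) + ln (exp (\<Sum>a\<in>UNIV. c a))"
    using assms by (simp add: ln_mult)
  finally show ?thesis by simp
qed

lemma loglik_factored:
  fixes Y :: "nat \<Rightarrow> real^'m2^'m1"
  assumes "det C \<noteq> 0" "det A \<noteq> 0"
  shows "loglik n Y (C ** diagm (\<lambda>a. exp (c a)) ** transpose C, A ** diagm (\<lambda>b. exp (d b)) **
      transpose A)
    = real n * real CARD('m2) * (ln ((det C)\<^sup>2) + (\<Sum>a\<in>UNIV. c a))
      + real n * real CARD('m1) * (ln ((det A)\<^sup>2) + (\<Sum>b\<in>UNIV. d b))
      - (\<Sum>i<n. \<Sum>a\<in>UNIV. \<Sum>b\<in>UNIV. ((transpose C ** Y i ** A) $ a $ b)\<^sup>2 * exp (c a + d b))"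
  using assms
  by (simp add: loglik_def ln_det_factored matrix_sum_ldistrib trace_sum trace_factored exp_add mult_ac)

text \<open>Stationarity of the log-likelihood in each argument, multiplied by the argument to avoid
  inverses.\<close>

definition likelihood_equations ::
  "nat \<Rightarrow> (nat \<Rightarrow> real^'m2^'m1) \<Rightarrow> real^'m1^'m1 \<Rightarrow> real^'m2^'m2 \<Rightarrow> bool" where
  "likelihood_equations n Y \<Psi>1 \<Psi>2 \<longleftrightarrow> \<Psi>1 \<in> PD \<and> \<Psi>2 \<in> PD \<and>
     \<Psi>1 ** (\<Sum>i<n. Y i ** \<Psi>2 ** transpose (Y i)) = (real n * real CARD('m2)) *\<^sub>R mat 1 \<and>
     \<Psi>2 ** (\<Sum>i<n. transpose (Y i) ** \<Psi>1 ** Y i) = (real n * real CARD('m1)) *\<^sub>R mat 1"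

lemma congruence_scalar:
  fixes C :: "real^'n^'n"
  assumes "det C \<noteq> 0" "C ** transpose C ** S = c *\<^sub>R mat 1"
  shows "transpose C ** S ** C = c *\<^sub>R mat 1"
proof -
  obtain B where B: "B ** C = mat 1" using invertible_obtain_inverse[OF assms(1)] by blast
  have "transpose C ** S ** C = B ** (C ** transpose C ** S) ** C"
    by (simp add: matrix_mul_assoc B)
  then show ?thesis by (simp add: assms(2) B)
qed

lemma diag_gram_nth:
  fixes Y :: "'i \<Rightarrow> real^'b^'a" and C :: "real^'c^'a" and A :: "real^'d^'b"
  shows "(transpose C ** (\<Sum>i\<in>I. Y i ** (A ** transpose A) ** transpose (Y i)) ** C) $ a $ a
    = (\<Sum>i\<in>I. \<Sum>b\<in>UNIV. ((transpose C ** Y i ** A) $ a $ b)\<^sup>2)"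
proof -
  have "transpose C ** (\<Sum>i\<in>I. Y i ** (A ** transpose A) ** transpose (Y i)) ** C
      = (\<Sum>i\<in>I. (transpose C ** Y i ** A) ** transpose (transpose C ** Y i ** A))"
    by (simp add: matrix_sum_ldistrib matrix_sum_rdistrib matrix_mul_assoc matrix_transpose_mul)
  moreover have "(X ** transpose X) $ a $ a = (\<Sum>b\<in>UNIV. (X $ a $ b)\<^sup>2)" for X :: "real^'d^'c"
    by (simp add: matrix_matrix_mult_def transpose_def power2_eq_square)
  ultimately show ?thesis by simp
qed

text \<open>In coordinates that diagonalise both the solution and a competitor, the log-likelihood is an
  affine function minus a sum of exponentials with nonnegative weights. The tangent inequality
  \<open>exp s \<ge> 1 + s\<close> bounds it by its linearisation at the solution, and the likelihood equations say
  precisely that the linear part vanishes.\<close>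

lemma likelihood_equations_imp_max:
  fixes Y :: "nat \<Rightarrow> real^'m2^'m1"
  assumes eqs: "likelihood_equations n Y \<Psi>1 \<Psi>2" and "\<Phi>1 \<in> PD" "\<Phi>2 \<in> PD"
  shows "loglik n Y (\<Phi>1, \<Phi>2) \<le> loglik n Y (\<Psi>1, \<Psi>2)"
proof -
  have "\<Psi>1 \<in> PD" "\<Psi>2 \<in> PD" using eqs by (auto simp: likelihood_equations_def)
  obtain C c where C: "det C \<noteq> 0" "\<Psi>1 = C ** transpose C"
    "\<Phi>1 = C ** diagm (\<lambda>i. exp (c i)) ** transpose C"
    using PD_simultaneous_diagonalization[OF \<open>\<Psi>1 \<in> PD\<close> \<open>\<Phi>1 \<in> PD\<close>] by blast
  obtain A d where A: "det A \<noteq> 0" "\<Psi>2 = A ** transpose A"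
    "\<Phi>2 = A ** diagm (\<lambda>i. exp (d i)) ** transpose A"
    using PD_simultaneous_diagonalization[OF \<open>\<Psi>2 \<in> PD\<close> \<open>\<Phi>2 \<in> PD\<close>] by blast
  define w where "w = (\<lambda>i a b. ((transpose C ** Y i ** A) $ a $ b)\<^sup>2)"
  have "transpose C ** (\<Sum>i<n. Y i ** (A ** transpose A) ** transpose (Y i)) ** C
      = (real n * real CARD('m2)) *\<^sub>R mat 1"
    using eqs C A(2) by (intro congruence_scalar) (auto simp: likelihood_equations_def)
  from arg_cong[OF this, of "\<lambda>X. X $ a $ a" for a]
  have rows: "(\<Sum>i<n. \<Sum>b\<in>UNIV. w i a b) = real n * real CARD('m2)" for a
    unfolding diag_gram_nth by (simp add: w_def mat_def)
  have gram: "transpose A ** (\<Sum>i<n. transpose (Y i) ** (C ** transpose C) ** Y i) ** A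
      = (real n * real CARD('m1)) *\<^sub>R mat 1"
    using eqs A C(2) by (intro congruence_scalar) (auto simp: likelihood_equations_def)
  have cols: "(\<Sum>i<n. \<Sum>a\<in>UNIV. w i a b) = real n * real CARD('m1)" for b
  proof -
    have "(transpose A ** transpose (Y i) ** C) $ b $ a = (transpose C ** Y i ** A) $ a $ b" for i a
    proof -
      have "transpose A ** transpose (Y i) ** C = transpose (transpose C ** Y i ** A)"
        by (simp add: matrix_transpose_mul matrix_mul_assoc)
      then show ?thesis by (simp add: transpose_def)
    qed
    then show ?thesis
      using arg_cong[OF gram, of "\<lambda>X. X $ b $ b"]
        diag_gram_nth[of A "\<lambda>i. transpose (Y i)" C "{..<n}" b]
      by (simp add: w_def mat_def)
  qed
  have linear: "(\<Sum>i<n. \<Sum>a\<in>UNIV. \<Sum>b\<in>UNIV. w i a b * (c a + d b))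
      = real n * real CARD('m2) * (\<Sum>a\<in>UNIV. c a) + real n * real CARD('m1) * (\<Sum>b\<in>UNIV. d b)"
  proof -
    have "(\<Sum>i<n. \<Sum>a\<in>UNIV. \<Sum>b\<in>UNIV. w i a b * (c a + d b))
       = (\<Sum>a\<in>UNIV. \<Sum>i<n. \<Sum>b\<in>UNIV. w i a b * c a) + (\<Sum>b\<in>UNIV. \<Sum>i<n. \<Sum>a\<in>UNIV. w i a b * d b)"
    proof -
      have "(\<Sum>i<n. \<Sum>a\<in>UNIV. \<Sum>b\<in>UNIV. w i a b * d b) = (\<Sum>i<n. \<Sum>b\<in>UNIV. \<Sum>a\<in>UNIV. w i a b * d b)"
        by (intro sum.cong refl sum.swap)
      also have "\<dots> = (\<Sum>b\<in>UNIV. \<Sum>i<n. \<Sum>a\<in>UNIV. w i a b * d b)"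
        by (rule sum.swap)
      finally show ?thesis
        using sum.swap[of "\<lambda>i a. \<Sum>b\<in>UNIV. w i a b * c a" UNIV "{..<n}"]
        by (simp add: distrib_left sum.distrib)
    qed
    also have "\<dots> = (\<Sum>a\<in>UNIV. real n * real CARD('m2) * c a) + (\<Sum>b\<in>UNIV. real n * real CARD('m1) * d b)"
      by (simp add: sum_distrib_right[symmetric] rows cols)
    finally show ?thesis by (simp add: sum_distrib_left)
  qed
  have "(\<Sum>i<n. \<Sum>a\<in>UNIV. \<Sum>b\<in>UNIV. w i a b * (1 + (c a + d b)))
      \<le> (\<Sum>i<n. \<Sum>a\<in>UNIV. \<Sum>b\<in>UNIV. w i a b * exp (c a + d b))"
    by (intro sum_mono mult_left_mono) (auto simp: w_def)
  then have "(\<Sum>i<n. \<Sum>a\<in>UNIV. \<Sum>b\<in>UNIV. w i a b)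
      + (\<Sum>i<n. \<Sum>a\<in>UNIV. \<Sum>b\<in>UNIV. w i a b * (c a + d b))
      \<le> (\<Sum>i<n. \<Sum>a\<in>UNIV. \<Sum>b\<in>UNIV. w i a b * exp (c a + d b))"
    by (simp only: distrib_left[of _ 1] sum.distrib mult_1_right)
  then show ?thesis
    using loglik_factored[OF C(1) A(1), of n Y c d] loglik_factored[OF C(1) A(1), of n Y "\<lambda>_. 0"
        "\<lambda>_. 0"]
    unfolding linear unfolding w_def
    by (simp add: C(2,3) A(2,3) diagm_1 algebra_simps)
qed

lemma likelihood_equations_imp_exists:
  "likelihood_equations n Y \<Psi>1 \<Psi>2 \<Longrightarrow> mle_exists n Y"
  using likelihood_equations_imp_max
  by (fastforce simp: mle_exists_def likelihood_equations_def)

lemma mle_exists_imp_bounded: "mle_exists n Y \<Longrightarrow> loglik_bounded n Y"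
  by (auto simp: mle_exists_def loglik_bounded_def bdd_above_def)

text \<open>Fix a diagonal entry of the second factors and compare; the one of \<open>\<Phi>1\<close> is positive.\<close>

lemma kronecker_eq_imp_proportional:
  fixes \<Psi>1 \<Phi>1 :: "real^'b^'b" and \<Psi>2 \<Phi>2 :: "real^'a^'a"
  assumes "kronecker \<Psi>2 \<Psi>1 = kronecker \<Phi>2 \<Phi>1" "\<Phi>1 \<in> PD"
  shows "\<exists>c. \<Phi>2 = c *\<^sub>R \<Psi>2"
proof -
  fix a :: 'b
  have pos: "\<Phi>1 $ a $ a > 0"
    using PD_D(2)[OF assms(2), of "axis a 1"]
    by (simp add: matrix_vector_mult_basis inner_axis' column_def)
  have "\<Psi>2 $ i $ j * \<Psi>1 $ a $ a = \<Phi>2 $ i $ j * \<Phi>1 $ a $ a" for i j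
    using arg_cong[OF assms(1), of "\<lambda>K. K $ (i, a) $ (j, a)"] by (simp add: kronecker_def)
  then have "\<Phi>2 = (\<Psi>1 $ a $ a / \<Phi>1 $ a $ a) *\<^sub>R \<Psi>2"
    using pos by (simp add: vec_eq_iff field_simps)
  then show ?thesis by blast
qed

lemma not_unique_if_two_solutions:
  assumes "likelihood_equations n Y \<Psi>1 \<Psi>2" "likelihood_equations n Y \<Phi>1 \<Phi>2"
    and "\<And>c. \<Phi>2 \<noteq> c *\<^sub>R \<Psi>2"
  shows "\<not> mle_exists_uniquely n Y"
proof
  assume uniq: "mle_exists_uniquely n Y"
  have "local_max_on (loglik n Y) (PD \<times> PD) (P1, P2)" if "likelihood_equations n Y P1 P2" for P1 P2
    using that likelihood_equations_imp_max[OF that]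
    by (auto simp: local_max_on_def likelihood_equations_def eventually_at_topological)
  then have "kronecker \<Psi>2 \<Psi>1 = kronecker \<Phi>2 \<Phi>1"
    using uniq assms(1,2) unfolding mle_exists_uniquely_def by blast
  then show False
    using kronecker_eq_imp_proportional[of \<Psi>2 \<Psi>1 \<Phi>2 \<Phi>1] assms
    by (auto simp: likelihood_equations_def)
qed

text \<open>A vector \<open>v\<close> orthogonal to all columns of the sample matrices makes the quadratic part blind
  to the direction \<open>v v\<^sup>T\<close> of \<open>\<Psi>\<^sub>1\<close>, along which the determinant grows.\<close>

lemma unbounded_if_small_sample:
  fixes Y :: "nat \<Rightarrow> real^'m2^'m1"
  assumes "n > 0" "n * CARD('m2) < CARD('m1)"
  shows "\<not> loglik_bounded n Y"
proof
  assume "loglik_bounded n Y"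
  then obtain K where K: "\<And>P1 P2. P1 \<in> PD \<Longrightarrow> P2 \<in> PD \<Longrightarrow> loglik n Y (P1, P2) \<le> K"
    by (force simp: loglik_bounded_def bdd_above_def)
  define T where "T = (\<lambda>(i, b). column b (Y i)) ` ({..<n} \<times> UNIV)"
  have "card T \<le> n * CARD('m2)"
    unfolding T_def by (rule order_trans[OF card_image_le]) (auto simp: card_cartesian_product)
  moreover have "finite T" by (simp add: T_def)
  ultimately have "dim T < DIM(real^'m1)"
    using dim_le_card'[of T] assms(2) by simp
  then obtain v where v: "v \<noteq> 0" "\<And>y. y \<in> span T \<Longrightarrow> orthogonal v y"
    using orthogonal_to_subspace_exists by blast
  have vY: "v v* Y i = 0" if "i < n" for i
  proof -
    have "(v v* Y i) $ b = 0" for b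
    proof -
      have "orthogonal v (column b (Y i))"
        using that by (intro v(2) span_base) (auto simp: T_def)
      then show ?thesis
        by (simp add: orthogonal_def vector_matrix_mult_def inner_vec_def column_def mult.commute)
    qed
    then show ?thesis by (simp add: vec_eq_iff)
  qed
  define V where "V = (\<chi> i j. v $ i * v $ j)"
  have quad: "x \<bullet> (V *v x) = (v \<bullet> x)\<^sup>2" for x
  proof -
    have "V *v x = (v \<bullet> x) *\<^sub>R v"
      by (simp add: vec_eq_iff V_def matrix_vector_mult_def inner_vec_def sum_distrib_left
          sum_distrib_right mult_ac)
    then show ?thesis by (simp add: power2_eq_square inner_commute)
  qed
  have symV: "transpose V = V" by (simp add: V_def transpose_def vec_eq_iff mult.commute)
  have trV: "trace V = v \<bullet> v" by (simp add: trace_def V_def inner_vec_def)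
  have VY: "V ** Y i = 0" if "i < n" for i
  proof -
    have "(V ** Y i) $ a $ b = v $ a * (v v* Y i) $ b" for a b
      by (simp add: V_def matrix_matrix_mult_def vector_matrix_mult_def sum_distrib_left mult_ac)
    then show ?thesis using vY[OF that] by (simp add: vec_eq_iff)
  qed
  define t where "t = trace (\<Sum>i<n. Y i ** transpose (Y i))"
  have lower: "real n * real CARD('m2) * ln (1 + s) - t \<le> K" if "s \<ge> 0" for s
  proof -
    define r where "r = s / (v \<bullet> v)"
    have "r \<ge> 0" using that by (simp add: r_def)
    define P where "P = mat 1 + r *\<^sub>R V"
    have psd: "x \<bullet> ((r *\<^sub>R V) *v x) \<ge> 0" for x
      using \<open>r \<ge> 0\<close> by (simp add: scaleR_matrix_vector_assoc[symmetric] quad)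
    have symP: "transpose (r *\<^sub>R V) = r *\<^sub>R V" by (simp add: transpose_scalar symV)
    have PPD: "P \<in> PD"
      unfolding PD_def
    proof (intro CollectI conjI allI impI)
      show "transpose P = P" by (simp add: P_def transpose_add symP)
      fix x :: "real^'m1" assume "x \<noteq> 0"
      then have "0 < x \<bullet> x" by simp
      with psd[of x] show "0 < x \<bullet> (P *v x)"
        unfolding P_def matrix_vector_mult_add_rdistrib inner_add_right matrix_vector_mul_lid
        by (intro add_pos_nonneg)
    qed
    have "1 + s \<le> det P"
      using det_one_plus_ge_trace[OF symP psd] v(1) by (simp add: P_def trace_scaleR trV r_def)
    then have "ln (1 + s) \<le> ln (det P)" using that by simp
    then have "real n * real CARD('m2) * ln (1 + s) \<le> real n * real CARD('m2) * ln (det P)"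
      by (intro mult_left_mono) auto
    moreover have "P ** (\<Sum>i<n. Y i ** transpose (Y i)) = (\<Sum>i<n. Y i ** transpose (Y i))"
      by (simp add: P_def matrix_add_rdistrib matrix_sum_ldistrib matrix_mul_assoc VY)
    ultimately show ?thesis
      using K[OF PPD mat_1_PD] by (simp add: loglik_def t_def)
  qed
  define N where "N = real n * real CARD('m2)"
  have "N > 0" using assms by (simp add: N_def)
  \<comment> \<open>This \<open>s\<close> makes the lower bound exceed \<open>K\<close>.\<close>
  have "N * ((\<bar>K + t\<bar> + 1) / N) - t \<le> K"
    using lower[of "exp ((\<bar>K + t\<bar> + 1) / N) - 1"] \<open>N > 0\<close> by (simp add: N_def)
  then show False using \<open>N > 0\<close> by simp
qed

lemma tendsto_matrix_mult [tendsto_intros]: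
  fixes f :: "'x \<Rightarrow> real^'b^'a" and g :: "'x \<Rightarrow> real^'c^'b"
  assumes "(f \<longlongrightarrow> A) F" "(g \<longlongrightarrow> B) F"
  shows "((\<lambda>x. f x ** g x) \<longlongrightarrow> A ** B) F"
  unfolding matrix_matrix_mult_def by (intro tendsto_intros assms)

lemma tendsto_diagm [tendsto_intros]:
  assumes "\<And>i. ((\<lambda>x. d x i) \<longlongrightarrow> (l i :: real)) F"
  shows "((\<lambda>x. diagm (d x)) \<longlongrightarrow> diagm l) F"
  unfolding diagm_def by (intro tendsto_vec_lambda) (auto intro: assms)

lemma factored_PD:
  "det C \<noteq> 0 \<Longrightarrow> C ** diagm (\<lambda>a. exp (c a)) ** transpose C \<in> PD"
  by (intro congruence_PD' diagm_PD) auto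

lemma local_max_along_path:
  fixes f :: "'a::topological_space \<Rightarrow> real" and g :: "real \<Rightarrow> 'a"
  assumes "local_max_on f S (g t)" "\<And>s. g s \<in> S" "(g \<longlongrightarrow> g t) (at t)"
  obtains e where "e > 0" "\<And>s. \<bar>t - s\<bar> < e \<Longrightarrow> f (g s) \<le> f (g t)"
proof -
  have "eventually (\<lambda>y. y \<in> S \<longrightarrow> f y \<le> f (g t)) (nhds (g t))"
    using assms(1) unfolding local_max_on_def eventually_at_filter
    by (auto elim: eventually_mono)
  then have "eventually (\<lambda>s. g s \<in> S \<longrightarrow> f (g s) \<le> f (g t)) (at t)"
    using assms(3) by (auto simp: filterlim_iff)
  then have "eventually (\<lambda>s. f (g s) \<le> f (g t)) (at t)"
    using assms(2) by simp
  then obtain e where "e > 0" "\<And>s. s \<noteq> t \<Longrightarrow> dist s t < e \<Longrightarrow> f (g s) \<le> f (g t)"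
    by (auto simp: eventually_at)
  then show thesis
    by (intro that[of e]) (metis dist_real_def abs_minus_commute order_refl)+
qed

text \<open>Along the curve that joins two local maxima the log-likelihood is \<open>\<alpha> + \<beta> t - \<Sum> w e\<^sup>t\<^sup>s\<close>. Its
  derivative vanishes at both ends, and subtracting the two equations gives \<open>\<Sum> w s (e\<^sup>s - 1) = 0\<close>
  with nonnegative terms: every exponent \<open>s = c\<^sub>a + d\<^sub>b\<close> that occurs is zero.\<close>

lemma two_local_maxima:
  fixes Y :: "nat \<Rightarrow> real^'m2^'m1"
  assumes max: "local_max_on (loglik n Y) (PD \<times> PD) (\<Psi>1, \<Psi>2)"
    "local_max_on (loglik n Y) (PD \<times> PD) (\<Phi>1, \<Phi>2)"
  obtains C c A d where "det C \<noteq> 0" "det A \<noteq> 0"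
    "\<Psi>1 = C ** transpose C" "\<Phi>1 = C ** diagm (\<lambda>i. exp (c i)) ** transpose C"
    "\<Psi>2 = A ** transpose A" "\<Phi>2 = A ** diagm (\<lambda>i. exp (d i)) ** transpose A"
    "\<And>i. i < n \<Longrightarrow> diagm c ** (transpose C ** Y i ** A) + (transpose C ** Y i ** A) ** diagm d = 0"
proof -
  have PD: "\<Psi>1 \<in> PD" "\<Psi>2 \<in> PD" "\<Phi>1 \<in> PD" "\<Phi>2 \<in> PD"
    using max by (auto simp: local_max_on_def)
  obtain C c where C: "det C \<noteq> 0" "\<Psi>1 = C ** transpose C"
    "\<Phi>1 = C ** diagm (\<lambda>i. exp (c i)) ** transpose C"
    using PD_simultaneous_diagonalization[OF PD(1,3)] by blast
  obtain A d where A: "det A \<noteq> 0" "\<Psi>2 = A ** transpose A"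
    "\<Phi>2 = A ** diagm (\<lambda>i. exp (d i)) ** transpose A"
    using PD_simultaneous_diagonalization[OF PD(2,4)] by blast
  define w where "w = (\<lambda>i a b. ((transpose C ** Y i ** A) $ a $ b)\<^sup>2)"
  define g where "g = (\<lambda>t. (C ** diagm (\<lambda>a. exp (t * c a)) ** transpose C,
    A ** diagm (\<lambda>b. exp (t * d b)) ** transpose A))"
  define \<beta> where "\<beta> = real n * real CARD('m2) * (\<Sum>a\<in>UNIV. c a) + real n * real CARD('m1) *
      (\<Sum>b\<in>UNIV. d b)"
  have gS: "g t \<in> PD \<times> PD" for t
    using factored_PD[OF C(1), of "\<lambda>a. t * c a"] factored_PD[OF A(1), of "\<lambda>b. t * d b"]
    by (simp add: g_def)
  have gcont: "(g \<longlongrightarrow> g t) (at t)" for t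
    unfolding g_def by (intro tendsto_intros)
  define \<alpha> where "\<alpha> = real n * real CARD('m2) * ln ((det C)\<^sup>2) + real n * real CARD('m1) * ln
      ((det A)\<^sup>2)"
  have eq: "loglik n Y (g t) = \<alpha> + \<beta> * t
      - (\<Sum>i<n. \<Sum>a\<in>UNIV. \<Sum>b\<in>UNIV. w i a b * exp (t * (c a + d b)))" for t
    unfolding g_def loglik_factored[OF C(1) A(1)]
    by (simp add: w_def \<alpha>_def \<beta>_def sum_distrib_left[symmetric] algebra_simps)
  have deriv: "((\<lambda>t. loglik n Y (g t)) has_real_derivative \<beta>
      - (\<Sum>i<n. \<Sum>a\<in>UNIV. \<Sum>b\<in>UNIV. w i a b * ((c a + d b) * exp (t * (c a + d b))))) (at t)" for t
    unfolding eq by (auto intro!: derivative_eq_intros sum.cong)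
  have critical: "\<beta> = (\<Sum>i<n. \<Sum>a\<in>UNIV. \<Sum>b\<in>UNIV. w i a b * ((c a + d b) * exp (t * (c a + d b))))"
    if lm: "local_max_on (loglik n Y) (PD \<times> PD) (g t)" for t
  proof -
    obtain e where "e > 0" "\<And>s. \<bar>t - s\<bar> < e \<Longrightarrow> loglik n Y (g s) \<le> loglik n Y (g t)"
      using local_max_along_path[OF lm gS gcont] by blast
    then show ?thesis using DERIV_local_max[OF deriv, of e] by simp
  qed
  have "g 0 = (\<Psi>1, \<Psi>2)" "g 1 = (\<Phi>1, \<Phi>2)"
    by (simp_all add: g_def C(2,3) A(2,3) diagm_1)
  then have "(\<Sum>i<n. \<Sum>a\<in>UNIV. \<Sum>b\<in>UNIV. w i a b * (c a + d b))
      = (\<Sum>i<n. \<Sum>a\<in>UNIV. \<Sum>b\<in>UNIV. w i a b * ((c a + d b) * exp (c a + d b)))"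
    using critical[of 0] critical[of 1] max by simp
  then have zero: "(\<Sum>i<n. \<Sum>a\<in>UNIV. \<Sum>b\<in>UNIV. w i a b * ((c a + d b) * (exp (c a + d b) - 1))) = 0"
    by (simp add: right_diff_distrib sum_subtractf)
  have mono: "s * (exp s - 1) \<ge> 0" for s :: real
    by (cases "s \<ge> 0") (auto intro: mult_nonneg_nonneg mult_nonpos_nonpos)
  have nn: "w i a b * ((c a + d b) * (exp (c a + d b) - 1)) \<ge> 0" for i a b
    using mono by (simp add: w_def)
  have each: "w i a b * ((c a + d b) * (exp (c a + d b) - 1)) = 0" if "i < n" for i a b
  proof -
    have "(\<Sum>a\<in>UNIV. \<Sum>b\<in>UNIV. w i a b * ((c a + d b) * (exp (c a + d b) - 1))) = 0"
      using zero that by (subst (asm) sum_nonneg_eq_0_iff) (auto intro!: sum_nonneg nn)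
    then have "(\<Sum>b\<in>UNIV. w i a b * ((c a + d b) * (exp (c a + d b) - 1))) = 0"
      by (subst (asm) sum_nonneg_eq_0_iff) (auto intro!: sum_nonneg nn)
    then show ?thesis
      by (subst (asm) sum_nonneg_eq_0_iff) (auto intro!: nn)
  qed
  have "diagm c ** (transpose C ** Y i ** A) + (transpose C ** Y i ** A) ** diagm d
      = 0" if "i < n" for i
  proof -
    have "c a * (transpose C ** Y i ** A) $ a $ b + (transpose C ** Y i ** A) $ a $ b * d b = 0" for a b
    proof (cases "(transpose C ** Y i ** A) $ a $ b = 0")
      case False
      then have "c a + d b = 0" using each[OF that, of a b] by (auto simp: w_def)
      then show ?thesis by (metis distrib_right mult.commute mult_zero_left)
    qed simp
    then show ?thesis by (simp add: vec_eq_iff diagm_mult_nth matrix_mult_diagm_nth)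
  qed
  with C A show thesis using that by blast
qed

lemma ln_det_inverse:
  fixes R T :: "real^'m^'m"
  assumes "R ** T = mat 1" "R \<in> PD" "T \<in> PD" "c > 0"
  shows "ln (det (c *\<^sub>R R)) = CARD('m) * ln c - ln (det T)"
proof -
  have "det R * det T = 1" using arg_cong[OF assms(1), of det] by (simp add: det_mul)
  then have "ln (det R) = - ln (det T)"
    using PD_det_pos[OF assms(2)] PD_det_pos[OF assms(3)]
    by (metis add_eq_0_iff2 less_irrefl ln_mult ln_one)
  then show ?thesis
    using PD_det_pos[OF assms(2)] assms(4) by (simp add: det_scaleR ln_mult ln_realpow)
qed

text \<open>For fixed \<open>T\<close> the maximiser of \<open>c log det P - tr(P T)\<close> is \<open>P = c T\<^sup>-\<^sup>1\<close>.\<close>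

lemma logdet_minus_trace_le:
  fixes P T :: "real^'m^'m"
  assumes "P \<in> PD" "T \<in> PD" "c > 0"
  shows "c * ln (det P) - trace (P ** T) \<le> c * (CARD('m) * ln c - ln (det T) - CARD('m))"
proof -
  obtain R where R: "R \<in> PD" "T ** R = mat 1" "R ** T = mat 1"
    using PD_inverse[OF assms(2)] by blast
  obtain C v where C: "det C \<noteq> 0" "c *\<^sub>R R = C ** transpose C"
    "P = C ** diagm (\<lambda>i. exp (v i)) ** transpose C"
    using PD_simultaneous_diagonalization[OF scaleR_PD[OF R(1) assms(3)] assms(1)] by blast
  have "C ** transpose C ** T = c *\<^sub>R mat 1"
    by (simp add: C(2)[symmetric] R(3))
  from congruence_scalar[OF C(1) this] have CTC: "transpose C ** T ** C = c *\<^sub>R mat 1" .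
  have "trace (P ** T) = trace (C ** (diagm (\<lambda>i. exp (v i)) ** transpose C ** T))"
    by (simp add: C(3) matrix_mul_assoc)
  also have "\<dots> = trace (diagm (\<lambda>i. exp (v i)) ** (transpose C ** T ** C))"
    by (subst trace_mul_sym) (simp add: matrix_mul_assoc)
  also have "\<dots> = c * (\<Sum>i\<in>UNIV. exp (v i))"
    by (simp add: CTC trace_scaleR)
  finally have tr: "trace (P ** T) = c * (\<Sum>i\<in>UNIV. exp (v i))" .
  have "ln (det (c *\<^sub>R R)) = CARD('m) * ln c - ln (det T)"
    by (rule ln_det_inverse[OF R(3,1) assms(2,3)])
  moreover have "det (c *\<^sub>R R) = (det C)\<^sup>2" by (simp add: C(2) det_mul power2_eq_square)
  ultimately have lnP: "ln (det P) = CARD('m) * ln c - ln (det T) + (\<Sum>i\<in>UNIV. v i)"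
    by (simp add: C(3) ln_det_factored[OF C(1)])
  have "(\<Sum>i\<in>UNIV. v i + 1) \<le> (\<Sum>i\<in>UNIV. exp (v i))"
    by (intro sum_mono) (simp add: add.commute)
  then have "c * (\<Sum>i\<in>UNIV. v i + 1) \<le> c * (\<Sum>i\<in>UNIV. exp (v i))"
    using assms(3) by (intro mult_left_mono) auto
  then show ?thesis
    by (simp add: lnP tr sum.distrib algebra_simps)
qed

lemma logdet_minus_trace_eq:
  fixes T R :: "real^'m^'m"
  assumes "T \<in> PD" "R \<in> PD" "T ** R = mat 1" "c > 0"
  shows "c * ln (det (c *\<^sub>R R)) - trace ((c *\<^sub>R R) ** T)
      = c * (CARD('m) * ln c - ln (det T) - CARD('m))"
proof -
  have RT: "R ** T = mat 1" using assms(3) by (simp add: matrix_right_inverse_commute)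
  show ?thesis
    unfolding ln_det_inverse[OF RT assms(2,1,4)] by (simp add: RT trace_scaleR trace_I algebra_simps)
qed

section \<open>Splitting the rows into blocks\<close>

text \<open>The map \<open>h\<close> identifies the row index with a block number below \<open>k\<close> and a position in the
  block, so that \<open>real^'m1\<close> becomes a sum of \<open>k\<close> copies of \<open>real^'m2\<close> with inclusions \<open>incl j\<close>. The
  matrix \<open>concat_samples Y\<close> is the \<open>W\<close> of the comments.\<close>

locale row_blocks =
  fixes h :: "'m1::finite \<Rightarrow> nat \<times> 'm2::finite" and k :: nat
  assumes h: "bij_betw h UNIV ({..<k} \<times> UNIV)"
begin

definition incl :: "nat \<Rightarrow> real^'m2^'m1" where
  "incl j = (\<chi> q b. if h q = (j, b) then 1 else 0)"

definition concat_samples :: "(nat \<Rightarrow> real^'m2^'m1) \<Rightarrow> real^'m1^'m1" where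
  "concat_samples Y = (\<Sum>j<k. Y j ** transpose (incl j))"

definition block_diag :: "real^'m2^'m2 \<Rightarrow> real^'m1^'m1" where
  "block_diag B = (\<Sum>j<k. incl j ** B ** transpose (incl j))"

lemma h_index:
  assumes "j < k"
  obtains q where "h q = (j, b)"
proof -
  have "(j, b) \<in> range h" using h assms by (auto simp: bij_betw_def)
  then show thesis using that by (metis imageE)
qed

lemma h_inj: "h q = h r \<longleftrightarrow> q = r"
  using h by (auto simp: bij_betw_def inj_on_def)

lemma h_fst: "fst (h q) < k"
  using bij_betwE[OF h] by (auto simp: mem_Times_iff)

lemma card_rows: "CARD('m1) = k * CARD('m2)"
  using bij_betw_same_card[OF h] by (simp add: card_cartesian_product)

lemma incl_orthonormal:
  assumes "j < k" "l < k"
  shows "transpose (incl j) ** incl l = (if j = l then mat 1 else 0)"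
proof -
  have "(\<Sum>q\<in>UNIV. (if h q = (j, b) then 1 else 0) * (if h q = (l, c) then 1 else 0))
      = (if j = l \<and> b = c then 1 else (0::real))" for b c
  proof -
    obtain r where r: "h r = (j, b)" using h_index assms(1) by metis
    have "h q = (j, b) \<longleftrightarrow> q = r" for q using h_inj[of q r] r by simp
    then have "(\<Sum>q\<in>UNIV. (if h q = (j, b) then 1 else 0) * (if h q = (l, c) then 1 else (0::real)))
        = (\<Sum>q\<in>UNIV. if q = r then (if h q = (l, c) then 1 else 0) else 0)"
      by (intro sum.cong) auto
    also have "\<dots> = (if h r = (l, c) then 1 else 0)" by (subst sum.delta) auto
    finally show ?thesis by (simp add: r)
  qed
  then show ?thesis
    by (simp add: vec_eq_iff matrix_matrix_mult_def transpose_def incl_def mat_def)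
qed

lemma incl_complete: "(\<Sum>j<k. incl j ** transpose (incl j)) = mat 1"
proof -
  have "(\<Sum>j<k. (\<Sum>b\<in>UNIV. (if h q = (j, b) then 1 else 0) * (if h r = (j, b) then 1 else 0)))
      = (if q = r then 1 else (0::real))" for q r
  proof -
    have "(\<Sum>j<k. (\<Sum>b\<in>UNIV. (if h q = (j, b) then 1 else 0) * (if h r = (j, b) then 1 else (0::real))))
        = (\<Sum>p\<in>{..<k} \<times> UNIV. (if h q = p then 1 else 0) * (if h r = p then 1 else 0))"
      by (simp add: sum.cartesian_product case_prod_unfold)
    also have "\<dots> = (\<Sum>p\<in>{..<k} \<times> UNIV. if h q = p then (if h r = p then 1 else 0) else 0)"
      by (intro sum.cong) auto
    also have "\<dots> = (if h r = h q then 1 else 0)"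
      using h_fst[of q] by (subst sum.delta') (auto simp: mem_Times_iff)
    finally show ?thesis using h_inj[of r q] by auto
  qed
  then show ?thesis
    by (simp add: vec_eq_iff matrix_matrix_mult_def transpose_def incl_def mat_def sum_component)
qed

lemma concat_samples_incl: "j < k \<Longrightarrow> concat_samples Y ** incl j = Y j"
  unfolding concat_samples_def matrix_sum_rdistrib
  by (simp add: matrix_mul_assoc[symmetric] incl_orthonormal if_distrib cong: if_cong)

lemma concat_samples_nth: "concat_samples Y $ a $ q = Y (fst (h q)) $ a $ snd (h q)"
proof -
  have "concat_samples Y $ a $ q = (\<Sum>j<k. \<Sum>b\<in>UNIV. Y j $ a $ b * (if h q = (j, b) then 1 else 0))"
    by (simp add: concat_samples_def sum_component matrix_matrix_mult_def transpose_def incl_def)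
  also have "\<dots> = (\<Sum>p\<in>{..<k} \<times> UNIV. if h q = p then Y (fst p) $ a $ snd p else 0)"
    by (simp add: sum.cartesian_product case_prod_unfold if_distrib cong: if_cong)
  also have "\<dots> = Y (fst (h q)) $ a $ snd (h q)"
    using h_fst[of q] by (subst sum.delta') (auto simp: mem_Times_iff)
  finally show ?thesis .
qed

lemma block_diag_incl: "j < k \<Longrightarrow> block_diag B ** incl j = incl j ** B"
  unfolding block_diag_def matrix_sum_rdistrib
  by (simp add: matrix_mul_assoc[symmetric] incl_orthonormal if_distrib cong: if_cong)

lemma block_diag_mult: "block_diag A ** block_diag B = block_diag (A ** B)"
proof -
  have "block_diag A ** block_diag B = (\<Sum>j<k. block_diag A ** incl j ** B ** transpose (incl j))"
    by (simp add: block_diag_def[of B] matrix_sum_ldistrib matrix_mul_assoc)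
  also have "\<dots> = (\<Sum>j<k. incl j ** (A ** B) ** transpose (incl j))"
    by (intro sum.cong) (auto simp: block_diag_incl matrix_mul_assoc)
  finally show ?thesis by (simp only: block_diag_def)
qed

lemma block_diag_1 [simp]: "block_diag (mat 1) = mat 1"
  by (simp add: block_diag_def incl_complete)

lemma transpose_block_diag: "transpose (block_diag B) = block_diag (transpose B)"
  by (simp add: block_diag_def transpose_sum matrix_transpose_mul matrix_mul_assoc)

lemma det_block_diag_nz: assumes "det B \<noteq> 0" shows "det (block_diag B) \<noteq> 0"
proof -
  obtain B' where "B ** B' = mat 1" using invertible_obtain_inverse[OF assms] by blast
  then have "block_diag B ** block_diag B' = mat 1" by (simp add: block_diag_mult)
  then show ?thesis by (metis det_I det_mul mult_zero_left zero_neq_one)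
qed

lemma block_diag_PD: assumes "P \<in> PD" shows "block_diag P \<in> PD"
proof -
  obtain B where B: "det B \<noteq> 0" "P = B ** transpose B" using PD_factor[OF assms] by blast
  then show ?thesis
    using gram_PD[OF det_block_diag_nz[OF B(1)]] by (simp add: transpose_block_diag block_diag_mult)
qed

text \<open>The spectral theorem reduces this to diagonal matrices.\<close>

lemma det_block_diag_PD:
  assumes "P \<in> PD" shows "det (block_diag P) = det P ^ k"
proof -
  obtain Q d where Q: "orthogonal_matrix Q" "P = Q ** diagm d ** transpose Q"
    using PD_diagonalizable[OF assms] by blast
  have QQ: "Q ** transpose Q = mat 1" using Q(1) by (simp add: orthogonal_matrix_def)
  have "block_diag Q ** block_diag (transpose Q) = mat 1" by (simp add: block_diag_mult QQ)
  from arg_cong[OF this, of det] have d1: "det (block_diag Q) * det (block_diag Q) = 1"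
    by (simp add: det_mul flip: transpose_block_diag)
  from arg_cong[OF QQ, of det] have d2: "det Q * det Q = 1" by (simp add: det_mul)
  have "block_diag (diagm d) = diagm (\<lambda>q. d (snd (h q)))"
  proof -
    have col: "block_diag (diagm d) *v axis q 1 = diagm (\<lambda>q. d (snd (h q))) *v axis q 1" for q
    proof -
      obtain j b where jb: "h q = (j, b)" by fastforce
      then have "j < k" using h_fst[of q] by simp
      have ax: "axis q 1 = incl j *v axis b 1"
        unfolding matrix_vector_mult_basis
        by (auto simp: vec_eq_iff column_def incl_def axis_def h_inj simp flip: jb)
      have "diagm d *v axis b 1 = d b *\<^sub>R axis b 1"
        by (simp add: vec_eq_iff diagm_mult_vec_nth axis_def)
      then have "block_diag (diagm d) *v axis q 1 = d b *\<^sub>R axis q 1"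
        unfolding ax matrix_vector_mul_assoc block_diag_incl[OF \<open>j < k\<close>]
        by (simp add: matrix_vector_mul_assoc[symmetric] matrix_vector_mult_scaleR
            del: matrix_vector_mult_basis)
      then show ?thesis by (simp add: vec_eq_iff diagm_mult_vec_nth axis_def jb)
    qed
    then show ?thesis
      by (simp add: matrix_vector_mult_basis column_def vec_eq_iff)
  qed
  then have "det (block_diag (diagm d)) = (\<Prod>q\<in>UNIV. d (snd (h q)))" by simp
  also have "\<dots> = (\<Prod>p\<in>{..<k} \<times> UNIV. d (snd p))"
    by (rule prod.reindex_bij_betw[OF h])
  also have "\<dots> = (\<Prod>j<k. \<Prod>b\<in>UNIV. d b)"
    unfolding prod.cartesian_product case_prod_unfold ..
  also have "\<dots> = (\<Prod>b\<in>UNIV. d b) ^ k" by simp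
  finally have d3: "det (block_diag (diagm d)) = (\<Prod>b\<in>UNIV. d b) ^ k" .
  have "block_diag P = block_diag Q ** block_diag (diagm d) ** transpose (block_diag Q)"
    by (simp add: Q(2) block_diag_mult transpose_block_diag)
  then have "det (block_diag P) = (\<Prod>b\<in>UNIV. d b) ^ k * (det (block_diag Q) * det (block_diag Q))"
    by (simp add: det_mul d3 mult_ac)
  moreover have "det P = (\<Prod>b\<in>UNIV. d b) * (det Q * det Q)"
    by (simp add: Q(2) det_mul mult_ac)
  ultimately show ?thesis by (simp add: d1 d2)
qed

end

text \<open>The likelihood equations are equivariant under \<open>Y \<mapsto> L Y\<close>.\<close>

lemma likelihood_equations_left_mult:
  fixes Y :: "nat \<Rightarrow> real^'m2^'m1"
  assumes "likelihood_equations n (\<lambda>i. L ** Y i) \<Psi>1 \<Psi>2" "det L \<noteq> 0"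
  shows "likelihood_equations n Y (transpose L ** \<Psi>1 ** L) \<Psi>2"
proof -
  obtain R where R: "L ** R = mat 1" using invertible_obtain_inverse[OF assms(2)] by blast
  have RL: "transpose R ** transpose L = mat 1" using R by (metis matrix_transpose_mul transpose_mat)
  then have LR: "transpose L ** transpose R = mat 1"
    by (simp add: matrix_right_inverse_commute)
  define S where "S = (\<Sum>i<n. Y i ** \<Psi>2 ** transpose (Y i))"
  have "\<Psi>1 ** (L ** S ** transpose L) = (real n * real CARD('m2)) *\<^sub>R mat 1"
    using assms(1)
    by (simp add: likelihood_equations_def S_def matrix_sum_ldistrib matrix_sum_rdistrib
        matrix_mul_assoc matrix_transpose_mul)
  then have "transpose L ** (\<Psi>1 ** (L ** S ** transpose L)) ** transpose R
      = (real n * real CARD('m2)) *\<^sub>R mat 1"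
    by (simp add: LR)
  moreover have "transpose L ** (\<Psi>1 ** (L ** S ** transpose L)) ** transpose R
      = transpose L ** \<Psi>1 ** L ** S ** (transpose L ** transpose R)"
    by (simp add: matrix_mul_assoc)
  ultimately have "transpose L ** \<Psi>1 ** L ** S = (real n * real CARD('m2)) *\<^sub>R mat 1"
    by (simp add: LR)
  moreover have "transpose L ** \<Psi>1 ** L \<in> PD"
    using assms by (intro congruence_PD) (auto simp: likelihood_equations_def)
  ultimately show ?thesis
    using assms(1)
    by (simp add: likelihood_equations_def S_def[symmetric] matrix_mul_assoc matrix_transpose_mul)
qed

context row_blocks
begin

text \<open>After multiplication by \<open>W\<^sup>-\<^sup>1\<close> the observations are the \<open>k\<close> inclusions. For any \<open>\<Psi>\<^sub>2\<close> the
  first equation has the solution \<open>k m\<^sub>2 (1 \<otimes> \<Psi>\<^sub>2\<^sup>-\<^sup>1)\<close>, and its \<open>k\<close> diagonal blocks add up to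
  what the second equation requires.\<close>

lemma likelihood_equations_square:
  assumes "det (concat_samples Y) \<noteq> 0" "\<Psi>2 \<in> PD" "k > 0"
  shows "\<exists>\<Psi>1. likelihood_equations k Y \<Psi>1 \<Psi>2"
proof -
  obtain L where L: "L ** concat_samples Y = mat 1" "det L \<noteq> 0"
    using invertible_obtain_inverse[OF assms(1)] by blast
  have LY: "L ** Y j = incl j" if "j < k" for j
    using L(1) concat_samples_incl[OF that, of Y] by (metis matrix_mul_assoc matrix_mul_lid)
  obtain R where R: "R \<in> PD" "\<Psi>2 ** R = mat 1" "R ** \<Psi>2 = mat 1"
    using PD_inverse[OF assms(2)] by blast
  define c where "c = real k * real CARD('m2)"
  have "c > 0" using assms(3) by (simp add: c_def)
  have "likelihood_equations k (\<lambda>i. L ** Y i) (c *\<^sub>R block_diag R) \<Psi>2"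
    unfolding likelihood_equations_def
  proof (intro conjI)
    have "(\<Sum>i<k. L ** Y i ** \<Psi>2 ** transpose (L ** Y i)) = block_diag \<Psi>2"
      unfolding block_diag_def by (intro sum.cong) (auto simp: LY)
    then show "c *\<^sub>R block_diag R ** (\<Sum>i<k. L ** Y i ** \<Psi>2 ** transpose (L ** Y i))
        = (real k * real CARD('m2)) *\<^sub>R mat 1"
      by (simp add: block_diag_mult R c_def)
    have "(\<Sum>i<k. transpose (L ** Y i) ** c *\<^sub>R block_diag R ** (L ** Y i)) = (\<Sum>i<k. c *\<^sub>R R)"
    proof (intro sum.cong refl)
      fix i assume "i \<in> {..<k}"
      then have i: "i < k" by simp
      have "transpose (incl i) ** block_diag R ** incl i = transpose (incl i) ** (incl i ** R)"
        by (simp add: matrix_mul_assoc[symmetric] block_diag_incl[OF i])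
      then show "transpose (L ** Y i) ** c *\<^sub>R block_diag R ** (L ** Y i) = c *\<^sub>R R"
        by (simp add: LY[OF i] matrix_mul_assoc incl_orthonormal[OF i i])
    qed
    also have "\<dots> = (real k * c) *\<^sub>R R" by (simp add: sum_constant_scaleR del: sum_constant)
    finally show "\<Psi>2 ** (\<Sum>i<k. transpose (L ** Y i) ** c *\<^sub>R block_diag R ** (L ** Y i))
        = (real k * real CARD('m1)) *\<^sub>R mat 1"
      by (simp only: matrix_scaleR_right R) (simp add: c_def card_rows)
  qed (use \<open>c > 0\<close> R assms block_diag_PD scaleR_PD in auto)
  from likelihood_equations_left_mult[OF this L(2)] show ?thesis by blast
qed

lemma not_unique_square:
  assumes "det (concat_samples Y) \<noteq> 0" "k > 0" "CARD('m2) \<ge> 2"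
  shows "\<not> mle_exists_uniquely k Y"
proof -
  obtain a b :: 'm2 where ab: "a \<noteq> b"
    using assms(3) by (metis One_nat_def Suc_1 card_2_iff' ex_card UNIV_I top_greatest)
  define D where "D = diagm (\<lambda>i. if i = a then 2 else (1::real))"
  have "D \<in> PD" unfolding D_def by (intro diagm_PD) auto
  then obtain \<Psi>1 \<Phi>1 where "likelihood_equations k Y \<Psi>1 (mat 1)" "likelihood_equations k Y \<Phi>1 D"
    using likelihood_equations_square assms mat_1_PD by blast
  moreover have "D \<noteq> c *\<^sub>R mat 1" for c
  proof
    assume D: "D = c *\<^sub>R mat 1"
    show False
      using arg_cong[OF D, of "\<lambda>D. D $ a $ a"] arg_cong[OF D, of "\<lambda>D. D $ b $ b"] ab
      by (simp add: D_def diagm_nth mat_def)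
  qed
  ultimately show ?thesis by (rule not_unique_if_two_solutions)
qed

text \<open>Two square observations, normalised to \<open>\<delta>\<close> and \<open>M\<close>. The hypotheses on \<open>\<Psi>\<close> and \<open>R\<close> are the
  likelihood equations in this normalisation.\<close>

lemma likelihood_equations_pair:
  assumes k: "k = 1" and "det L \<noteq> 0" "L ** Y 0 = \<delta> *\<^sub>R incl 0" "L ** Y 1 = incl 0 ** M"
    and "\<Psi> \<in> PD" "R \<in> PD"
    and R1: "R ** (\<delta>\<^sup>2 *\<^sub>R \<Psi> + M ** \<Psi> ** transpose M) = mat 1"
    and R2: "\<Psi> ** (\<delta>\<^sup>2 *\<^sub>R R + transpose M ** R ** M) = mat 1"
  shows "\<exists>\<Psi>1. likelihood_equations 2 Y \<Psi>1 \<Psi>"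
proof -
  define c where "c = real 2 * real CARD('m2)"
  have "c > 0" by (simp add: c_def)
  have bd: "block_diag B = incl 0 ** B ** transpose (incl 0)" for B
    using k by (subst block_diag_def) simp
  have sum2: "(\<Sum>i<2. f i) = f 0 + f 1" for f :: "nat \<Rightarrow> 'z::comm_monoid_add"
    by (simp add: numeral_2_eq_2)
  have JJ: "transpose (incl 0) ** incl 0 = mat 1" using incl_orthonormal[of 0 0] k by simp
  have "likelihood_equations 2 (\<lambda>i. L ** Y i) (c *\<^sub>R block_diag R) \<Psi>"
    unfolding likelihood_equations_def
  proof (intro conjI)
    have "(\<Sum>i<2. L ** Y i ** \<Psi> ** transpose (L ** Y i))
        = \<delta> *\<^sub>R incl 0 ** \<Psi> ** transpose (\<delta> *\<^sub>R incl 0)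
          + incl 0 ** M ** \<Psi> ** transpose (incl 0 ** M)"
      by (simp only: sum2 assms(3,4))
    also have "\<dots> = block_diag (\<delta>\<^sup>2 *\<^sub>R \<Psi> + M ** \<Psi> ** transpose M)"
      by (simp add: bd matrix_add_ldistrib matrix_add_rdistrib matrix_mul_assoc
          matrix_transpose_mul transpose_scalar power2_eq_square)
    finally show "c *\<^sub>R block_diag R ** (\<Sum>i<2. L ** Y i ** \<Psi> ** transpose (L ** Y i))
        = (real 2 * real CARD('m2)) *\<^sub>R mat 1"
      by (simp add: block_diag_mult R1 c_def)
    have JbJ: "transpose (incl 0) ** block_diag R ** incl 0 = R"
    proof -
      have "transpose (incl 0) ** block_diag R ** incl 0
          = (transpose (incl 0) ** incl 0) ** R ** (transpose (incl 0) ** incl 0)"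
        by (simp add: bd matrix_mul_assoc)
      then show ?thesis by (simp add: JJ)
    qed
    have "(\<Sum>i<2. transpose (L ** Y i) ** c *\<^sub>R block_diag R ** (L ** Y i))
        = transpose (\<delta> *\<^sub>R incl 0) ** c *\<^sub>R block_diag R ** \<delta> *\<^sub>R incl 0
          + transpose (incl 0 ** M) ** c *\<^sub>R block_diag R ** (incl 0 ** M)"
      by (simp only: sum2 assms(3,4))
    also have "\<dots> = c *\<^sub>R (\<delta>\<^sup>2 *\<^sub>R (transpose (incl 0) ** block_diag R ** incl 0)
           + transpose M ** (transpose (incl 0) ** block_diag R ** incl 0) ** M)"
      by (simp add: matrix_mul_assoc matrix_transpose_mul transpose_scalar power2_eq_square
          scaleR_add_right mult_ac)
    also have "\<dots> = c *\<^sub>R (\<delta>\<^sup>2 *\<^sub>R R + transpose M ** R ** M)" by (simp only: JbJ)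
    finally show "\<Psi> ** (\<Sum>i<2. transpose (L ** Y i) ** c *\<^sub>R block_diag R ** (L ** Y i))
        = (real 2 * real CARD('m1)) *\<^sub>R mat 1"
      by (simp add: R2 c_def card_rows k)
  qed (use \<open>c > 0\<close> assms block_diag_PD scaleR_PD in auto)
  from likelihood_equations_left_mult[OF this assms(2)] show ?thesis by blast
qed

end

section \<open>Matrix algebras and simultaneous conjugation\<close>

inductive_set matrix_algebra :: "(real^'n^'n) set \<Rightarrow> (real^'n^'n) set" for G where
  gen: "X \<in> G \<Longrightarrow> X \<in> matrix_algebra G"
| one: "mat 1 \<in> matrix_algebra G"
| add: "X \<in> matrix_algebra G \<Longrightarrow> Z \<in> matrix_algebra G \<Longrightarrow> X + Z \<in> matrix_algebra G"
| scale: "X \<in> matrix_algebra G \<Longrightarrow> c *\<^sub>R X \<in> matrix_algebra G"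
| mult: "X \<in> matrix_algebra G \<Longrightarrow> Z \<in> matrix_algebra G \<Longrightarrow> X ** Z \<in> matrix_algebra G"

lemma matrix_algebra_subset:
  assumes "G \<subseteq> matrix_algebra H"
  shows "matrix_algebra G \<subseteq> matrix_algebra H"
proof
  fix X assume "X \<in> matrix_algebra G"
  then show "X \<in> matrix_algebra H"
    by induction (use assms in \<open>auto intro: matrix_algebra.intros\<close>)
qed

definition unit_matrix :: "'a \<Rightarrow> 'b \<Rightarrow> real^'b^'a" where
  "unit_matrix a b = (\<chi> i j. if i = a \<and> j = b then 1 else 0)"

lemma mult_unit_matrix_nth: "(A ** unit_matrix a b) $ i $ j = (if j = b then A $ i $ a else 0)"
  by (simp add: matrix_matrix_mult_def unit_matrix_def if_distrib cong: if_cong)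

lemma unit_matrix_mult_nth: "(unit_matrix a b ** A) $ i $ j = (if i = a then A $ b $ j else 0)"
  by (simp add: matrix_matrix_mult_def unit_matrix_def if_distrib if_distribR cong: if_cong)

lemma norm_matrix_mult_le:
  fixes A :: "real^'b^'a" and B :: "real^'c^'b"
  shows "norm (A ** B) \<le> norm A * norm B"
proof -
  have sq: "(norm X)\<^sup>2 = (\<Sum>i\<in>UNIV. (norm (X $ i))\<^sup>2)" for X :: "real^'d^'e"
    by (simp add: norm_vec_def L2_set_def sum_nonneg)
  have tr: "(norm X)\<^sup>2 = (norm (transpose X))\<^sup>2" for X :: "real^'d^'e"
    unfolding norm_matrix_power2 by (simp add: trace_mul_sym[of X])
  have "(norm (A ** B))\<^sup>2 = (\<Sum>i\<in>UNIV. \<Sum>j\<in>UNIV. (A $ i \<bullet> (transpose B $ j))\<^sup>2)"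
    unfolding norm_matrix_power2 trace_transpose_mult
    by (simp add: matrix_matrix_mult_def transpose_def inner_vec_def)
  also have "\<dots> \<le> (\<Sum>i\<in>UNIV. \<Sum>j\<in>UNIV. (norm (A $ i))\<^sup>2 * (norm (transpose B $ j))\<^sup>2)"
  proof (intro sum_mono)
    fix i j
    show "(A $ i \<bullet> transpose B $ j)\<^sup>2 \<le> (norm (A $ i))\<^sup>2 * (norm (transpose B $ j))\<^sup>2"
      using power_mono[OF Cauchy_Schwarz_ineq2 abs_ge_zero, of "A $ i" "transpose B $ j" 2]
      by (simp add: power_mult_distrib)
  qed
  also have "\<dots> = (norm A)\<^sup>2 * (norm (transpose B))\<^sup>2"
    by (simp add: sq sum_product)
  finally have "(norm (A ** B))\<^sup>2 \<le> (norm A * norm B)\<^sup>2"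
    by (simp add: power_mult_distrib tr[of B, symmetric])
  then show ?thesis by (rule power2_le_imp_le) simp
qed

lemma norm_le_sum_entries: "norm A \<le> (\<Sum>i\<in>UNIV. \<Sum>j\<in>UNIV. \<bar>(A :: real^'n^'m) $ i $ j\<bar>)"
proof -
  have "norm A \<le> (\<Sum>i\<in>UNIV. norm (A $ i))"
    unfolding norm_vec_def by (rule L2_set_le_sum) auto
  also have "\<dots> \<le> (\<Sum>i\<in>UNIV. \<Sum>j\<in>UNIV. \<bar>A $ i $ j\<bar>)"
    by (intro sum_mono norm_le_l1_cart)
  finally show ?thesis .
qed

lemma entry_le_norm: "\<bar>(A :: real^'n^'m) $ i $ j\<bar> \<le> norm A"
  using component_le_norm_cart[of "A $ i" j] Finite_Cartesian_Product.norm_nth_le[of A i] by simp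

text \<open>Conjugation by \<open>B\<close> is an algebra homomorphism and the norm is submultiplicative; the bound
  \<open>K\<close> depends on the expression of \<open>X\<close> in the generators but not on \<open>B\<close>.\<close>

lemma conjugate_bounded:
  fixes G :: "(real^'n^'n) set"
  assumes "X \<in> matrix_algebra G"
  shows "\<exists>K. \<forall>B B' :: real^'n^'n. B ** B' = mat 1 \<longrightarrow> (\<forall>g\<in>G. norm (B' ** g ** B) \<le> R)
      \<longrightarrow> norm (B' ** X ** B) \<le> K"
  using assms
proof induction
  case (gen X)
  then show ?case by blast
next
  case one
  show ?case
  proof (intro exI[of _ "norm (mat 1 :: real^'n^'n)"] allI impI)
    fix B B' :: "real^'n^'n"
    assume "B ** B' = mat 1"
    then have "B' ** B = mat 1" by (simp add: matrix_right_inverse_commute)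
    then show "norm (B' ** mat 1 ** B) \<le> norm (mat 1 :: real^'n^'n)" by simp
  qed
next
  case (add X Z)
  then obtain K L where
    K: "\<And>B B' :: real^'n^'n. B ** B' = mat 1 \<Longrightarrow> (\<forall>g\<in>G. norm (B' ** g ** B) \<le> R)
        \<Longrightarrow> norm (B' ** X ** B) \<le> K" and
    L: "\<And>B B' :: real^'n^'n. B ** B' = mat 1 \<Longrightarrow> (\<forall>g\<in>G. norm (B' ** g ** B) \<le> R)
        \<Longrightarrow> norm (B' ** Z ** B) \<le> L"
    by metis
  have "norm (B' ** (X + Z) ** B) \<le> K + L"
    if "B ** B' = mat 1" "\<forall>g\<in>G. norm (B' ** g ** B) \<le> R" for B B' :: "real^'n^'n"
    using norm_triangle_mono[OF K[OF that] L[OF that]]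
    by (simp add: matrix_add_ldistrib matrix_add_rdistrib)
  then show ?case by blast
next
  case (scale X c)
  then obtain K where
    K: "\<And>B B' :: real^'n^'n. B ** B' = mat 1 \<Longrightarrow> (\<forall>g\<in>G. norm (B' ** g ** B) \<le> R)
        \<Longrightarrow> norm (B' ** X ** B) \<le> K"
    by metis
  have "norm (B' ** (c *\<^sub>R X) ** B) \<le> \<bar>c\<bar> * K"
    if "B ** B' = mat 1" "\<forall>g\<in>G. norm (B' ** g ** B) \<le> R" for B B' :: "real^'n^'n"
    using K[OF that] by (simp add: mult_left_mono)
  then show ?case by blast
next
  case (mult X Z)
  then obtain K L where
    K: "\<And>B B' :: real^'n^'n. B ** B' = mat 1 \<Longrightarrow> (\<forall>g\<in>G. norm (B' ** g ** B) \<le> R)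
        \<Longrightarrow> norm (B' ** X ** B) \<le> K" and
    L: "\<And>B B' :: real^'n^'n. B ** B' = mat 1 \<Longrightarrow> (\<forall>g\<in>G. norm (B' ** g ** B) \<le> R)
        \<Longrightarrow> norm (B' ** Z ** B) \<le> L"
    by metis
  have "norm (B' ** (X ** Z) ** B) \<le> K * L"
    if *: "B ** B' = mat 1" "\<forall>g\<in>G. norm (B' ** g ** B) \<le> R" for B B' :: "real^'n^'n"
  proof -
    have "B' ** (X ** Z) ** B = B' ** X ** (B ** B') ** Z ** B"
      using *(1) by (simp add: matrix_mul_assoc)
    then have "B' ** (X ** Z) ** B = (B' ** X ** B) ** (B' ** Z ** B)"
      by (simp add: matrix_mul_assoc)
    then have "norm (B' ** (X ** Z) ** B) \<le> norm (B' ** X ** B) * norm (B' ** Z ** B)"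
      by (simp add: norm_matrix_mult_le)
    also have "\<dots> \<le> K * L"
      using K[OF *] L[OF *] by (intro mult_mono) (auto intro: order_trans[OF norm_ge_zero])
    finally show ?thesis .
  qed
  then show ?case by blast
qed

text \<open>If the generators of the full matrix algebra stay bounded under conjugation by \<open>B\<close>, then so
  does each matrix unit; but the conjugate of a matrix unit is a column of \<open>B\<^sup>-\<^sup>1\<close> times a row of
  \<open>B\<close>. Hence the condition number of \<open>B\<close> is bounded.\<close>

lemma condition_number_bounded:
  fixes G :: "(real^'n^'n) set"
  assumes "matrix_algebra G = UNIV"
  shows "\<exists>K. \<forall>B B' :: real^'n^'n. B ** B' = mat 1 \<longrightarrow> (\<forall>g\<in>G. norm (B' ** g ** B) \<le> R)
      \<longrightarrow> norm B' * norm B \<le> K"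
proof -
  have "\<forall>a b. \<exists>K. \<forall>B B' :: real^'n^'n. B ** B' = mat 1 \<longrightarrow> (\<forall>g\<in>G. norm (B' ** g ** B) \<le> R) \<longrightarrow>
      norm (B' ** unit_matrix a b ** B) \<le> K"
    using conjugate_bounded assms by blast
  then obtain K where K: "\<And>a b (B :: real^'n^'n) B'. B ** B' = mat 1 \<Longrightarrow> (\<forall>g\<in>G. norm (B' ** g ** B) \<le> R) \<Longrightarrow>
      norm (B' ** unit_matrix a b ** B) \<le> K a b"
    by metis
  show ?thesis
  proof (intro exI allI impI)
    fix B B' :: "real^'n^'n"
    assume *: "B ** B' = mat 1" "\<forall>g\<in>G. norm (B' ** g ** B) \<le> R"
    have entry: "\<bar>B' $ i $ a\<bar> * \<bar>B $ b $ j\<bar> \<le> K a b" for i a b j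
    proof -
      have "(B' ** unit_matrix a b ** B) $ i $ j = B' $ i $ a * B $ b $ j"
        by (simp add: matrix_mul_assoc[symmetric])
          (simp add: matrix_matrix_mult_def[of B'] unit_matrix_mult_nth if_distrib cong: if_cong)
      then show ?thesis
        using entry_le_norm[of "B' ** unit_matrix a b ** B" i j] K[OF *, of a b]
        by (simp add: abs_mult)
    qed
    have "norm B' * norm B \<le> (\<Sum>i\<in>UNIV. \<Sum>a\<in>UNIV. \<bar>B' $ i $ a\<bar>) * (\<Sum>b\<in>UNIV. \<Sum>j\<in>UNIV. \<bar>B $ b $ j\<bar>)"
      by (intro mult_mono norm_le_sum_entries sum_nonneg) auto
    also have "\<dots> = (\<Sum>i\<in>UNIV. \<Sum>b\<in>UNIV. \<Sum>a\<in>UNIV. \<Sum>j\<in>UNIV. \<bar>B' $ i $ a\<bar> * \<bar>B $ b $ j\<bar>)"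
      by (simp add: sum_product)
    also have "\<dots> \<le> (\<Sum>i\<in>(UNIV::'n set). \<Sum>b\<in>UNIV. \<Sum>a\<in>UNIV. \<Sum>j\<in>(UNIV::'n set). K a b)"
      by (intro sum_mono entry)
    finally show "norm B' * norm B \<le> (\<Sum>i\<in>(UNIV::'n set). \<Sum>b\<in>UNIV. \<Sum>a\<in>UNIV. \<Sum>j\<in>(UNIV::'n set). K a b)" .
  qed
qed

lemma commuting_with_algebra:
  assumes "X \<in> matrix_algebra G" "\<And>g. g \<in> G \<Longrightarrow> Z ** g = g ** Z"
  shows "Z ** X = X ** Z"
  using assms(1)
proof induction
  case (mult X U)
  then show ?case by (metis matrix_mul_assoc)
qed (auto simp: assms(2) matrix_add_ldistrib matrix_add_rdistrib)

lemma central_matrix_scalar: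
  fixes Z :: "real^'n^'n"
  assumes "\<And>X. Z ** X = X ** Z"
  shows "\<exists>z. Z = z *\<^sub>R mat 1"
proof -
  fix b :: 'n
  define z where "z = Z $ b $ b"
  have "Z $ i $ a = (if i = a then z else 0)" for i a
    using arg_cong[OF assms[of "unit_matrix a b"], of "\<lambda>X. X $ i $ b"]
    by (simp add: mult_unit_matrix_nth unit_matrix_mult_nth z_def)
  then have "Z = z *\<^sub>R mat 1" by (simp add: vec_eq_iff mat_def)
  then show ?thesis by blast
qed

lemma continuous_on_matrix_mult [continuous_intros]:
  fixes f :: "'x::topological_space \<Rightarrow> real^'b^'a" and g :: "'x \<Rightarrow> real^'c^'b"
  assumes "continuous_on S f" "continuous_on S g"
  shows "continuous_on S (\<lambda>x. f x ** g x)"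
  using assms unfolding continuous_on_def by (auto intro: tendsto_matrix_mult)

lemma continuous_on_transpose [continuous_intros]:
  fixes f :: "'x::topological_space \<Rightarrow> real^'b^'a"
  assumes "continuous_on S f"
  shows "continuous_on S (\<lambda>x. transpose (f x))"
  using assms unfolding continuous_on_def transpose_def by (auto intro!: tendsto_intros)

lemma continuous_on_det [continuous_intros]:
  fixes f :: "'x::topological_space \<Rightarrow> real^'n^'n"
  assumes "continuous_on S f"
  shows "continuous_on S (\<lambda>x. det (f x))"
  unfolding det_def by (intro continuous_intros assms)

section \<open>Samples whose blocks generate the full matrix algebra\<close>

lemma psd_sum_gram:
  fixes N :: "'i \<Rightarrow> real^'b^'a"
  shows "transpose (\<Sum>i\<in>I. N i ** transpose (N i)) = (\<Sum>i\<in>I. N i ** transpose (N i))"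
    and "x \<bullet> ((\<Sum>i\<in>I. N i ** transpose (N i)) *v x) \<ge> 0"
    and "trace (\<Sum>i\<in>I. N i ** transpose (N i)) = (\<Sum>i\<in>I. (norm (N i))\<^sup>2)"
proof -
  show "transpose (\<Sum>i\<in>I. N i ** transpose (N i)) = (\<Sum>i\<in>I. N i ** transpose (N i))"
    by (simp add: transpose_sum matrix_transpose_mul)
  have "x \<bullet> ((N i ** transpose (N i)) *v x) = (transpose (N i) *v x) \<bullet> (transpose (N i) *v x)" for i
    unfolding matrix_vector_mul_assoc[symmetric] by (rule inner_matrix_vector_transpose)
  then have "x \<bullet> ((N i ** transpose (N i)) *v x) \<ge> 0" for i by simp
  moreover have "(\<Sum>i\<in>I. N i ** transpose (N i)) *v x = (\<Sum>i\<in>I. (N i ** transpose (N i)) *v x)"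
    by (induction I rule: infinite_finite_induct) (auto simp: matrix_vector_mult_add_rdistrib)
  ultimately show "x \<bullet> ((\<Sum>i\<in>I. N i ** transpose (N i)) *v x) \<ge> 0"
    by (simp add: inner_sum_right sum_nonneg)
  show "trace (\<Sum>i\<in>I. N i ** transpose (N i)) = (\<Sum>i\<in>I. (norm (N i))\<^sup>2)"
    by (simp add: trace_sum norm_matrix_power2 trace_mul_sym[of "transpose _"])
qed

lemma one_plus_psd_PD:
  fixes X :: "real^'n^'n"
  assumes "transpose X = X" "\<And>x. x \<bullet> (X *v x) \<ge> 0"
  shows "mat 1 + X \<in> PD"
  unfolding PD_def
proof (intro CollectI conjI allI impI)
  show "transpose (mat 1 + X) = mat 1 + X" by (simp add: transpose_add assms)
  fix x :: "real^'n" assume "x \<noteq> 0"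
  then have "0 < x \<bullet> x" by simp
  with assms(2)[of x] show "0 < x \<bullet> ((mat 1 + X) *v x)"
    unfolding matrix_vector_mult_add_rdistrib inner_add_right matrix_vector_mul_lid
    by (intro add_pos_nonneg)
qed

lemma diagm_const: "diagm (\<lambda>_. r) = r *\<^sub>R (mat 1 :: real^'n^'n)"
  by (simp add: vec_eq_iff diagm_nth mat_def)

context row_blocks
begin

definition sample_blocks :: "(nat \<Rightarrow> real^'m2^'m1) \<Rightarrow> nat \<Rightarrow> (real^'m2^'m2) set" where
  "sample_blocks U n = {transpose (incl j) ** U i |i j. k \<le> i \<and> i < n \<and> j < k}"

text \<open>The Gram matrix of a sample \<open>U\<close> whose first \<open>k\<close> members are the inclusions, in the
  coordinates given by \<open>\<Psi>\<^sub>2 = B B\<^sup>T\<close> with \<open>B' = B\<^sup>-\<^sup>1\<close>. The inclusions contribute the identity.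
  Maximising over \<open>\<Psi>\<^sub>1\<close> leaves the determinant of this matrix to be minimised.\<close>

definition reduced_gram ::
  "(nat \<Rightarrow> real^'m2^'m1) \<Rightarrow> nat \<Rightarrow> real^'m2^'m2 \<Rightarrow> real^'m2^'m2 \<Rightarrow> real^'m1^'m1" where
  "reduced_gram U n B B' = mat 1 +
     (\<Sum>i\<in>{k..<n}. (block_diag B' ** U i ** B) ** transpose (block_diag B' ** U i ** B))"

lemma reduced_gram_PD: "reduced_gram U n B B' \<in> PD"
  unfolding reduced_gram_def
  by (intro one_plus_psd_PD psd_sum_gram(1) psd_sum_gram(2))

lemma norm_le_det_reduced_gram:
  assumes "i \<in> {k..<n}"
  shows "norm (block_diag B' ** U i ** B) \<le> det (reduced_gram U n B B')"
proof -
  define N where "N i = block_diag B' ** U i ** B" for i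
  have "(norm (N i))\<^sup>2 \<le> (\<Sum>i\<in>{k..<n}. (norm (N i))\<^sup>2)"
    using assms by (intro member_le_sum) auto
  then have "1 + (norm (N i))\<^sup>2 \<le> 1 + trace (\<Sum>i\<in>{k..<n}. N i ** transpose (N i))"
    by (simp add: psd_sum_gram(3))
  also have "\<dots> \<le> det (reduced_gram U n B B')"
    unfolding reduced_gram_def N_def
    by (intro det_one_plus_ge_trace psd_sum_gram(1) psd_sum_gram(2))
  finally have "1 + (norm (N i))\<^sup>2 \<le> det (reduced_gram U n B B')" .
  moreover have "norm (N i) \<le> 1 + (norm (N i))\<^sup>2"
    using sum_squares_bound[of "norm (N i)" 1, unfolded mult_1_right one_power2] norm_ge_zero[of "N i"]
    by linarith
  ultimately show ?thesis by (simp add: N_def)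
qed

lemma reduced_gram_scale:
  assumes "s \<noteq> 0"
  shows "reduced_gram U n (s *\<^sub>R B) ((1 / s) *\<^sub>R B') = reduced_gram U n B B'"
proof -
  have "block_diag ((1 / s) *\<^sub>R B') = (1 / s) *\<^sub>R block_diag B'"
    by (simp add: block_diag_def scaleR_sum_right)
  then show ?thesis using assms by (simp add: reduced_gram_def)
qed

lemma continuous_on_block_diag [continuous_intros]:
  assumes "continuous_on S f"
  shows "continuous_on S (\<lambda>x. block_diag (f x))"
  unfolding block_diag_def by (intro continuous_intros assms)

text \<open>The substitution \<open>P = Q\<^sup>T \<Psi>\<^sub>1 Q\<close> with \<open>Q = W (I \<otimes> B)\<close>. The log-determinant of \<open>\<Psi>\<^sub>2\<close> cancels
  because \<open>m\<^sub>1 = k m\<^sub>2\<close>.\<close>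

lemma loglik_reduced:
  assumes "k \<le> n" and LW: "L ** concat_samples Y = mat 1" and BB: "B ** B' = mat 1" and "\<Psi>1 \<in> PD"
  defines "Q \<equiv> concat_samples Y ** block_diag B" and "c \<equiv> real n * real CARD('m2)"
  shows "loglik n Y (\<Psi>1, B ** transpose B) = c * ln (det (transpose Q ** \<Psi>1 ** Q))
    - trace (transpose Q ** \<Psi>1 ** Q ** reduced_gram (\<lambda>i. L ** Y i) n B B') - c * ln ((det
        (concat_samples Y))\<^sup>2)"
proof -
  define W where "W = concat_samples Y"
  have WL: "W ** L = mat 1" using LW by (simp add: W_def matrix_right_inverse_commute)
  have bb: "block_diag B ** block_diag B' = mat 1" by (simp add: block_diag_mult BB)
  have dB: "det B \<noteq> 0" using arg_cong[OF BB, of det] by (auto simp: det_mul)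
  have dW: "det W \<noteq> 0" using arg_cong[OF WL, of det] by (auto simp: det_mul)
  define N where "N i = block_diag B' ** (L ** Y i) ** B" for i
  have QN: "Q ** N i = Y i ** B" for i
  proof -
    have "Q ** N i = W ** (block_diag B ** block_diag B') ** L ** Y i ** B"
      unfolding Q_def N_def W_def by (simp only: matrix_mul_assoc)
    then show ?thesis by (simp add: bb WL)
  qed
  have N_incl: "N i = incl i" if "i < k" for i
  proof -
    have "L ** Y i = incl i"
      using LW concat_samples_incl[OF that, of Y] by (metis matrix_mul_assoc matrix_mul_lid)
    then have "N i = block_diag B' ** (incl i ** B)" by (simp add: N_def matrix_mul_assoc)
    also have "\<dots> = block_diag B' ** (block_diag B ** incl i)" by (simp only: block_diag_incl[OF that])
    also have "\<dots> = (block_diag B' ** block_diag B) ** incl i" by (simp only: matrix_mul_assoc)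
    also have "block_diag B' ** block_diag B = mat 1" using bb
        by (simp add: matrix_right_inverse_commute)
    finally show ?thesis by simp
  qed
  have "{..<n} = {..<k} \<union> {k..<n}" "{..<k} \<inter> {k..<n} = {}" using assms(1) by auto
  then have "(\<Sum>i<n. N i ** transpose (N i))
      = (\<Sum>i<k. N i ** transpose (N i)) + (\<Sum>i\<in>{k..<n}. N i ** transpose (N i))"
    by (simp add: sum.union_disjoint)
  also have "(\<Sum>i<k. N i ** transpose (N i)) = (\<Sum>i<k. incl i ** transpose (incl i))"
    by (intro sum.cong) (simp_all add: N_incl)
  finally have T: "(\<Sum>i<n. N i ** transpose (N i)) = reduced_gram (\<lambda>i. L ** Y i) n B B'"
    by (simp add: incl_complete reduced_gram_def N_def)
  have "Y i ** (B ** transpose B) ** transpose (Y i)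
      = Q ** (N i ** transpose (N i)) ** transpose Q" for i
  proof -
    have "Y i ** (B ** transpose B) ** transpose (Y i) = (Y i ** B) ** transpose (Y i ** B)"
      by (simp add: matrix_mul_assoc matrix_transpose_mul)
    then show ?thesis unfolding QN[symmetric] by (simp add: matrix_mul_assoc matrix_transpose_mul)
  qed
  then have "(\<Sum>i<n. Y i ** (B ** transpose B) ** transpose (Y i))
      = Q ** reduced_gram (\<lambda>i. L ** Y i) n B B' ** transpose Q"
    by (simp add: T[symmetric] matrix_sum_ldistrib matrix_sum_rdistrib)
  then have "trace (\<Psi>1 ** (\<Sum>i<n. Y i ** (B ** transpose B) ** transpose (Y i)))
      = trace ((\<Psi>1 ** Q ** reduced_gram (\<lambda>i. L ** Y i) n B B') ** transpose Q)"
    by (simp add: matrix_mul_assoc)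
  also have "\<dots> = trace (transpose Q ** \<Psi>1 ** Q ** reduced_gram (\<lambda>i. L ** Y i) n B B')"
    by (subst trace_mul_sym) (simp add: matrix_mul_assoc)
  finally have tr: "trace (\<Psi>1 ** (\<Sum>i<n. Y i ** (B ** transpose B) ** transpose (Y i)))
      = trace (transpose Q ** \<Psi>1 ** Q ** reduced_gram (\<lambda>i. L ** Y i) n B B')" .
  have "block_diag (B ** transpose B) = block_diag B ** transpose (block_diag B)"
    by (simp add: block_diag_mult transpose_block_diag)
  then have "(det (block_diag B))\<^sup>2 = det (B ** transpose B) ^ k"
    using det_block_diag_PD[OF gram_PD[OF dB]] by (simp add: det_mul power2_eq_square)
  then have "det (transpose Q ** \<Psi>1 ** Q) = det \<Psi>1 * ((det W)\<^sup>2 * det (B ** transpose B) ^ k)"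
    by (simp add: Q_def W_def det_mul power2_eq_square mult_ac)
  then have "ln (det (transpose Q ** \<Psi>1 ** Q))
      = ln (det \<Psi>1) + (ln ((det W)\<^sup>2) + real k * ln (det (B ** transpose B)))"
    using PD_det_pos[OF assms(4)] PD_det_pos[OF gram_PD[OF dB]] dW
    by (simp add: ln_mult ln_realpow)
  then have "c * ln (det (transpose Q ** \<Psi>1 ** Q)) - c * ln ((det W)\<^sup>2)
      = c * ln (det \<Psi>1) + c * real k * ln (det (B ** transpose B))"
    by (simp add: algebra_simps)
  moreover have "c * real k = real n * real CARD('m1)" by (simp add: c_def card_rows)
  ultimately have "c * ln (det (transpose Q ** \<Psi>1 ** Q)) - c * ln ((det W)\<^sup>2)
      = c * ln (det \<Psi>1) + real n * real CARD('m1) * ln (det (B ** transpose B))"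
    by simp
  then show ?thesis
    unfolding loglik_def prod.case tr c_def[symmetric] W_def by linarith
qed

text \<open>Up to scaling, \<open>B\<close> may be restricted to matrices of norm one, and on a sublevel set of the
  reduced problem the blocks stay bounded under conjugation, hence \<open>B\<^sup>-\<^sup>1\<close> is bounded as well. So
  a minimum over a compact set is a global one.\<close>

lemma reduced_gram_minimum:
  assumes G: "matrix_algebra (sample_blocks U n) = UNIV"
  obtains B B' where "B ** B' = mat 1"
    "\<And>A A'. A ** A' = mat 1 \<Longrightarrow> det (reduced_gram U n B B') \<le> det (reduced_gram U n A A')"
proof -
  define F where "F = (\<lambda>(B, B'). det (reduced_gram U n B B'))"
  define s where "s = norm (mat 1 :: real^'m2^'m2)"
  have s: "s > 0" by (simp add: s_def vec_eq_iff mat_def)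
  define X0 :: "(real^'m2^'m2) \<times> (real^'m2^'m2)" where "X0 = ((1 / s) *\<^sub>R mat 1, s *\<^sub>R mat 1)"
  define j0 where "j0 = (\<Sum>j<k. norm (transpose (incl j)))"
  define R where "R = j0 * F X0"
  obtain K where K: "\<And>(B :: real^'m2^'m2) B'. B ** B' = mat 1 \<Longrightarrow>
      (\<forall>g\<in>sample_blocks U n. norm (B' ** g ** B) \<le> R) \<Longrightarrow> norm B' * norm B \<le> K"
    using condition_number_bounded[OF G, of R] by blast
  define C where "C = max K (s * s)"
  define S where "S = {(B, B'). B ** B' = mat 1 \<and> norm B = 1 \<and> norm (B' :: real^'m2^'m2) \<le> C}"
  have "closed {X :: (real^'m2^'m2) \<times> (real^'m2^'m2). fst X ** snd X = mat 1}"
    by (intro closed_Collect_eq continuous_intros)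
  moreover have "S = {X. fst X ** snd X = mat 1} \<inter> (sphere 0 1 \<times> cball 0 C)"
    by (auto simp: S_def)
  ultimately have "compact S"
    by (auto intro!: closed_Int_compact compact_Times)
  have X0S: "X0 \<in> S" using s by (auto simp: S_def X0_def C_def s_def[symmetric])
  have "continuous_on S F"
    unfolding F_def reduced_gram_def case_prod_unfold by (intro continuous_intros)
  then obtain X where X: "X \<in> S" "\<And>Z. Z \<in> S \<Longrightarrow> F X \<le> F Z"
    using continuous_attains_inf[OF \<open>compact S\<close>, of F] X0S by blast
  have min: "F X \<le> F (A, A')" if AA: "A ** A' = mat 1" for A A'
  proof (cases "F (A, A') \<le> F X0")
    case False
    then show ?thesis using X(2)[OF X0S] by simp
  next
    case True
    have "norm (A' ** g ** A) \<le> R" if gG: "g \<in> sample_blocks U n" for g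
    proof -
      obtain i j where ij: "g = transpose (incl j) ** U i" "i \<in> {k..<n}" "j < k"
        using gG by (auto simp: sample_blocks_def)
      have "transpose (block_diag (transpose A') ** incl j) = transpose (incl j ** transpose A')"
        by (simp only: block_diag_incl[OF ij(3)])
      then have "transpose (incl j) ** block_diag A' = A' ** transpose (incl j)"
        by (simp add: matrix_transpose_mul transpose_block_diag)
      then have "A' ** g ** A = transpose (incl j) ** (block_diag A' ** U i ** A)"
        by (simp add: ij(1) matrix_mul_assoc)
      then have "norm (A' ** g ** A) \<le> norm (transpose (incl j)) * norm (block_diag A' ** U i ** A)"
        by (simp add: norm_matrix_mult_le)
      also have "\<dots> \<le> j0 * F X0"
      proof (intro mult_mono)
        show "norm (transpose (incl j)) \<le> j0"
          unfolding j0_def using ij(3) by (intro member_le_sum) auto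
        show "norm (block_diag A' ** U i ** A) \<le> F X0"
          using norm_le_det_reduced_gram[OF ij(2), of A' U A] True by (simp add: F_def)
      qed (auto simp: j0_def sum_nonneg)
      finally show ?thesis by (simp add: R_def)
    qed
    then have KA: "norm A' * norm A \<le> K" using K AA by blast
    have "norm A \<noteq> 0"
    proof
      assume "norm A = 0"
      then have "mat 1 = (0 :: real^'m2^'m2)" using AA by simp
      then show False using s by (simp add: s_def)
    qed
    define r where "r = 1 / norm A"
    have r: "r > 0" using \<open>norm A \<noteq> 0\<close> by (simp add: r_def)
    have "(r *\<^sub>R A, (1 / r) *\<^sub>R A') \<in> S"
      using KA \<open>norm A \<noteq> 0\<close> r AA by (auto simp: S_def C_def r_def mult.commute)
    from X(2)[OF this] show ?thesis
      using r by (simp add: F_def reduced_gram_scale)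
  qed
  obtain B B' where "X = (B, B')" by fastforce
  with X(1) min show thesis
    using that[of B B'] by (simp add: S_def F_def)
qed

lemma mle_exists_if_generating:
  assumes "k \<le> n" "n > 0" and LW: "L ** concat_samples Y = mat 1"
    and G: "matrix_algebra (sample_blocks (\<lambda>i. L ** Y i) n) = UNIV"
  shows "mle_exists n Y"
proof -
  define U where "U = (\<lambda>i. L ** Y i)"
  define W where "W = concat_samples Y"
  define c where "c = real n * real CARD('m2)"
  have "c > 0" using assms(2) by (simp add: c_def)
  obtain B B' where B: "B ** B' = mat 1"
    "\<And>A A'. A ** A' = mat 1 \<Longrightarrow> det (reduced_gram U n B B') \<le> det (reduced_gram U n A A')"
    using reduced_gram_minimum[of U n] G unfolding U_def by blast
  define val where "val T = c * (CARD('m1) * ln c - ln (det T) - CARD('m1)) - c * ln ((det W)\<^sup>2)"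
      for T :: "real^'m1^'m1"
  have upper: "loglik n Y (\<Phi>1, \<Phi>2) \<le> val (reduced_gram U n B B')" if \<Phi>: "\<Phi>1 \<in> PD" "\<Phi>2 \<in> PD" for \<Phi>1 \<Phi>2
  proof -
    obtain A where A: "det A \<noteq> 0" "\<Phi>2 = A ** transpose A" using PD_factor[OF \<Phi>(2)] by blast
    obtain A' where A': "A ** A' = mat 1" using invertible_obtain_inverse[OF A(1)] by blast
    define Q where "Q = W ** block_diag A"
    have "det Q \<noteq> 0"
      using det_block_diag_nz[OF A(1)] arg_cong[OF LW, of det] by (auto simp: Q_def W_def det_mul)
    then have "transpose Q ** \<Phi>1 ** Q \<in> PD" using congruence_PD \<Phi>(1) by blast
    from logdet_minus_trace_le[OF this reduced_gram_PD \<open>c > 0\<close>]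
    have "c * ln (det (transpose Q ** \<Phi>1 ** Q)) - trace (transpose Q ** \<Phi>1 ** Q ** reduced_gram U
        n A A')
        - c * ln ((det W)\<^sup>2) \<le> val (reduced_gram U n A A')"
      unfolding val_def by (intro diff_right_mono)
    then have "loglik n Y (\<Phi>1, \<Phi>2) \<le> val (reduced_gram U n A A')"
      using loglik_reduced[OF assms(1) LW A' \<Phi>(1)] unfolding A(2) Q_def U_def c_def W_def by simp
    also have "\<dots> \<le> val (reduced_gram U n B B')"
      using B(2)[OF A'] PD_det_pos[OF reduced_gram_PD] \<open>c > 0\<close> by (simp add: val_def)
    finally show ?thesis .
  qed
  define Q where "Q = W ** block_diag B"
  have dB: "det B \<noteq> 0" using arg_cong[OF B(1), of det] by (auto simp: det_mul)
  have "det Q \<noteq> 0"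
    using det_block_diag_nz[OF dB] arg_cong[OF LW, of det] by (auto simp: Q_def W_def det_mul)
  then obtain Q' where Q': "Q ** Q' = mat 1" "Q' ** Q = mat 1" "det Q' \<noteq> 0"
    using invertible_obtain_inverse[of Q] by blast
  have QQ: "transpose Q ** transpose Q' = mat 1" by (metis Q'(2) matrix_transpose_mul transpose_mat)
  obtain R where R: "R \<in> PD" "reduced_gram U n B B' ** R = mat 1"
    using PD_inverse[OF reduced_gram_PD] by blast
  define \<Psi>1 where "\<Psi>1 = transpose Q' ** (c *\<^sub>R R) ** Q'"
  have "\<Psi>1 \<in> PD" unfolding \<Psi>1_def
    by (rule congruence_PD[OF scaleR_PD[OF R(1) \<open>c > 0\<close>] Q'(3)])
  have "transpose Q ** \<Psi>1 ** Q = (transpose Q ** transpose Q') ** (c *\<^sub>R R) ** (Q' ** Q)"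
    unfolding \<Psi>1_def by (simp only: matrix_mul_assoc)
  then have QPQ: "transpose Q ** \<Psi>1 ** Q = c *\<^sub>R R" by (simp add: QQ Q')
  have "loglik n Y (\<Psi>1, B ** transpose B) = val (reduced_gram U n B B')"
    using loglik_reduced[OF assms(1) LW B(1) \<open>\<Psi>1 \<in> PD\<close>]
      logdet_minus_trace_eq[OF reduced_gram_PD R \<open>c > 0\<close>]
    unfolding QPQ[unfolded Q_def W_def] U_def[symmetric] c_def[symmetric] val_def W_def by simp
  then show ?thesis
    using upper \<open>\<Psi>1 \<in> PD\<close> gram_PD[OF dB] unfolding mle_exists_def
    by (intro bexI[of _ "(\<Psi>1, B ** transpose B)"]) auto
qed

text \<open>The relation \<open>X Y\<^sub>i + Y\<^sub>i Z = 0\<close> between two local maxima determines \<open>X\<close> from \<open>Z\<close> through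
  the first \<open>k\<close> observations; the others then say that \<open>Z\<close> commutes with all blocks, so \<open>Z\<close> is a
  scalar and the two maxima differ by a scalar moved between the factors.\<close>

lemma local_maxima_equivalent_if_generating:
  assumes "k \<le> n" and LW: "L ** concat_samples Y = mat 1"
    and G: "matrix_algebra (sample_blocks (\<lambda>i. L ** Y i) n) = UNIV"
    and max: "local_max_on (loglik n Y) (PD \<times> PD) (\<Psi>1, \<Psi>2)"
      "local_max_on (loglik n Y) (PD \<times> PD) (\<Phi>1, \<Phi>2)"
  shows "kronecker \<Psi>2 \<Psi>1 = kronecker \<Phi>2 \<Phi>1"
proof -
  define W where "W = concat_samples Y"
  have WL: "W ** L = mat 1" using LW by (simp add: W_def matrix_right_inverse_commute)
  obtain C c A d where CA: "det C \<noteq> 0" "det A \<noteq> 0"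
    "\<Psi>1 = C ** transpose C" "\<Phi>1 = C ** diagm (\<lambda>i. exp (c i)) ** transpose C"
    "\<Psi>2 = A ** transpose A" "\<Phi>2 = A ** diagm (\<lambda>i. exp (d i)) ** transpose A"
    and rel: "\<And>i. i < n \<Longrightarrow> diagm c ** (transpose C ** Y i ** A) + (transpose C ** Y i ** A) **
        diagm d = 0"
    by (rule two_local_maxima[OF max], rule that)
  obtain E where E: "transpose C ** E = mat 1" "E ** transpose C = mat 1"
    using invertible_obtain_inverse[of "transpose C"] CA(1) by auto
  obtain A' where A': "A ** A' = mat 1" "A' ** A = mat 1"
    using invertible_obtain_inverse[OF CA(2)] by blast
  define X where "X = E ** diagm c ** transpose C"
  define Z where "Z = A ** diagm d ** A'"
  have XYZ: "X ** Y i = - (Y i ** Z)" if "i < n" for i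
  proof -
    have "E ** (diagm c ** (transpose C ** Y i ** A) + (transpose C ** Y i ** A) ** diagm d) ** A'
        = X ** Y i ** (A ** A') + (E ** transpose C) ** Y i ** Z"
      by (simp add: X_def Z_def matrix_add_ldistrib matrix_add_rdistrib matrix_mul_assoc)
    then have "X ** Y i + Y i ** Z = 0" by (simp add: rel[OF that] A' E)
    then show ?thesis by (simp add: eq_neg_iff_add_eq_0)
  qed
  have neg_mult: "(- M) ** N = - (M ** N)" for M :: "real^'b^'a" and N :: "real^'e^'b"
    using matrix_scaleR_left[of "-1" M N] by simp
  have mult_neg: "M ** (- N) = - (M ** N)" for M :: "real^'b^'a" and N :: "real^'e^'b"
    using matrix_scaleR_right[of M "-1" N] by simp
  have XW: "X ** W = - (W ** block_diag Z)"
  proof -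
    have "X ** W = (\<Sum>j<k. (X ** Y j) ** transpose (incl j))"
      by (simp add: W_def concat_samples_def matrix_sum_ldistrib matrix_mul_assoc)
    also have "\<dots> = (\<Sum>j<k. - ((W ** incl j) ** Z ** transpose (incl j)))"
      by (intro sum.cong refl) (use assms(1) in \<open>simp add: XYZ neg_mult W_def concat_samples_incl\<close>)
    also have "\<dots> = - (W ** block_diag Z)"
      by (simp add: block_diag_def matrix_sum_ldistrib matrix_mul_assoc sum_negf)
    finally show ?thesis .
  qed
  have LX: "L ** X = - (block_diag Z ** L)"
  proof -
    have "L ** X = L ** (X ** W) ** L" using WL by (metis matrix_mul_assoc matrix_mul_rid)
    also have "\<dots> = - ((L ** W) ** block_diag Z ** L)"
      by (simp add: XW neg_mult mult_neg matrix_mul_assoc)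
    finally show ?thesis using LW by (simp add: W_def)
  qed
  have comm: "Z ** g = g ** Z" if gG: "g \<in> sample_blocks (\<lambda>i. L ** Y i) n" for g
  proof -
    obtain i j where ij: "g = transpose (incl j) ** (L ** Y i)" "i < n" "j < k"
      using gG by (auto simp: sample_blocks_def)
    have "transpose (block_diag (transpose Z) ** incl j) = transpose (incl j ** transpose Z)"
      by (simp only: block_diag_incl[OF ij(3)])
    then have tZ: "transpose (incl j) ** block_diag Z = Z ** transpose (incl j)"
      by (simp add: matrix_transpose_mul transpose_block_diag)
    have "- (block_diag Z ** L ** Y i) = L ** X ** Y i" by (simp add: LX neg_mult)
    also have "\<dots> = - (L ** Y i ** Z)"
      using XYZ[OF ij(2)] by (simp add: matrix_mul_assoc[symmetric] mult_neg)
    finally have "block_diag Z ** L ** Y i = L ** Y i ** Z" by simp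
    then have "transpose (incl j) ** block_diag Z ** (L ** Y i) = transpose (incl j) ** (L ** Y i) ** Z"
      by (metis matrix_mul_assoc)
    then show ?thesis by (simp add: tZ ij(1) matrix_mul_assoc)
  qed
  have "Z ** V = V ** Z" for V
    using commuting_with_algebra[OF _ comm] G by blast
  then obtain z where z: "Z = z *\<^sub>R mat 1" using central_matrix_scalar by blast
  have "diagm d = (A' ** A) ** diagm d ** (A' ** A)" by (simp add: A')
  also have "\<dots> = A' ** Z ** A" by (simp add: Z_def matrix_mul_assoc)
  also have "\<dots> = z *\<^sub>R mat 1" by (simp add: z A')
  finally have d: "diagm d = z *\<^sub>R mat 1" .
  have "X = X ** (W ** L)" by (simp add: WL)
  also have "\<dots> = X ** W ** L" by (simp only: matrix_mul_assoc)
  also have "\<dots> = - z *\<^sub>R mat 1"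
  proof -
    have "block_diag Z = z *\<^sub>R mat 1"
      using block_diag_1 by (simp add: z block_diag_def scaleR_sum_right[symmetric])
    then show ?thesis by (simp add: XW neg_mult WL)
  qed
  finally have X: "X = - z *\<^sub>R mat 1" .
  have "diagm c = (transpose C ** E) ** diagm c ** (transpose C ** E)" by (simp add: E)
  also have "\<dots> = transpose C ** X ** E" by (simp add: X_def matrix_mul_assoc)
  also have "\<dots> = - z *\<^sub>R mat 1" by (simp add: X E mult_neg neg_mult)
  finally have c: "diagm c = - z *\<^sub>R mat 1" .
  have "d b = z" for b using arg_cong[OF d, of "\<lambda>M. M $ b $ b"] by (simp add: diagm_nth mat_def)
  moreover have "c a = - z" for a using arg_cong[OF c, of "\<lambda>M. M $ a $ a"]
      by (simp add: diagm_nth mat_def)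
  ultimately have "\<Phi>2 = exp z *\<^sub>R \<Psi>2" "\<Phi>1 = exp (- z) *\<^sub>R \<Psi>1"
    by (simp_all add: CA diagm_const)
  then show ?thesis
    by (simp add: kronecker_def vec_eq_iff exp_minus)
qed

lemma mle_exists_uniquely_if_generating:
  assumes "k \<le> n" "n > 0" "L ** concat_samples Y = mat 1"
    and "matrix_algebra (sample_blocks (\<lambda>i. L ** Y i) n) = UNIV"
  shows "mle_exists_uniquely n Y"
  using mle_exists_if_generating[OF assms] local_maxima_equivalent_if_generating[OF assms(1,3,4)]
  unfolding mle_exists_uniquely_def by blast

end

section \<open>Characteristic polynomials and simple spectra\<close>

definition charpoly :: "'a::comm_ring_1^'n^'n \<Rightarrow> 'a poly" where
  "charpoly M = det (\<chi> i j. [:- (M $ i $ j), if i = j then 1 else 0:])"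

lemma poly_det: "poly (det A) x = det (\<chi> i j. poly (A $ i $ j) (x :: 'a::comm_ring_1))"
  by (simp add: det_def poly_sum poly_prod)

lemma poly_charpoly: "poly (charpoly M) x = det (\<chi> i j. (if i = j then x else 0) - M $ i $ j)"
proof -
  have "poly [:- (M $ i $ j), if i = j then 1 else 0:] x = (if i = j then x else 0) - M $ i $ j" for i j
    by simp
  then show ?thesis by (simp only: charpoly_def poly_det vec_lambda_beta)
qed

lemma prod_linear_coeff:
  fixes a b :: "'i \<Rightarrow> 'a::comm_ring_1"
  assumes "finite S"
  shows "degree (\<Prod>i\<in>S. [:a i, b i:]) \<le> card S \<and> coeff (\<Prod>i\<in>S. [:a i, b i:]) (card S) = (\<Prod>i\<in>S. b i)"
  using assms
proof (induction S rule: finite_induct)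
  case (insert x S)
  define q where "q = (\<Prod>i\<in>S. [:a i, b i:])"
  have q: "degree q \<le> card S" "coeff q (card S) = (\<Prod>i\<in>S. b i)" using insert by (auto simp: q_def)
  have eq: "(\<Prod>i\<in>insert x S. [:a i, b i:]) = smult (a x) q + pCons 0 (smult (b x) q)"
    using insert by (simp add: q_def)
  have "coeff q (Suc (card S)) = 0" using q(1) by (intro coeff_eq_0) simp
  moreover have "degree (smult (a x) q + pCons 0 (smult (b x) q)) \<le> Suc (card S)"
    using q(1) degree_smult_le[of "a x" q] degree_smult_le[of "b x" q]
    by (intro degree_add_le degree_pCons_le[THEN order_trans]) auto
  ultimately show ?case
    using insert q unfolding eq by simp
qed auto

text \<open>The coefficient of order \<open>m\<close> in the determinant of an \<open>m \<times> m\<close> matrix of linear polynomials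
  is the determinant of the leading coefficients, here of the identity.\<close>

lemma charpoly_monic:
  fixes M :: "'a::comm_ring_1^'n^'n"
  shows "degree (charpoly M) \<le> CARD('n)" "coeff (charpoly M) CARD('n) = 1"
proof -
  define t where "t p = (\<Prod>i\<in>UNIV. [:- (M $ i $ p i), if i = p i then 1 else 0:])" for p
  have t: "degree (t p) \<le> CARD('n)" "coeff (t p) CARD('n) = (\<Prod>i\<in>UNIV. if i = p i then 1 else 0)" for p
    using prod_linear_coeff[of UNIV "\<lambda>i. - (M $ i $ p i)" "\<lambda>i. if i = p i then 1 else 0"]
    by (auto simp: t_def)
  have cp: "charpoly M = (\<Sum>p\<in>{p. p permutes UNIV}. of_int (sign p) * t p)"
    by (simp add: charpoly_def det_def t_def)
  have "degree (of_int (sign p) * t p) \<le> CARD('n)" for p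
    by (rule order_trans[OF degree_mult_le]) (use t(1)[of p] in simp)
  then show "degree (charpoly M) \<le> CARD('n)"
    unfolding cp by (intro degree_sum_le) (auto simp: finite_permutations)
  have "coeff (charpoly M) CARD('n)
      = (\<Sum>p\<in>{p. p permutes UNIV}. of_int (sign p) * (\<Prod>i\<in>UNIV. (mat 1 :: 'a^'n^'n) $ i $ p i))"
    unfolding cp coeff_sum
    by (intro sum.cong refl) (simp add: of_int_poly t mat_def)
  also have "\<dots> = det (mat 1 :: 'a^'n^'n)" by (simp add: det_def)
  finally show "coeff (charpoly M) CARD('n) = 1" by simp
qed

primrec matrix_power :: "'a::semiring_1^'n^'n \<Rightarrow> nat \<Rightarrow> 'a^'n^'n" where
  "matrix_power M 0 = mat 1"
| "matrix_power M (Suc i) = M ** matrix_power M i"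

text \<open>The matrix \<open>\<chi>'(M)\<close>, where \<open>\<chi>\<close> is the characteristic polynomial of \<open>M\<close>. Its determinant, a
  polynomial in the entries of \<open>M\<close>, plays the role of the discriminant of \<open>\<chi>\<close>.\<close>

definition charpoly_deriv_at :: "real^'n^'n \<Rightarrow> real^'n^'n" where
  "charpoly_deriv_at M = (\<Sum>i\<le>CARD('n). coeff (pderiv (charpoly M)) i *\<^sub>R matrix_power M i)"

abbreviation complex_matrix :: "real^'n^'m \<Rightarrow> complex^'n^'m" where
  "complex_matrix \<equiv> map_matrix complex_of_real"

lemma complex_matrix_mult: "complex_matrix (A ** B) = complex_matrix A ** complex_matrix B"
  by (simp add: vec_eq_iff matrix_matrix_mult_def)

lemma complex_matrix_1: "complex_matrix (mat 1) = mat 1"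
  by (simp add: vec_eq_iff mat_def)

lemma complex_matrix_add: "complex_matrix (A + B) = complex_matrix A + complex_matrix B"
  by (simp add: vec_eq_iff)

lemma complex_matrix_inject: "complex_matrix A = complex_matrix B \<longleftrightarrow> A = B"
  by (simp add: vec_eq_iff)

lemma det_complex_matrix: "det (complex_matrix A) = complex_of_real (det A)"
  by (simp add: det_def)

lemma complex_matrix_scaleR: "complex_matrix (c *\<^sub>R A) = c *\<^sub>R complex_matrix A"
  by (simp add: vec_eq_iff scaleR_conv_of_real[where 'a = complex])

lemma complex_matrix_sum: "complex_matrix (\<Sum>i\<in>S. f i) = (\<Sum>i\<in>S. complex_matrix (f i))"
  by (induction S rule: infinite_finite_induct) (auto simp: complex_matrix_add, auto simp: vec_eq_iff)

lemma poly_map_of_real: "poly (map_poly complex_of_real p) (complex_of_real x)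
    = complex_of_real (poly p x)"
  by (induction p) (auto simp: map_poly_pCons)

text \<open>Both sides agree at every real point.\<close>

lemma charpoly_complex_matrix:
  "charpoly (complex_matrix M) = map_poly complex_of_real (charpoly M)"
proof (rule ccontr)
  define p where "p = charpoly (complex_matrix M) - map_poly complex_of_real (charpoly M)"
  assume "\<not> ?thesis"
  then have "finite {x. poly p x = 0}" by (intro poly_roots_finite) (simp add: p_def)
  moreover have "poly p (complex_of_real x) = 0" for x
  proof -
    have "(\<chi> i j. (if i = j then complex_of_real x else 0) - complex_matrix M $ i $ j)
        = complex_matrix (\<chi> i j. (if i = j then x else 0) - M $ i $ j)"
      by (simp add: vec_eq_iff)
    then have "poly (charpoly (complex_matrix M)) (complex_of_real x)
        = complex_of_real (poly (charpoly M) x)"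
      by (simp add: poly_charpoly det_complex_matrix[symmetric])
    then show ?thesis by (simp add: p_def poly_map_of_real)
  qed
  then have "range complex_of_real \<subseteq> {x. poly p x = 0}" by auto
  ultimately have "finite (range complex_of_real)" by (rule rev_finite_subset)
  then show False by (simp add: finite_image_iff inj_on_def infinite_UNIV_char_0)
qed

lemma eigenvector_exists:
  fixes M :: "'a::field^'n^'n"
  assumes "poly (charpoly M) z = 0"
  obtains v where "v \<noteq> 0" "M *v v = z *s v"
proof -
  define A where "A = (\<chi> i j. (if i = j then z else 0) - M $ i $ j)"
  have "det A = 0" using assms by (simp add: A_def poly_charpoly)
  then have "\<not> (\<exists>B. B ** A = mat 1)"
    by (metis det_I det_mul mult_zero_right zero_neq_one)
  then obtain v where v: "A *v v = 0" "v \<noteq> 0" using matrix_left_invertible_ker by blast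
  have "(A *v v) $ i = z * v $ i - (M *v v) $ i" for i
  proof -
    have "(A *v v) $ i = (\<Sum>j\<in>UNIV. (if i = j then z * v $ j else 0) - M $ i $ j * v $ j)"
      unfolding A_def matrix_vector_mult_def vec_lambda_beta
      by (intro sum.cong) (auto simp: left_diff_distrib)
    then show ?thesis by (simp add: sum_subtractf matrix_vector_mult_def)
  qed
  then have "M *v v = z *s v" using v(1) by (simp add: vec_eq_iff)
  with v that show thesis by blast
qed

text \<open>An eigenvector for a multiple root \<open>z\<close> of \<open>\<chi>\<close> is killed by \<open>\<chi>'(M)\<close>, which acts on it as
  \<open>\<chi>'(z) = 0\<close>.\<close>

lemma charpoly_rsquarefree:
  fixes M :: "real^'n^'n"
  assumes "det (charpoly_deriv_at M) \<noteq> 0"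
  shows "rsquarefree (charpoly (complex_matrix M))"
  unfolding rsquarefree_roots
proof (intro allI notI, elim conjE)
  fix z
  assume z: "poly (charpoly (complex_matrix M)) z
      = 0" "poly (pderiv (charpoly (complex_matrix M))) z = 0"
  obtain v where v: "v \<noteq> 0" "complex_matrix M *v v = z *s v" using eigenvector_exists[OF z(1)] .
  have pow: "complex_matrix (matrix_power M i) *v v = z ^ i *s v" for i
  proof (induction i)
    case (Suc i)
    have "complex_matrix (matrix_power M (Suc i)) *v v
        = complex_matrix M *v (complex_matrix (matrix_power M i) *v v)"
      by (simp add: complex_matrix_mult matrix_vector_mul_assoc)
    also have "\<dots> = z ^ i *s (complex_matrix M *v v)"
      by (simp add: Suc vec.scale)
    finally show ?case by (simp add: v(2) mult.commute)
  qed (simp add: complex_matrix_1)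
  have dist: "(\<Sum>i\<in>S. f i) *v v = (\<Sum>i\<in>S. f i *v v)" for S and f :: "nat \<Rightarrow> complex^'n^'n"
    by (induction S rule: infinite_finite_induct) (auto simp: matrix_vector_mult_add_rdistrib)
  define p where "p = charpoly (complex_matrix M)"
  have pc: "complex_of_real (coeff (pderiv (charpoly M)) i) = coeff (pderiv p) i" for i
    by (simp add: p_def charpoly_complex_matrix coeff_pderiv coeff_map_poly)
  have "complex_matrix (charpoly_deriv_at M) *v v
      = (\<Sum>i\<le>CARD('n). complex_of_real (coeff (pderiv (charpoly M)) i) *s (z ^ i *s v))"
  proof -
    have "(c *\<^sub>R A) *v v = complex_of_real c *s (A *v v)" for c and A :: "complex^'n^'n"
      by (simp add: vec_eq_iff matrix_vector_mult_def scaleR_conv_of_real[where 'a = complex]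
          sum_distrib_left mult.assoc)
    then show ?thesis
      by (simp add: charpoly_deriv_at_def complex_matrix_sum complex_matrix_scaleR dist pow)
  qed
  also have "\<dots> = (\<Sum>i\<le>CARD('n). coeff (pderiv p) i * z ^ i) *s v"
    by (simp add: pc vec.scale_sum_left)
  also have "(\<Sum>i\<le>CARD('n). coeff (pderiv p) i * z ^ i) = poly (pderiv p) z"
  proof -
    have "degree (pderiv p) \<le> CARD('n)"
      using charpoly_monic(1)[of "complex_matrix M"] degree_pderiv[of p] by (simp add: p_def)
    then show ?thesis
      unfolding poly_altdef by (intro sum.mono_neutral_right) (auto simp: coeff_eq_0)
  qed
  finally have "complex_matrix (charpoly_deriv_at M) *v v = 0" using z(2) by (simp add: p_def)
  moreover have "det (complex_matrix (charpoly_deriv_at M)) \<noteq> 0"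
    using assms by (simp add: det_complex_matrix)
  ultimately show False using v(1) matrix_vector_mult_eq_0_iff by blast
qed

lemma rsquarefree_card_roots:
  fixes p :: "complex poly"
  assumes "rsquarefree p"
  shows "card {z. poly p z = 0} = degree p"
proof -
  have "p \<noteq> 0" using assms by (simp add: rsquarefree_def)
  have "degree p = degree (\<Prod>z|poly p z = 0. [:-z, 1:])"
    using complex_poly_decompose_rsquarefree[OF assms] \<open>p \<noteq> 0\<close>
    by (metis degree_smult_eq leading_coeff_0_iff)
  also have "\<dots> = card {z. poly p z = 0}"
    by (subst degree_prod_eq_sum_degree) auto
  finally show ?thesis by simp
qed

text \<open>Applying \<open>M - l\<^sub>j\<close> to a linear dependency that involves the \<open>j\<close>-th eigenvector shortens it.\<close>

lemma distinct_eigenvalues_independent: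
  fixes M V :: "'a::field^'n^'n"
  assumes MV: "M ** V = V ** diagm l" and "inj l" and nz: "\<And>j. V *v axis j 1 \<noteq> 0"
  shows "det V \<noteq> 0"
proof -
  have "x = 0" if "V *v x = 0" for x
    using that
  proof (induction "card {j. x $ j \<noteq> 0}" arbitrary: x rule: less_induct)
    case less
    show ?case
    proof (rule ccontr)
      assume "x \<noteq> 0"
      then obtain j0 where j0: "x $ j0 \<noteq> 0" by (auto simp: vec_eq_iff)
      define y where "y = diagm l *v x - l j0 *s x"
      have y: "y $ j = (l j - l j0) * x $ j" for j
        by (simp add: y_def diagm_mult_vec_nth left_diff_distrib)
      have "V *v (diagm l *v x) = M *v (V *v x)"
        by (simp add: matrix_vector_mul_assoc MV)
      then have "V *v y = 0" by (simp add: y_def vec.diff vec.scale less.prems)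
      moreover have "card {j. y $ j \<noteq> 0} < card {j. x $ j \<noteq> 0}"
        by (rule psubset_card_mono) (use j0 y in auto)
      ultimately have "y = 0" using less.hyps by blast
      then have "x $ j = 0" if "j \<noteq> j0" for j
        using that y[of j] \<open>inj l\<close> by (auto simp: inj_eq)
      moreover define c where "c = x $ j0"
      ultimately have x: "x = c *s axis j0 1" by (auto simp: vec_eq_iff axis_def)
      have "V *v (c *s axis j0 1) = 0" using less.prems unfolding x .
      then have "c *s (V *v axis j0 1) = 0" by (simp only: vec.scale)
      then show False using nz[of j0] j0 by (simp add: vec.scale_eq_0_iff c_def)
    qed
  qed
  then have "\<exists>B. B ** V = mat 1" by (simp add: matrix_left_invertible_ker)
  then obtain B where "B ** V = mat 1" ..
  then show ?thesis by (metis det_I det_mul mult_zero_right zero_neq_one)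
qed

text \<open>The non-real eigenvalues of the real matrix \<open>M\<close> come in conjugate pairs, and the conjugate
  of an eigenvector belongs to the conjugate eigenvalue. The permutation \<open>\<sigma>\<close> records the pairing.\<close>

lemma conjugation_closed_eigenbasis:
  fixes M :: "real^'n^'n"
  assumes "det (charpoly_deriv_at M) \<noteq> 0"
  obtains V l \<sigma> where "det V \<noteq> 0" "complex_matrix M ** V = V ** diagm l" "inj l"
    "range l = {z. poly (charpoly (complex_matrix M)) z = 0}"
    "bij \<sigma>" "\<And>j. l (\<sigma> j) = cnj (l j)" "\<And>a j. V $ a $ \<sigma> j = cnj (V $ a $ j)"
proof -
  define p where "p = charpoly (complex_matrix M)"
  define Z where "Z = {z. poly p z = 0}"
  have rs: "rsquarefree p" using charpoly_rsquarefree[OF assms] by (simp add: p_def)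
  have "degree p = CARD('n)"
    using charpoly_monic[of "complex_matrix M"] le_degree[of p "CARD('n)"] by (simp add: p_def)
  then have "card Z = CARD('n)" using rsquarefree_card_roots[OF rs] by (simp add: Z_def)
  moreover have "finite Z" using rs poly_roots_finite[of p] by (simp add: Z_def rsquarefree_def)
  ultimately obtain l where l: "bij_betw l (UNIV :: 'n set) Z"
    using finite_same_card_bij[of "UNIV :: 'n set" Z] by auto
  have cnjM: "(complex_matrix M *v (\<chi> i. cnj (v $ i))) $ i = cnj ((complex_matrix M *v v) $ i)" for v i
    by (simp add: matrix_vector_mult_def)
  have eig: "\<exists>v. v \<noteq> 0 \<and> complex_matrix M *v v = z *s v" if "z \<in> Z" for z
    using eigenvector_exists[of "complex_matrix M" z] that by (auto simp: Z_def p_def)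
  have Zcnj: "cnj z \<in> Z" if z: "z \<in> Z" for z
  proof -
    have "poly (map_poly cnj p) (cnj z) = 0" using z by (simp add: Z_def poly_cnj[symmetric])
    moreover have "map_poly cnj p = p"
      by (simp add: p_def charpoly_complex_matrix map_poly_map_poly o_def)
    ultimately show ?thesis by (simp add: Z_def)
  qed
  have realeig: "\<exists>v. v \<noteq> 0 \<and> M *v v = x *s v" if x: "complex_of_real x \<in> Z" for x
  proof -
    have "poly (charpoly M) x = 0"
      using x by (simp add: Z_def p_def charpoly_complex_matrix poly_map_of_real)
    then show ?thesis using eigenvector_exists[of M x] by blast
  qed
  define u where "u z = (SOME v. v \<noteq> 0 \<and> complex_matrix M *v v = z *s v)" for z
  define r where "r x = (SOME v. v \<noteq> 0 \<and> M *v v = x *s v)" for x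
  have u: "u z \<noteq> 0" "complex_matrix M *v u z = z *s u z" if "z \<in> Z" for z
    using someI_ex[OF eig[OF that]] by (auto simp: u_def)
  have r: "r x \<noteq> 0" "M *v r x = x *s r x" if "complex_of_real x \<in> Z" for x
    using someI_ex[OF realeig[OF that]] by (auto simp: r_def)
  \<comment> \<open>Choose eigenvectors in the upper half plane, conjugate them into the lower one, and take real
    ones for real eigenvalues.\<close>
  define ve :: "complex \<Rightarrow> complex^'n" where "ve z
      = (if Im z > 0 then u z else if Im z < 0 then (\<chi> i. cnj (u (cnj z) $ i))
    else (\<chi> i. complex_of_real (r (Re z) $ i)))" for z
  have ve_cnj: "ve (cnj z) $ i = cnj (ve z $ i)" for z i
    by (simp add: ve_def)
  have ve: "ve z \<noteq> 0 \<and> complex_matrix M *v ve z = z *s ve z" if z: "z \<in> Z" for z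
  proof -
    consider "Im z > 0" | "Im z < 0" | "Im z = 0" by linarith
    then show ?thesis
    proof cases
      case 1
      then show ?thesis using u[OF z] by (simp add: ve_def)
    next
      case 2
      then have vz: "ve z = (\<chi> i. cnj (u (cnj z) $ i))" by (simp add: ve_def)
      have "(complex_matrix M *v ve z) $ i = z * ve z $ i" for i
        unfolding vz cnjM u(2)[OF Zcnj[OF z]] by simp
      then show ?thesis using u(1)[OF Zcnj[OF z]] by (simp add: vec_eq_iff vz)
    next
      case 3
      then have zr: "z = complex_of_real (Re z)" by (simp add: complex_eq_iff)
      have vz: "ve z = (\<chi> i. complex_of_real (r (Re z) $ i))" using 3 by (simp add: ve_def)
      have Rz: "complex_of_real (Re z) \<in> Z" using z zr by simp
      have "(complex_matrix M *v ve z) $ i = complex_of_real ((M *v r (Re z)) $ i)" for i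
        by (simp add: vz matrix_vector_mult_def)
      then have "(complex_matrix M *v ve z) $ i = z * ve z $ i" for i
        unfolding r(2)[OF Rz] by (simp add: vz zr[symmetric])
      then show ?thesis using r(1)[OF Rz] by (simp add: vec_eq_iff vz)
    qed
  qed
  have lZ: "l j \<in> Z" for j using l by (auto simp: bij_betw_def)
  define V where "V = (\<chi> a j. ve (l j) $ a)"
  have Vax: "V *v axis j 1 = ve (l j)" for j
    by (simp add: vec_eq_iff V_def matrix_vector_mult_def axis_def if_distrib cong: if_cong)
  have MV: "complex_matrix M ** V = V ** diagm l"
  proof -
    have "(complex_matrix M ** V) $ a $ j = (complex_matrix M *v ve (l j)) $ a" for a j
      by (simp add: matrix_matrix_mult_def matrix_vector_mult_def V_def)
    then show ?thesis
      using ve[OF lZ] by (simp add: vec_eq_iff matrix_mult_diagm_nth V_def mult.commute)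
  qed
  have injl: "inj l" using l by (simp add: bij_betw_def)
  have "det V \<noteq> 0"
    by (rule distinct_eigenvalues_independent[OF MV injl]) (use ve[OF lZ] in \<open>simp add: Vax\<close>)
  define \<sigma> where "\<sigma> j = inv l (cnj (l j))" for j
  have ls: "l (\<sigma> j) = cnj (l j)" for j
    using l Zcnj[OF lZ[of j]] by (simp add: \<sigma>_def bij_betw_def f_inv_into_f)
  have "\<sigma> (\<sigma> j) = j" for j
    using injl by (simp add: inj_eq[OF injl, symmetric] ls)
  then have "bij \<sigma>" by (intro involuntory_imp_bij)
  moreover have "V $ a $ \<sigma> j = cnj (V $ a $ j)" for a j
    by (simp add: V_def ls ve_cnj)
  moreover have "range l = {z. poly (charpoly (complex_matrix M)) z = 0}"
    using l by (simp add: bij_betw_def Z_def p_def)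
  ultimately show thesis using that[of V l \<sigma>] \<open>det V \<noteq> 0\<close> MV injl ls by blast
qed

section \<open>Two square observations with simple spectrum\<close>

definition ctranspose :: "complex^'n^'m \<Rightarrow> complex^'m^'n" where
  "ctranspose A = (\<chi> i j. cnj (A $ j $ i))"

lemma ctranspose_mult: "ctranspose (A ** B) = ctranspose B ** ctranspose A"
  by (simp add: vec_eq_iff ctranspose_def matrix_matrix_mult_def mult.commute)

lemma ctranspose_complex_matrix: "ctranspose (complex_matrix A) = complex_matrix (transpose A)"
  by (simp add: vec_eq_iff ctranspose_def transpose_def)

lemma ctranspose_1: "ctranspose (mat 1) = mat 1"
  by (simp add: vec_eq_iff ctranspose_def mat_def)

lemma ctranspose_diagm: "ctranspose (diagm l) = diagm (\<lambda>j. cnj (l j))"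
  by (simp add: vec_eq_iff ctranspose_def diagm_nth)

text \<open>The matrix \<open>V diag(w) V\<^sup>*\<close>, which is real if the columns of \<open>V\<close> and the weights are closed
  under conjugation; taking real parts gives it a real type.\<close>

definition weighted_gram :: "complex^'n^'n \<Rightarrow> ('n \<Rightarrow> real) \<Rightarrow> real^'n^'n" where
  "weighted_gram V w = (\<chi> a b. \<Sum>j\<in>UNIV. w j * Re (V $ a $ j * cnj (V $ b $ j)))"

text \<open>Reindexing by \<open>\<sigma>\<close> conjugates each entry of \<open>V diag(w) V\<^sup>*\<close> and leaves it unchanged.\<close>

lemma complex_weighted_gram:
  fixes V :: "complex^'n^'n"
  assumes "bij \<sigma>" "\<And>a j. V $ a $ \<sigma> j = cnj (V $ a $ j)" "\<And>j. w (\<sigma> j) = w j"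
  shows "complex_matrix (weighted_gram V w) = V ** diagm (\<lambda>j. complex_of_real (w j)) ** ctranspose V"
proof -
  have "complex_of_real (\<Sum>j\<in>UNIV. w j * Re (V $ a $ j * cnj (V $ b $ j)))
      = (\<Sum>j\<in>UNIV. complex_of_real (w j) * (V $ a $ j * cnj (V $ b $ j)))" (is "?l = ?r") for a b
  proof -
    have "cnj ?r = (\<Sum>j\<in>UNIV. complex_of_real (w (\<sigma> j)) * (V $ a $ \<sigma> j * cnj (V $ b $ \<sigma> j)))"
      by (simp add: assms)
    also have "\<dots> = ?r"
      by (rule sum.reindex_bij_betw[OF assms(1)])
    finally have "Im ?r = 0" by (simp add: complex_eq_iff del: cnj_sum)
    then show ?thesis by (simp add: complex_eq_iff)
  qed
  moreover have "(A ** ctranspose V) $ a $ b = (\<Sum>j\<in>UNIV. A $ a $ j * cnj (V $ b $ j))"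
    for A :: "complex^'n^'n" and a b
    by (simp add: matrix_matrix_mult_def ctranspose_def)
  ultimately show ?thesis
    by (simp add: vec_eq_iff weighted_gram_def matrix_mult_diagm_nth mult_ac del: of_real_sum)
qed

lemma weighted_gram_PD:
  fixes V :: "complex^'n^'n"
  assumes "det V \<noteq> 0" "\<And>j. w j > 0"
  shows "weighted_gram V w \<in> PD"
  unfolding PD_def
proof (intro CollectI conjI allI impI)
  show "transpose (weighted_gram V w) = weighted_gram V w"
    by (simp add: vec_eq_iff transpose_def weighted_gram_def mult.commute)
  fix x :: "real^'n" assume "x \<noteq> 0"
  define y where "y = transpose V *v (\<chi> i. complex_of_real (x $ i))"
  have "(\<chi> i. complex_of_real (x $ i)) \<noteq> (0 :: complex^'n)" using \<open>x \<noteq> 0\<close> by (simp add: vec_eq_iff)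
  then have "y \<noteq> 0"
    using assms(1) unfolding y_def by (subst matrix_vector_mult_eq_0_iff) auto
  then obtain j0 where j0: "y $ j0 \<noteq> 0" by (auto simp: vec_eq_iff)
  have y: "y $ j = (\<Sum>a\<in>UNIV. V $ a $ j * complex_of_real (x $ a))" for j
    by (simp add: y_def matrix_vector_mult_def transpose_def del: transpose_matrix_vector)
  have "x \<bullet> (weighted_gram V w *v x)
      = (\<Sum>a\<in>UNIV. \<Sum>b\<in>UNIV. \<Sum>j\<in>UNIV. w j * Re ((V $ a $ j * x $ a) * cnj (V $ b $ j * x $ b)))"
    by (simp add: inner_vec_def matrix_vector_mult_def weighted_gram_def sum_distrib_left
        sum_distrib_right algebra_simps)
  also have "\<dots> = (\<Sum>j\<in>UNIV. \<Sum>a\<in>UNIV. \<Sum>b\<in>UNIV. w j * Re ((V $ a $ j * x $ a) * cnj (V $ b $ j * x $ b)))"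
    by (subst (2) sum.swap, subst sum.swap, rule refl)
  also have "\<dots> = (\<Sum>j\<in>UNIV. w j * Re (y $ j * cnj (y $ j)))"
  proof -
    have "Re (y $ j * cnj (y $ j)) = (\<Sum>a\<in>UNIV. \<Sum>b\<in>UNIV. Re ((V $ a $ j * x $ a) * cnj (V $ b $ j *
        x $ b)))" for j
      unfolding y cnj_sum sum_product Re_sum ..
    then show ?thesis by (simp only: sum_distrib_left)
  qed
  also have "\<dots> = (\<Sum>j\<in>UNIV. w j * (cmod (y $ j))\<^sup>2)"
    by (simp add: complex_mult_cnj cmod_power2)
  also have "\<dots> > 0"
    using j0 assms(2) by (intro sum_pos2[of _ j0]) (auto simp: less_imp_le)
  finally show "0 < x \<bullet> (weighted_gram V w *v x)" .
qed

lemma PD_add_congruence: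
  fixes P :: "real^'n^'n"
  assumes "P \<in> PD" "c > 0"
  shows "c *\<^sub>R P + M ** P ** transpose M \<in> PD"
  unfolding PD_def
proof (intro CollectI conjI allI impI)
  show "transpose (c *\<^sub>R P + M ** P ** transpose M) = c *\<^sub>R P + M ** P ** transpose M"
    by (simp add: transpose_add transpose_scalar matrix_transpose_mul matrix_mul_assoc PD_D(1)[OF
        assms(1)])
  fix x :: "real^'n" assume "x \<noteq> 0"
  have "y \<bullet> (P *v y) \<ge> 0" for y using PD_D(2)[OF assms(1), of y] by (cases "y = 0") auto
  moreover have "x \<bullet> (M ** P ** transpose M *v x) = (transpose M *v x) \<bullet> (P *v (transpose M *v x))"
    using inner_congruence[of x "transpose M" P] by simp
  ultimately have "x \<bullet> (M ** P ** transpose M *v x) \<ge> 0" by simp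
  moreover have "x \<bullet> (c *\<^sub>R P *v x) > 0"
    using PD_D(2)[OF assms(1) \<open>x \<noteq> 0\<close>] assms(2) by (simp add: scaleR_matrix_vector_assoc[symmetric])
  ultimately show "0 < x \<bullet> ((c *\<^sub>R P + M ** P ** transpose M) *v x)"
    by (simp add: matrix_vector_mult_add_rdistrib inner_add_right)
qed

text \<open>In a basis of eigenvectors \<open>M\<close> is diagonal, hence normal, so \<open>\<delta>\<^sup>2 + M M\<^sup>*\<close> and \<open>\<delta>\<^sup>2 + M\<^sup>* M\<close>
  agree. This makes \<open>\<Psi> = V diag(w) V\<^sup>*\<close> solve the likelihood equations whatever the positive
  weights are, as long as conjugate eigenvalues carry the same weight.\<close>

lemma eigenbasis_solves:
  fixes M :: "real^'n^'n"
  assumes V: "det V \<noteq> 0" "complex_matrix M ** V = V ** diagm l"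
    and \<sigma>: "bij \<sigma>" "\<And>a j. V $ a $ \<sigma> j = cnj (V $ a $ j)"
    and w: "\<And>j. w (\<sigma> j) = w j" "\<And>j. w j > 0" and "\<delta> \<noteq> 0"
  obtains R where "R \<in> PD"
    "R ** (\<delta>\<^sup>2 *\<^sub>R weighted_gram V w + M ** weighted_gram V w ** transpose M) = mat 1"
    "weighted_gram V w ** (\<delta>\<^sup>2 *\<^sub>R R + transpose M ** R ** M) = mat 1"
proof -
  define \<Psi> where "\<Psi> = weighted_gram V w"
  define T where "T = \<delta>\<^sup>2 *\<^sub>R \<Psi> + M ** \<Psi> ** transpose M"
  have "T \<in> PD"
    unfolding T_def \<Psi>_def using assms by (intro PD_add_congruence weighted_gram_PD) auto
  then obtain R where R: "R \<in> PD" "T ** R = mat 1" "R ** T = mat 1" using PD_inverse by blast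
  define D where "D f = diagm (\<lambda>j. complex_of_real (f j))" for f :: "'n \<Rightarrow> real"
  define d where "d j = \<delta>\<^sup>2 + (cmod (l j))\<^sup>2" for j
  have d: "d j > 0" for j using assms by (simp add: d_def add_pos_nonneg)
  have DD: "D f ** D g = D (\<lambda>j. f j * g j)" for f g by (simp add: D_def diagm_mult_diagm)
  have abs2: "z * cnj z = (complex_of_real (cmod z))\<^sup>2" for z
    by (metis complex_norm_square of_real_power)
  have Ds: "\<delta>\<^sup>2 *\<^sub>R D f + diagm l ** D f ** ctranspose (diagm l) = D (\<lambda>j. d j * f j)" for f
    by (simp add: vec_eq_iff D_def ctranspose_diagm diagm_mult_diagm diagm_nth d_def
        scaleR_conv_of_real[where 'a = complex] algebra_simps abs2)
  have Ds': "\<delta>\<^sup>2 *\<^sub>R D f + ctranspose (diagm l) ** D f ** diagm l = D (\<lambda>j. d j * f j)" for f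
    by (simp add: vec_eq_iff D_def ctranspose_diagm diagm_mult_diagm diagm_nth d_def
        scaleR_conv_of_real[where 'a = complex] algebra_simps abs2)
  have scaleL: "(c *\<^sub>R A) ** B = c *\<^sub>R (A ** B)" and scaleR: "A ** (c *\<^sub>R B) = c *\<^sub>R (A ** B)"
    for c and A B :: "complex^'n^'n"
    by (simp_all add: vec_eq_iff matrix_matrix_mult_def scaleR_conv_of_real[where 'a = complex]
        sum_distrib_left mult_ac)
  obtain U where U: "V ** U = mat 1" "U ** V = mat 1" using invertible_obtain_inverse[OF V(1)] by blast
  have Uc: "ctranspose U ** ctranspose V = mat 1" "ctranspose V ** ctranspose U = mat 1"
    using U by (metis ctranspose_mult ctranspose_1)+
  have C\<Psi>: "complex_matrix \<Psi> = V ** D w ** ctranspose V"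
    unfolding \<Psi>_def D_def by (rule complex_weighted_gram[of \<sigma> V w, OF \<sigma> w(1)])
  have CM: "complex_matrix M = V ** diagm l ** U"
    using V(2) U(1) by (metis matrix_mul_assoc matrix_mul_rid)
  have CMt: "complex_matrix (transpose M) = ctranspose U ** ctranspose (diagm l) ** ctranspose V"
    unfolding ctranspose_complex_matrix[symmetric] CM by (simp add: ctranspose_mult matrix_mul_assoc)
  have "complex_matrix M ** complex_matrix \<Psi> ** complex_matrix (transpose M)
      = V ** diagm l ** (U ** V) ** D w ** (ctranspose V ** ctranspose U) ** ctranspose (diagm l)
          ** ctranspose V"
    unfolding CM C\<Psi> CMt by (simp only: matrix_mul_assoc)
  then have "complex_matrix T = V ** (\<delta>\<^sup>2 *\<^sub>R D w + diagm l ** D w ** ctranspose (diagm l)) **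
      ctranspose V"
    by (simp add: T_def complex_matrix_add complex_matrix_scaleR complex_matrix_mult C\<Psi> U Uc
        matrix_add_ldistrib matrix_add_rdistrib scaleL scaleR matrix_mul_assoc)
  then have CT: "complex_matrix T = V ** D (\<lambda>j. d j * w j) ** ctranspose V" by (simp only: Ds)
  define CR where "CR = ctranspose U ** D (\<lambda>j. 1 / (d j * w j)) ** U"
  have "complex_matrix T ** CR
      = V ** D (\<lambda>j. d j * w j) ** (ctranspose V ** ctranspose U) ** D (\<lambda>j. 1 / (d j * w j)) ** U"
    unfolding CT CR_def by (simp only: matrix_mul_assoc)
  also have "\<dots> = V ** (D (\<lambda>j. d j * w j) ** D (\<lambda>j. 1 / (d j * w j))) ** U"
    by (simp add: Uc matrix_mul_assoc)
  also have "D (\<lambda>j. d j * w j) ** D (\<lambda>j. 1 / (d j * w j)) = mat 1"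
  proof -
    have "d j * w j \<noteq> 0" for j using d[of j] w(2)[of j] by simp
    then show ?thesis unfolding DD by (simp add: D_def diagm_1)
  qed
  finally have TCR: "complex_matrix T ** CR = mat 1" by (simp add: U)
  have "complex_matrix R ** complex_matrix T = mat 1"
    by (simp add: complex_matrix_mult[symmetric] R complex_matrix_1)
  then have CR: "complex_matrix R = CR"
    using TCR by (metis matrix_mul_assoc matrix_mul_lid matrix_mul_rid)
  have "complex_matrix (transpose M) ** complex_matrix R ** complex_matrix M
      = ctranspose U ** ctranspose (diagm l) ** (ctranspose V ** ctranspose U)
        ** D (\<lambda>j. 1 / (d j * w j)) ** (U ** V) ** diagm l ** U"
    unfolding CM CR CR_def CMt by (simp only: matrix_mul_assoc)
  then have "complex_matrix (\<delta>\<^sup>2 *\<^sub>R R + transpose M ** R ** M)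
      = ctranspose U ** (\<delta>\<^sup>2 *\<^sub>R D (\<lambda>j. 1 / (d j * w j))
          + ctranspose (diagm l) ** D (\<lambda>j. 1 / (d j * w j)) ** diagm l) ** U"
    by (simp add: complex_matrix_add complex_matrix_scaleR complex_matrix_mult CR CR_def U Uc
        matrix_add_ldistrib matrix_add_rdistrib scaleL scaleR matrix_mul_assoc)
  also have "\<dots> = ctranspose U ** D (\<lambda>j. 1 / w j) ** U"
  proof -
    have "d j * (1 / (d j * w j)) = 1 / w j" for j using d[of j] by simp
    then show ?thesis by (simp only: Ds')
  qed
  finally have "complex_matrix (\<Psi> ** (\<delta>\<^sup>2 *\<^sub>R R + transpose M ** R ** M))
      = V ** D w ** (ctranspose V ** ctranspose U) ** D (\<lambda>j. 1 / w j) ** U"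
    by (simp add: complex_matrix_mult C\<Psi> matrix_mul_assoc)
  also have "\<dots> = V ** (D w ** D (\<lambda>j. 1 / w j)) ** U" by (simp add: Uc matrix_mul_assoc)
  also have "D w ** D (\<lambda>j. 1 / w j) = mat 1"
  proof -
    have "w j \<noteq> 0" for j using w(2)[of j] by simp
    then show ?thesis unfolding DD by (simp add: D_def diagm_1)
  qed
  finally have "complex_matrix (\<Psi> ** (\<delta>\<^sup>2 *\<^sub>R R + transpose M ** R ** M)) = complex_matrix (mat 1)"
    by (simp add: U complex_matrix_1)
  then have "\<Psi> ** (\<delta>\<^sup>2 *\<^sub>R R + transpose M ** R ** M) = mat 1" by (simp only: complex_matrix_inject)
  with R that show thesis unfolding T_def \<Psi>_def by blast
qed

text \<open>The determinant changes sign on the segment from \<open>M\<close> to the identity. A singular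
  \<open>s + (1 - s) M\<close> means that \<open>s / (s - 1)\<close> is an eigenvalue of \<open>M\<close>.\<close>

lemma negative_det_real_eigenvalue:
  fixes M :: "real^'n^'n"
  assumes "det M < 0"
  obtains x where "poly (charpoly M) x = 0"
proof -
  define f where "f s = det (s *\<^sub>R mat 1 + (1 - s) *\<^sub>R M)" for s :: real
  have "continuous_on {0..1} f" unfolding f_def by (intro continuous_intros)
  moreover have "f 0 \<le> 0" "0 \<le> f 1" using assms by (simp_all add: f_def)
  ultimately obtain s where s: "0 \<le> s" "s \<le> 1" "f s = 0" using IVT'[of f 0 0 1] by auto
  have "s \<noteq> 1" using s(3) by (auto simp: f_def)
  define x where "x = s / (s - 1)"
  have "s *\<^sub>R mat 1 + (1 - s) *\<^sub>R M = (s - 1) *\<^sub>R (\<chi> i j. (if i = j then x else 0) - M $ i $ j)"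
  proof -
    have "(s - 1) * x = s" using \<open>s \<noteq> 1\<close> by (simp add: x_def)
    then show ?thesis
      by (simp add: vec_eq_iff mat_def right_diff_distrib) (simp add: algebra_simps)
  qed
  then have "f s = (s - 1) ^ CARD('n) * poly (charpoly M) x"
    by (simp add: f_def det_scaleR poly_charpoly)
  then show thesis using s(3) \<open>s \<noteq> 1\<close> that by simp
qed

context row_blocks
begin

lemma mle_exists_pair:
  assumes k: "k = 1" and L: "det L \<noteq> 0" "L ** Y 0 = \<delta> *\<^sub>R incl 0" "L ** Y 1 = incl 0 ** M" "\<delta> \<noteq> 0"
    and simple: "det (charpoly_deriv_at M) \<noteq> 0"
  shows "mle_exists 2 Y"
proof -
  obtain V l \<sigma> where V: "det V \<noteq> 0" "complex_matrix M ** V = V ** diagm l"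
    "bij \<sigma>" "\<And>a j. V $ a $ \<sigma> j = cnj (V $ a $ j)"
    by (rule conjugation_closed_eigenbasis[OF simple]) (rule that)
  obtain R where R: "R \<in> PD"
    "R ** (\<delta>\<^sup>2 *\<^sub>R weighted_gram V (\<lambda>_. 1) + M ** weighted_gram V (\<lambda>_. 1) ** transpose M) = mat 1"
    "weighted_gram V (\<lambda>_. 1) ** (\<delta>\<^sup>2 *\<^sub>R R + transpose M ** R ** M) = mat 1"
    by (rule eigenbasis_solves[OF V, of "\<lambda>_. 1" \<delta>]) (use L in auto)
  have "weighted_gram V (\<lambda>_. 1) \<in> PD" using V(1) by (intro weighted_gram_PD) auto
  then show ?thesis
    using likelihood_equations_pair[OF k L(1-3) _ R] likelihood_equations_imp_exists by blast
qed

text \<open>The weight of a real eigenvalue can be changed on its own, because \<open>\<sigma>\<close> fixes its index.\<close>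

lemma not_unique_pair:
  assumes k: "k = 1" and L: "det L \<noteq> 0" "L ** Y 0 = \<delta> *\<^sub>R incl 0" "L ** Y 1 = incl 0 ** M" "\<delta> \<noteq> 0"
    and simple: "det (charpoly_deriv_at M) \<noteq> 0" and neg: "det M < 0" and "CARD('m2) \<ge> 2"
  shows "\<not> mle_exists_uniquely 2 Y"
proof -
  obtain V l \<sigma> where V: "det V \<noteq> 0" "complex_matrix M ** V = V ** diagm l"
    "bij \<sigma>" "\<And>a j. V $ a $ \<sigma> j = cnj (V $ a $ j)"
    and l: "inj l" "range l = {z. poly (charpoly (complex_matrix M)) z = 0}" "\<And>j. l (\<sigma> j) = cnj (l j)"
    by (rule conjugation_closed_eigenbasis[OF simple]) (rule that)
  obtain x where "poly (charpoly M) x = 0" using negative_det_real_eigenvalue[OF neg] .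
  then have "complex_of_real x \<in> range l"
    by (simp add: l(2) charpoly_complex_matrix poly_map_of_real)
  then obtain j0 where j0: "l j0 = complex_of_real x" by auto
  have \<sigma>0: "\<sigma> j = j0 \<longleftrightarrow> j = j0" for j
  proof -
    have "l (\<sigma> j0) = l j0" using l(3)[of j0] j0 by simp
    then have "\<sigma> j0 = j0" using l(1) by (simp add: inj_eq)
    then show ?thesis using V(3) by (metis bij_is_inj inj_eq)
  qed
  define w where "w j = (if j = j0 then 2 else (1::real))" for j
  obtain R where R: "R \<in> PD"
    "R ** (\<delta>\<^sup>2 *\<^sub>R weighted_gram V (\<lambda>_. 1) + M ** weighted_gram V (\<lambda>_. 1) ** transpose M) = mat 1"
    "weighted_gram V (\<lambda>_. 1) ** (\<delta>\<^sup>2 *\<^sub>R R + transpose M ** R ** M) = mat 1"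
    by (rule eigenbasis_solves[OF V, of "\<lambda>_. 1" \<delta>]) (use L in auto)
  obtain R' where R': "R' \<in> PD"
    "R' ** (\<delta>\<^sup>2 *\<^sub>R weighted_gram V w + M ** weighted_gram V w ** transpose M) = mat 1"
    "weighted_gram V w ** (\<delta>\<^sup>2 *\<^sub>R R' + transpose M ** R' ** M) = mat 1"
    by (rule eigenbasis_solves[OF V, of w \<delta>]) (use L in \<open>auto simp: w_def \<sigma>0\<close>)
  have PD: "weighted_gram V (\<lambda>_. 1) \<in> PD" "weighted_gram V w \<in> PD"
    using V(1) by (auto intro!: weighted_gram_PD simp: w_def)
  obtain P P' where "likelihood_equations 2 Y P (weighted_gram V (\<lambda>_. 1))"
      "likelihood_equations 2 Y P' (weighted_gram V w)"
    using likelihood_equations_pair[OF k L(1-3) PD(1) R] likelihood_equations_pair[OF k L(1-3) PD(2) R']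
    by blast
  moreover have "weighted_gram V w \<noteq> c *\<^sub>R weighted_gram V (\<lambda>_. 1)" for c
  proof
    assume eq: "weighted_gram V w = c *\<^sub>R weighted_gram V (\<lambda>_. 1)"
    obtain U where U: "V ** U = mat 1" "U ** V = mat 1" using invertible_obtain_inverse[OF V(1)]
        by blast
    have Uc: "ctranspose V ** ctranspose U = mat 1"
      using U by (metis ctranspose_mult ctranspose_1)
    have rec: "diagm (\<lambda>j. complex_of_real (v j))
        = U ** complex_matrix (weighted_gram V v) ** ctranspose U"
      if "\<And>j. v (\<sigma> j) = v j" for v
    proof -
      have "U ** complex_matrix (weighted_gram V v) ** ctranspose U
          = (U ** V) ** diagm (\<lambda>j. complex_of_real (v j)) ** (ctranspose V ** ctranspose U)"
        unfolding complex_weighted_gram[of \<sigma> V v, OF V(3,4) that] by (simp only: matrix_mul_assoc)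
      then show ?thesis by (simp add: U Uc)
    qed
    have entry: "complex_of_real (w j) = complex_of_real c" for j
    proof -
      have "complex_of_real (w j) = (U ** complex_matrix (weighted_gram V w) ** ctranspose U) $ j $ j"
        using rec[of w] by (simp add: w_def \<sigma>0 diagm_nth flip: rec)
      also have "\<dots> = complex_of_real c * (U ** complex_matrix (weighted_gram V (\<lambda>_. 1)) **
          ctranspose U) $ j $ j"
        by (simp add: eq matrix_matrix_mult_def sum_distrib_left sum_distrib_right mult_ac)
      also have "\<dots> = complex_of_real c"
        using rec[of "\<lambda>_. 1"] by (simp add: diagm_nth flip: rec)
      finally show ?thesis .
    qed
    obtain b where "b \<noteq> j0"
      using assms(8) by (metis One_nat_def Suc_1 card_2_iff' ex_card UNIV_I top_greatest)
    then show False using entry[of j0] entry[of b] by (simp add: w_def)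
  qed
  ultimately show ?thesis by (rule not_unique_if_two_solutions)
qed

end

section \<open>Polynomial events under Gaussian laws\<close>

text \<open>The properties of polynomials under a law with a positive density. The first clause yields
  almost sure statements; the second, read contrapositively, yields events \<open>F < 0\<close> of positive
  probability.\<close>

definition zero_one_class :: "'v measure \<Rightarrow> ('v \<Rightarrow> real) set \<Rightarrow> bool" where
  "zero_one_class M C \<longleftrightarrow> (\<forall>F\<in>C. ((\<exists>x. F x \<noteq> 0) \<longrightarrow> (AE x in M. F x \<noteq> 0)) \<and>
     ((AE x in M. F x \<ge> 0) \<longrightarrow> (\<forall>x. F x \<ge> 0)))"

lemma zero_one_class_normal: "zero_one_class std_normal_distribution (range poly)"
  unfolding zero_one_class_def
proof (intro ballI conjI impI allI)
  fix F :: "real \<Rightarrow> real" assume "F \<in> range poly"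
  then obtain p where p: "F = poly p" by auto
  have AE_iff: "(AE x in std_normal_distribution. P x) \<longleftrightarrow> (AE x in lborel. P x)" for P
    by (subst AE_density) (auto simp: normal_density_pos)
  {
    assume "\<exists>x. F x \<noteq> 0"
    then have "p \<noteq> 0" using p by auto
    then have "{x. poly p x = 0} \<in> null_sets lborel"
      by (intro finite_imp_null_set_lborel poly_roots_finite)
    then show "AE x in std_normal_distribution. F x \<noteq> 0"
      unfolding AE_iff p by (intro AE_I'[of "{x. poly p x = 0}"]) auto
  }
  {
    fix x0
    assume "AE x in std_normal_distribution. F x \<ge> 0"
    then have ae: "AE x in lborel. F x \<ge> 0" by (simp only: AE_iff)
    show "F x0 \<ge> 0"
    proof (rule ccontr)
      assume "\<not> F x0 \<ge> 0"
      then have "x0 \<in> {x. poly p x < 0}" by (simp add: p)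
      moreover have "open {x. poly p x < 0}" by (intro open_Collect_less continuous_intros)
      ultimately obtain e where e: "e > 0" "ball x0 e \<subseteq> {x. poly p x < 0}"
        using open_contains_ball by blast
      have "AE x in lborel. x \<notin> {x0 - e <..< x0 + e}"
        using ae
      proof eventually_elim
        case (elim x)
        show ?case
        proof
          assume "x \<in> {x0 - e <..< x0 + e}"
          then have "poly p x < 0" using e(2) by (auto simp: ball_eq_greaterThanLessThan)
          then show False using elim by (simp add: p)
        qed
      qed
      then have "{x0 - e <..< x0 + e} \<in> null_sets lborel"
        by (subst AE_iff_null_sets) auto
      then show False using e(1) by (simp add: null_sets_def)
    qed
  }
qed

text \<open>Both clauses pass to finite powers by Fubini, one coordinate at a time. The coordinates
  outside \<open>J\<close> are frozen at the values of \<open>y\<close>, which the induction has to vary.\<close>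

lemma zero_one_class_PiM:
  fixes F :: "('i \<Rightarrow> 'v) \<Rightarrow> real"
  assumes M: "prob_space M" "space M = UNIV" and C: "zero_one_class M C" and "finite J"
    and FC: "\<And>x i. (\<lambda>v. F (x(i := v))) \<in> C"
    and meas: "\<And>y J. finite J \<Longrightarrow> (\<lambda>x. F (override_on y x J)) \<in> borel_measurable (Pi\<^sub>M J (\<lambda>_. M))"
  shows "((\<exists>x. F (override_on y x J) \<noteq> 0) \<longrightarrow> (AE x in Pi\<^sub>M J (\<lambda>_. M). F (override_on y x J) \<noteq> 0))
    \<and> ((AE x in Pi\<^sub>M J (\<lambda>_. M). F (override_on y x J) \<ge> 0) \<longrightarrow> (\<forall>x. F (override_on y x J) \<ge> 0))"
  using \<open>finite J\<close>
proof (induction J arbitrary: y rule: finite_induct)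
  case empty
  interpret P: prob_space "Pi\<^sub>M {} (\<lambda>_. M)" by (intro prob_space_PiM M)
  show ?case by simp
next
  case (insert i J)
  interpret M: prob_space M by fact
  interpret P: prob_space "Pi\<^sub>M J (\<lambda>_. M)" by (intro prob_space_PiM M)
  interpret pair_sigma_finite M "Pi\<^sub>M J (\<lambda>_. M)" ..
  define g where "g = (\<lambda>(v, x). x(i := v) :: 'i \<Rightarrow> 'v)"
  have g[measurable]: "g \<in> measurable (M \<Otimes>\<^sub>M Pi\<^sub>M J (\<lambda>_. M)) (Pi\<^sub>M (insert i J) (\<lambda>_. M))"
    unfolding g_def by measurable
  have D: "Pi\<^sub>M (insert i J) (\<lambda>_. M) = distr (M \<Otimes>\<^sub>M Pi\<^sub>M J (\<lambda>_. M)) (Pi\<^sub>M (insert i J) (\<lambda>_. M)) g"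
    using distr_pair_PiM_eq_PiM[of J "\<lambda>_. M" i] M(1) by (simp add: g_def)
  define H where "H x = F (override_on y x (insert i J))" for x
  have H[measurable]: "H \<in> borel_measurable (Pi\<^sub>M (insert i J) (\<lambda>_. M))"
    unfolding H_def using meas[of "insert i J" y] insert.hyps by simp
  have Hg: "H (g (v, x)) = F (override_on (y(i := v)) x J)" for v x
    unfolding H_def g_def using insert.hyps(2)
    by (intro arg_cong[of _ _ F]) (auto simp: override_on_def fun_eq_iff)
  have Hy: "H x = F (override_on (y(i := x i)) x J)" for x
    unfolding H_def using insert.hyps(2)
    by (intro arg_cong[of _ _ F]) (auto simp: override_on_def fun_eq_iff)
  have sect: "(\<lambda>v. F (override_on (y(i := v)) x J)) \<in> C" for x
  proof -
    have "(\<lambda>v. F (override_on (y(i := v)) x J)) = (\<lambda>v. F ((override_on y x J)(i := v)))"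
      using insert.hyps(2) by (intro ext arg_cong[of _ _ F]) (auto simp: override_on_def fun_eq_iff)
    then show ?thesis using FC by simp
  qed
  have zo: "((\<exists>v. G v \<noteq> 0) \<longrightarrow> (AE v in M. G v \<noteq> 0)) \<and> ((AE v in M. G v \<ge> 0) \<longrightarrow> (\<forall>v. G v \<ge> 0))"
    if "G \<in> C" for G
    using C that unfolding zero_one_class_def by (rule bspec)
  show ?case
  proof (intro conjI impI allI)
    assume "\<exists>x. F (override_on y x (insert i J)) \<noteq> 0"
    then obtain x0 where "H x0 \<noteq> 0" unfolding H_def ..
    then have "F (override_on (y(i := x0 i)) x0 J) \<noteq> 0" using Hy[of x0] by simp
    then have "AE v in M. F (override_on (y(i := v)) x0 J) \<noteq> 0"
      by (intro mp[OF conjunct1[OF zo[OF sect[of x0]]]]) (rule exI)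
    then have "AE v in M. AE x in Pi\<^sub>M J (\<lambda>_. M). H (g (v, x)) \<noteq> 0"
    proof eventually_elim
      case (elim v)
      then have "\<exists>x. F (override_on (y(i := v)) x J) \<noteq> 0" by (rule exI[of _ x0])
      then show ?case unfolding Hg by (rule mp[OF conjunct1[OF insert.IH]])
    qed
    then have "AE z in M \<Otimes>\<^sub>M Pi\<^sub>M J (\<lambda>_. M). H (g z) \<noteq> 0"
      by (intro AE_pair_measure) auto
    then have "AE x in Pi\<^sub>M (insert i J) (\<lambda>_. M). H x \<noteq> 0"
      by (subst D, subst AE_distr_iff) auto
    then show "AE x in Pi\<^sub>M (insert i J) (\<lambda>_. M). F (override_on y x (insert i J)) \<noteq> 0"
      by (simp add: H_def)
  next
    fix x
    assume "AE x in Pi\<^sub>M (insert i J) (\<lambda>_. M). F (override_on y x (insert i J)) \<ge> 0"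
    then have "AE x in distr (M \<Otimes>\<^sub>M Pi\<^sub>M J (\<lambda>_. M)) (Pi\<^sub>M (insert i J) (\<lambda>_. M)) g. H x \<ge> 0"
      unfolding D[symmetric] by (simp add: H_def)
    then have "AE z in M \<Otimes>\<^sub>M Pi\<^sub>M J (\<lambda>_. M). H (g z) \<ge> 0"
      by (subst (asm) AE_distr_iff) auto
    from AE_pair[OF this] have "AE v in M. AE x in Pi\<^sub>M J (\<lambda>_. M). F (override_on (y(i := v)) x J) \<ge> 0"
      by (simp add: Hg)
    then have "AE v in M. F (override_on (y(i := v)) x J) \<ge> 0"
    proof eventually_elim
      case (elim v)
      then have "\<forall>x. F (override_on (y(i := v)) x J) \<ge> 0" by (rule mp[OF conjunct2[OF insert.IH]])
      then show ?case ..
    qed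
    then have "\<forall>v. F (override_on (y(i := v)) x J) \<ge> 0"
      by (rule mp[OF conjunct2[OF zo[OF sect[of x]]]])
    then have "F (override_on (y(i := x i)) x J) \<ge> 0" ..
    then show "0 \<le> F (override_on y x (insert i J))"
      using Hy[of x] by (simp add: H_def)
  qed
qed

lemma borel_measurable_matrix:
  fixes f :: "'x \<Rightarrow> real^'b^'a"
  assumes "\<And>a b. (\<lambda>x. f x $ a $ b) \<in> borel_measurable M"
  shows "f \<in> borel_measurable M"
proof (rule iffD2[OF borel_measurable_euclidean_space], rule ballI)
  fix i :: "real^'b^'a" assume "i \<in> Basis"
  then obtain a b where "i = axis a (axis b 1)" by (auto simp: Basis_vec_def)
  then have "(\<lambda>x. f x \<bullet> i) = (\<lambda>x. f x $ a $ b)" by (simp add: inner_axis fun_eq_iff)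
  then show "(\<lambda>x. f x \<bullet> i) \<in> borel_measurable M" using assms by simp
qed

lemma borel_measurable_matrix_nth [measurable]:
  "(\<lambda>V :: real^'b^'a. V $ a $ b) \<in> borel_measurable borel"
  by (intro borel_measurable_continuous_onI continuous_intros)

text \<open>Restriction to lines gives a notion of polynomial that is invariant under \<open>Z \<mapsto> A Z B\<^sup>T\<close> and
  whose sections in the single entries are polynomials in one variable.\<close>

definition line_polynomials :: "(real^'b^'a \<Rightarrow> real) set" where
  "line_polynomials = {G. G \<in> borel_measurable borel \<and> (\<forall>X D. \<exists>p. \<forall>t. G (X + t *\<^sub>R D) = poly p t)}"

text \<open>The law is the image of independent standard normal entries under the bijective linear map
  \<open>Z \<mapsto> A Z B\<^sup>T\<close>.\<close>

lemma zero_one_class_matrix_normal: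
  assumes "matrix_normal mu \<Sigma>1 \<Sigma>2"
  shows "zero_one_class (mu :: (real^'m2^'m1) measure) line_polynomials"
proof -
  obtain A B where AB: "\<Sigma>1 \<in> PD" "\<Sigma>2 \<in> PD" "\<Sigma>1 = A ** transpose A" "\<Sigma>2 = B ** transpose B"
    and mu: "mu = distr (std_normal_matrix :: (real^'m2^'m1) measure) borel (\<lambda>Z. A ** Z ** transpose B)"
    using assms unfolding matrix_normal_def by blast
  have "det A \<noteq> 0" "det B \<noteq> 0"
    using PD_det_pos[OF AB(1)] PD_det_pos[OF AB(2)] by (auto simp: AB(3,4) det_mul)
  obtain A' where A': "A ** A' = mat 1" using invertible_obtain_inverse[OF \<open>det A \<noteq> 0\<close>] by blast
  obtain B' where B': "B' ** transpose B = mat 1"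
    using invertible_obtain_inverse[of "transpose B"] \<open>det B \<noteq> 0\<close> by auto
  define J where "J = (UNIV :: ('m1 \<times> 'm2) set)"
  define T :: "(('m1 \<times> 'm2) \<Rightarrow> real) \<Rightarrow> real^'m2^'m1" where "T z = (\<chi> i j. z (i, j))" for z
  define S where "S z = A ** T z ** transpose B" for z
  let ?P = "Pi\<^sub>M J (\<lambda>_. std_normal_distribution)"
  have T: "T \<in> borel_measurable ?P"
    unfolding T_def J_def by (intro borel_measurable_matrix) simp
  have lin: "(\<lambda>Z. A ** Z ** transpose B) \<in> borel_measurable borel"
    by (intro borel_measurable_continuous_onI continuous_intros)
  have S[measurable]: "S \<in> borel_measurable ?P"
    unfolding S_def using measurable_compose[OF T lin] by simp
  have muS: "mu = distr ?P borel S"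
    unfolding mu std_normal_matrix_def using distr_distr[OF lin T]
    by (simp add: T_def[abs_def] S_def[abs_def] J_def o_def)
  interpret N: prob_space std_normal_distribution
    using real_dist_normal_dist by (simp add: real_distribution_def)
  have key: "((\<exists>z. G (S z) \<noteq> 0) \<longrightarrow> (AE z in ?P. G (S z) \<noteq> 0))
      \<and> ((AE z in ?P. G (S z) \<ge> 0) \<longrightarrow> (\<forall>z. G (S z) \<ge> 0))" if G: "G \<in> line_polynomials" for G
  proof -
    have Gm: "G \<in> borel_measurable borel" using G by (simp add: line_polynomials_def)
    have sect: "(\<lambda>v. G (S (z(p := v)))) \<in> range poly" for z p
    proof -
      define D :: "real^'m2^'m1" where "D = (\<chi> i j. if (i, j) = p then 1 else 0)"
      have TD: "T (z(p := v)) = T (z(p := 0)) + v *\<^sub>R D" for v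
        by (simp add: vec_eq_iff T_def D_def)
      have SD: "S (z(p := v)) = S (z(p := 0)) + v *\<^sub>R (A ** D ** transpose B)" for v
        unfolding S_def TD[of v] by (simp add: matrix_add_ldistrib matrix_add_rdistrib)
      have "\<exists>q. \<forall>t. G (S (z(p := 0)) + t *\<^sub>R (A ** D ** transpose B)) = poly q t"
        using G by (simp add: line_polynomials_def)
      then obtain q where "\<forall>t. G (S (z(p := 0)) + t *\<^sub>R (A ** D ** transpose B)) = poly q t" ..
      then have "G (S (z(p := v))) = poly q v" for v
        unfolding SD[of v] ..
      then have "(\<lambda>v. G (S (z(p := v)))) = poly q" by (intro ext)
      then show ?thesis by simp
    qed
    have meas: "(\<lambda>z. G (S (override_on y z K))) \<in> borel_measurable (Pi\<^sub>M K (\<lambda>_.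
        std_normal_distribution))"
      for y K
    proof -
      have "(\<lambda>z. override_on y z K p) \<in> borel_measurable (Pi\<^sub>M K (\<lambda>_. std_normal_distribution))" for p
        by (cases "p \<in> K") (simp_all add: override_on_def)
      then have "(\<lambda>z. T (override_on y z K)) \<in> borel_measurable (Pi\<^sub>M K (\<lambda>_. std_normal_distribution))"
        unfolding T_def by (intro borel_measurable_matrix) simp
      from measurable_compose[OF measurable_compose[OF this lin] Gm] show ?thesis by (simp add: S_def)
    qed
    have ov: "override_on undefined z J = z" for z :: "'m1 \<times> 'm2 \<Rightarrow> real"
      by (simp add: J_def override_on_def)
    have "space std_normal_distribution = UNIV" "finite J" by (simp_all add: J_def)
    from zero_one_class_PiM[OF N.prob_space_axioms this(1) zero_one_class_normal this(2),
        of "\<lambda>z. G (S z)" undefined, OF sect meas]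
    show ?thesis unfolding ov .
  qed
  show ?thesis
    unfolding zero_one_class_def
  proof (intro ballI conjI impI allI)
    fix G :: "real^'m2^'m1 \<Rightarrow> real" assume G: "G \<in> line_polynomials"
    then have Gm[measurable]: "G \<in> borel_measurable borel" by (simp add: line_polynomials_def)
    have surj: "\<exists>z. S z = X" for X
    proof -
      have "T (\<lambda>(i, j). (A' ** X ** B') $ i $ j) = A' ** X ** B'" by (simp add: T_def vec_eq_iff)
      then have "S (\<lambda>(i, j). (A' ** X ** B') $ i $ j) = (A ** A') ** X ** (B' ** transpose B)"
        by (simp add: S_def matrix_mul_assoc)
      then show ?thesis by (auto simp: A' B')
    qed
    {
      assume "\<exists>X. G X \<noteq> 0"
      then have "\<exists>z. G (S z) \<noteq> 0" using surj by metis
      then show "AE X in mu. G X \<noteq> 0"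
        using key[OF G] unfolding muS by (subst AE_distr_iff) auto
    }
    {
      fix X
      assume "AE X in mu. G X \<ge> 0"
      then have "AE z in ?P. G (S z) \<ge> 0" unfolding muS by (subst (asm) AE_distr_iff) auto
      then show "G X \<ge> 0" using key[OF G] surj[of X] by metis
    }
  qed
qed

text \<open>Given by closure rules, so that measurability, polynomial sections and dependence on the
  indices in \<open>I\<close> only follow by induction.\<close>

inductive sample_polynomial :: "nat set \<Rightarrow> ((nat \<Rightarrow> real^'b^'a) \<Rightarrow> real) \<Rightarrow> bool" for I where
  const: "sample_polynomial I (\<lambda>_. c)"
| entry: "i \<in> I \<Longrightarrow> sample_polynomial I (\<lambda>Y. Y i $ a $ b)"
| add: "sample_polynomial I F \<Longrightarrow> sample_polynomial I G \<Longrightarrow> sample_polynomial I (\<lambda>Y. F Y + G Y)"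
| mult: "sample_polynomial I F \<Longrightarrow> sample_polynomial I G \<Longrightarrow> sample_polynomial I (\<lambda>Y. F Y * G Y)"

lemma sample_polynomial_sum:
  "(\<And>s. s \<in> S \<Longrightarrow> sample_polynomial I (F s)) \<Longrightarrow> sample_polynomial I (\<lambda>Y. \<Sum>s\<in>S. F s Y)"
  by (induction S rule: infinite_finite_induct)
    (auto intro: sample_polynomial.intros)

lemma sample_polynomial_prod:
  "(\<And>s. s \<in> S \<Longrightarrow> sample_polynomial I (F s)) \<Longrightarrow> sample_polynomial I (\<lambda>Y. \<Prod>s\<in>S. F s Y)"
  by (induction S rule: infinite_finite_induct)
    (auto intro: sample_polynomial.intros)

lemma sample_polynomial_diff:
  assumes "sample_polynomial I F" "sample_polynomial I G"
  shows "sample_polynomial I (\<lambda>Y. F Y - G Y)"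
  using sample_polynomial.add[OF assms(1) sample_polynomial.mult[OF sample_polynomial.const[of I
      "-1"] assms(2)]]
  by simp

lemma sample_polynomial_det:
  fixes A :: "(nat \<Rightarrow> real^'b^'a) \<Rightarrow> real^'n^'n"
  assumes "\<And>i j. sample_polynomial I (\<lambda>Y. A Y $ i $ j)"
  shows "sample_polynomial I (\<lambda>Y. det (A Y))"
  unfolding det_def
  by (intro sample_polynomial_sum sample_polynomial.mult sample_polynomial_prod assms
      sample_polynomial.const)

lemma sample_polynomial_section:
  assumes "sample_polynomial I F"
  shows "(\<lambda>V. F (Y(i := V))) \<in> line_polynomials"
proof -
  have "(\<lambda>V. F (Y(i := V))) \<in> borel_measurable borel"
    using assms by induction (auto simp: fun_upd_def)
  moreover have "\<exists>p. \<forall>t. F (Y(i := X + t *\<^sub>R D)) = poly p t" for X D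
    using assms
  proof induction
    case (const c)
    show ?case by (rule exI[of _ "[:c:]"]) simp
  next
    case (entry j a b)
    show ?case
    proof (cases "j = i")
      case True
      show ?thesis by (rule exI[of _ "[:X $ a $ b, D $ a $ b:]"]) (simp add: True)
    next
      case False
      then show ?thesis by (intro exI[of _ "[:Y j $ a $ b:]"]) simp
    qed
  next
    case (add F G)
    then show ?case by (metis poly_add)
  next
    case (mult F G)
    then show ?case by (metis poly_mult)
  qed
  ultimately show ?thesis by (simp add: line_polynomials_def)
qed

lemma sample_polynomial_cong:
  assumes "sample_polynomial I F" "\<And>i. i \<in> I \<Longrightarrow> Y i = Y' i"
  shows "F Y = F Y'"
  using assms by induction auto

lemma sample_polynomial_measurable:
  fixes F :: "(nat \<Rightarrow> real^'b^'a) \<Rightarrow> real"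
  assumes "sample_polynomial I F" "sets mu = sets borel"
  shows "(\<lambda>x. F (override_on y x J)) \<in> borel_measurable (Pi\<^sub>M J (\<lambda>_. mu))"
  using assms(1)
proof induction
  case (entry i a b)
  show ?case
  proof (cases "i \<in> J")
    case True
    have "(\<lambda>V :: real^'b^'a. V $ a $ b) \<in> borel_measurable mu"
      using borel_measurable_matrix_nth by (subst measurable_cong_sets[OF assms(2) refl])
    from measurable_compose[OF measurable_component_singleton[OF True] this]
    show ?thesis using True by (simp add: override_on_def)
  qed (simp add: override_on_def)
qed auto

lemma matrix_normal_prob_space:
  assumes "matrix_normal mu \<Sigma>1 \<Sigma>2"
  shows "prob_space (mu :: (real^'m2^'m1) measure)" "space mu = UNIV" "sets mu = sets borel"
proof -
  obtain A B where mu: "mu = distr (std_normal_matrix :: (real^'m2^'m1) measure) borel (\<lambda>Z. A ** Z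
      ** transpose B)"
    using assms unfolding matrix_normal_def by blast
  interpret N: prob_space std_normal_distribution
    using real_dist_normal_dist by (simp add: real_distribution_def)
  interpret P: prob_space "Pi\<^sub>M (UNIV :: ('m1 \<times> 'm2) set) (\<lambda>_. std_normal_distribution)"
    by (intro prob_space_PiM N.prob_space_axioms)
  interpret S: prob_space "std_normal_matrix :: (real^'m2^'m1) measure"
    unfolding std_normal_matrix_def
    by (intro P.prob_space_distr borel_measurable_matrix) simp
  have "(\<lambda>Z. A ** Z ** transpose B) \<in> borel_measurable borel"
    by (intro borel_measurable_continuous_onI continuous_intros)
  then have "(\<lambda>Z. A ** Z ** transpose B) \<in> measurable std_normal_matrix borel"
    by (subst measurable_cong_sets[of _ borel borel borel]) (simp_all add: std_normal_matrix_def)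
  then show "prob_space mu" unfolding mu by (rule S.prob_space_distr)
  show "space mu = UNIV" "sets mu = sets borel" by (simp_all add: mu)
qed

lemma sample_polynomial_zero_one:
  assumes mu: "matrix_normal mu \<Sigma>1 \<Sigma>2" and F: "sample_polynomial {..<n} F"
  shows "\<exists>Y. F Y \<noteq> 0 \<Longrightarrow> AE Y in Pi\<^sub>M {..<n} (\<lambda>_. mu). F Y \<noteq> 0"
    and "AE Y in Pi\<^sub>M {..<n} (\<lambda>_. mu). F Y \<ge> 0 \<Longrightarrow> F Y \<ge> 0"
proof -
  have eq: "F (override_on undefined Y {..<n}) = F Y" for Y
    by (rule sample_polynomial_cong[OF F]) simp
  have main: "((\<exists>x. F (override_on undefined x {..<n}) \<noteq> 0) \<longrightarrow>
      (AE x in Pi\<^sub>M {..<n} (\<lambda>_. mu). F (override_on undefined x {..<n}) \<noteq> 0))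
    \<and> ((AE x in Pi\<^sub>M {..<n} (\<lambda>_. mu). F (override_on undefined x {..<n}) \<ge> 0) \<longrightarrow>
      (\<forall>x. F (override_on undefined x {..<n}) \<ge> 0))"
    by (rule zero_one_class_PiM[OF matrix_normal_prob_space(1,2)[OF mu]
        zero_one_class_matrix_normal[OF mu]])
      (simp, rule sample_polynomial_section[OF F],
        rule sample_polynomial_measurable[OF F matrix_normal_prob_space(3)[OF mu]])
  note main = main[unfolded eq]
  show "\<exists>Y. F Y \<noteq> 0 \<Longrightarrow> AE Y in Pi\<^sub>M {..<n} (\<lambda>_. mu). F Y \<noteq> 0"
    by (rule mp[OF conjunct1[OF main]])
  show "AE Y in Pi\<^sub>M {..<n} (\<lambda>_. mu). F Y \<ge> 0 \<Longrightarrow> F Y \<ge> 0"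
    by (rule spec[OF mp[OF conjunct2[OF main]]])
qed

section \<open>Generic generation of the matrix algebra\<close>

text \<open>The words \<open>A\<^sup>i (1 - A B) B\<^sup>j\<close>, written as the rows of a square matrix. When \<open>A\<close> is the lower
  shift and \<open>B\<close> its transpose they are the matrix units.\<close>

definition shift_word :: "real^'n^'n \<Rightarrow> real^'n^'n \<Rightarrow> nat \<Rightarrow> nat \<Rightarrow> real^'n^'n" where
  "shift_word A B i j = matrix_power A i ** (mat 1 - A ** B) ** matrix_power B j"

definition word_matrix :: "('n \<Rightarrow> nat) \<Rightarrow> real^'n^'n \<Rightarrow> real^'n^'n \<Rightarrow> real^('n \<times> 'n)^('n \<times> 'n)" where
  "word_matrix e A B = (\<chi> p q. shift_word A B (e (fst p)) (e (snd p)) $ fst q $ snd q)"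

lemma matrix_algebra_power: "A \<in> matrix_algebra G \<Longrightarrow> matrix_power A i \<in> matrix_algebra G"
  by (induction i) (auto intro: matrix_algebra.intros)

lemma matrix_algebra_sum:
  "(\<And>s. s \<in> S \<Longrightarrow> f s \<in> matrix_algebra G) \<Longrightarrow> (\<Sum>s\<in>S. f s) \<in> matrix_algebra G"
proof (induction S rule: infinite_finite_induct)
  case (insert x S)
  then show ?case by (auto intro: matrix_algebra.add)
qed (use matrix_algebra.scale[OF matrix_algebra.one, of 0] in auto)

text \<open>An invertible word matrix means that the words span the space of all matrices.\<close>

lemma generating_if_word_matrix_invertible:
  fixes A B :: "real^'n^'n"
  assumes "det (word_matrix e A B) \<noteq> 0"
  shows "matrix_algebra {A, B} = UNIV"
proof -
  have AB: "A \<in> matrix_algebra {A, B}" "B \<in> matrix_algebra {A, B}"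
    by (auto intro: matrix_algebra.gen)
  have "mat 1 - A ** B = mat 1 + (-1) *\<^sub>R (A ** B)" by simp
  then have "mat 1 - A ** B \<in> matrix_algebra {A, B}"
    using AB by (metis matrix_algebra.add matrix_algebra.one matrix_algebra.scale matrix_algebra.mult)
  then have word: "shift_word A B i j \<in> matrix_algebra {A, B}" for i j
    unfolding shift_word_def using AB by (intro matrix_algebra.mult matrix_algebra_power)
  have "X \<in> matrix_algebra {A, B}" for X
  proof -
    define x where "x = (\<chi> q. X $ fst q $ snd q)"
    obtain R where R: "transpose (word_matrix e A B) ** R = mat 1"
      using invertible_obtain_inverse[of "transpose (word_matrix e A B)"] assms by auto
    define c where "c = R *v x"
    have c: "transpose (word_matrix e A B) *v c = x"
      by (simp add: c_def matrix_vector_mul_assoc R del: transpose_matrix_vector)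
    have "X $ a $ b = (\<Sum>p\<in>UNIV. c $ p *\<^sub>R shift_word A B (e (fst p)) (e (snd p))) $ a $ b" for a b
      using arg_cong[OF c, of "\<lambda>v. v $ (a, b)"]
      by (simp add: x_def matrix_vector_mult_def transpose_def word_matrix_def sum_component
          mult.commute
          del: transpose_matrix_vector)
    then have "X = (\<Sum>p\<in>UNIV. c $ p *\<^sub>R shift_word A B (e (fst p)) (e (snd p)))"
      by (simp add: vec_eq_iff)
    then show ?thesis
      by (simp add: matrix_algebra_sum matrix_algebra.scale word)
  qed
  then show ?thesis by blast
qed

definition shift_matrix :: "('n \<Rightarrow> nat) \<Rightarrow> real^'n^'n" where
  "shift_matrix e = (\<chi> x y. if e x = Suc (e y) then 1 else 0)"

lemma matrix_power_commute: "matrix_power A i ** A = A ** matrix_power A i"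
  by (induction i) (auto simp: matrix_mul_assoc[symmetric])

lemma matrix_power_transpose: "matrix_power (transpose A) i
    = transpose (matrix_power (A :: real^'n^'n) i)"
  by (induction i) (auto simp: matrix_transpose_mul matrix_power_commute[symmetric])

lemma word_matrix_shift:
  fixes e :: "'n::finite \<Rightarrow> nat"
  assumes e: "bij_betw e UNIV {..<CARD('n)}"
  shows "word_matrix e (shift_matrix e) (transpose (shift_matrix e)) = mat 1"
proof -
  let ?N = "shift_matrix e"
  have inj: "e x = e y \<longleftrightarrow> x = y" for x y using e by (auto simp: bij_betw_def inj_on_def)
  have ex: "\<exists>z. e z = i" if "i < CARD('n)" for i
  proof -
    have "i \<in> range e" using e that by (auto simp: bij_betw_def)
    then show ?thesis by (metis imageE)
  qed
  have lt: "e x < CARD('n)" for x using e by (auto simp: bij_betw_def)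
  have pow: "matrix_power ?N i $ x $ y = (if e x = e y + i then 1 else 0)" for i x y
  proof (induction i arbitrary: x)
    case 0
    then show ?case by (simp add: mat_def inj)
  next
    case (Suc i)
    have eq: "matrix_power ?N (Suc i) $ x $ y = (\<Sum>z\<in>UNIV. if e x = Suc (e z) \<and> e z
        = e y + i then 1 else 0)"
      unfolding matrix_power.simps matrix_matrix_mult_def vec_lambda_beta Suc
      by (intro sum.cong refl) (simp add: shift_matrix_def)
    show ?case
    proof (cases "e x = e y + Suc i")
      case True
      then obtain z where z: "e z = e y + i" using ex[of "e y + i"] lt[of x] by auto
      have "(e x = Suc (e v) \<and> e v = e y + i) \<longleftrightarrow> v = z" for v
        using True z inj[of v z] by auto
      then show ?thesis unfolding eq using True by simp
    next
      case False
      then show ?thesis unfolding eq by (auto intro!: sum.neutral)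
    qed
  qed
  obtain z0 where z0: "e z0 = 0" using ex[of 0] by auto
  have NN: "(?N ** transpose ?N) $ x $ y = (if x = y \<and> x \<noteq> z0 then 1 else 0)" for x y
  proof -
    have eq: "(?N ** transpose ?N) $ x $ y = (\<Sum>z\<in>UNIV. if e x = Suc (e z) \<and> e y
        = Suc (e z) then 1 else 0)"
      unfolding matrix_matrix_mult_def transpose_def vec_lambda_beta shift_matrix_def
      by (intro sum.cong) auto
    show ?thesis
    proof (cases "x = y \<and> x \<noteq> z0")
      case True
      then have "e x \<noteq> 0" using inj[of x z0] z0 by auto
      then obtain i where i: "e x = Suc i" using not0_implies_Suc by blast
      then obtain z where "e z = i" using ex[of i] lt[of x] by auto
      with i have z: "e x = Suc (e z)" by simp
      have "(e x = Suc (e v) \<and> e y = Suc (e v)) \<longleftrightarrow> v = z" for v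
        using True z inj[of v z] by auto
      then show ?thesis unfolding eq using True by auto
    next
      case False
      then have "\<not> (e x = Suc (e v) \<and> e y = Suc (e v))" for v
        using inj[of x y] z0 by auto
      then have "(\<Sum>z\<in>UNIV. if e x = Suc (e z) \<and> e y = Suc (e z) then 1 else (0::real)) = 0"
        by (intro sum.neutral ballI) (simp only: if_False refl)
      then show ?thesis unfolding eq using False by auto
    qed
  qed
  have mid: "mat 1 - ?N ** transpose ?N = unit_matrix z0 z0"
    by (simp add: vec_eq_iff NN mat_def unit_matrix_def)
  have "shift_word ?N (transpose ?N) (e u) (e v) $ x $ y = (if x = u \<and> y = v then 1 else 0)" for u v x y
  proof -
    have "shift_word ?N (transpose ?N) (e u) (e v) $ x $ y
        = (\<Sum>z\<in>UNIV. (if z = z0 then matrix_power ?N (e u) $ x $ z0 else 0) * matrix_power ?N (e v)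
            $ y $ z)"
      by (simp add: shift_word_def mid matrix_power_transpose matrix_matrix_mult_def[of "_ **
          unit_matrix z0 z0"]
          mult_unit_matrix_nth) (simp add: transpose_def)
    also have "\<dots> = (\<Sum>z\<in>UNIV. if z = z0
        then matrix_power ?N (e u) $ x $ z0 * matrix_power ?N (e v) $ y $ z else 0)"
      by (intro sum.cong) auto
    also have "\<dots> = matrix_power ?N (e u) $ x $ z0 * matrix_power ?N (e v) $ y $ z0"
      by simp
    finally show ?thesis by (simp add: pow z0 inj)
  qed
  then show ?thesis
    by (auto simp: vec_eq_iff word_matrix_def mat_def prod_eq_iff)
qed

section \<open>Polynomial conditions on the sample\<close>

lemma sample_polynomial_matrix_mult:
  fixes A :: "(nat \<Rightarrow> real^'b^'a) \<Rightarrow> real^'n^'m" and B :: "(nat \<Rightarrow> real^'b^'a) \<Rightarrow> real^'l^'n"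
  assumes "\<And>x y. sample_polynomial I (\<lambda>Y. A Y $ x $ y)" "\<And>x y. sample_polynomial I (\<lambda>Y. B Y $ x $ y)"
  shows "sample_polynomial I (\<lambda>Y. (A Y ** B Y) $ x $ y)"
  unfolding matrix_matrix_mult_def vec_lambda_beta
  by (intro sample_polynomial_sum sample_polynomial.mult assms)

lemma sample_polynomial_mat: "sample_polynomial I (\<lambda>Y. mat c $ x $ y)"
  by (rule sample_polynomial.const)

lemma sample_polynomial_matrix_power:
  fixes A :: "(nat \<Rightarrow> real^'b^'a) \<Rightarrow> real^'n^'n"
  assumes "\<And>x y. sample_polynomial I (\<lambda>Y. A Y $ x $ y)"
  shows "sample_polynomial I (\<lambda>Y. matrix_power (A Y) i $ x $ y)"
proof (induction i arbitrary: x y)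
  case 0
  show ?case unfolding matrix_power.simps by (rule sample_polynomial_mat)
next
  case (Suc i)
  show ?case unfolding matrix_power.simps by (rule sample_polynomial_matrix_mult[OF assms Suc])
qed

lemma sample_polynomial_word_matrix:
  fixes A B :: "(nat \<Rightarrow> real^'b^'a) \<Rightarrow> real^'n^'n"
  assumes "\<And>x y. sample_polynomial I (\<lambda>Y. A Y $ x $ y)" "\<And>x y. sample_polynomial I (\<lambda>Y. B Y $ x $ y)"
  shows "sample_polynomial I (\<lambda>Y. det (word_matrix e (A Y) (B Y)))"
proof (rule sample_polynomial_det)
  have "sample_polynomial I (\<lambda>Y. (mat 1 - A Y ** B Y) $ x $ y)" for x y
    unfolding vector_minus_component
    by (intro sample_polynomial_diff sample_polynomial_mat sample_polynomial_matrix_mult assms)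
  then show "sample_polynomial I (\<lambda>Y. word_matrix e (A Y) (B Y) $ p $ q)" for p q
    unfolding word_matrix_def shift_word_def vec_lambda_beta
    by (intro sample_polynomial_matrix_mult sample_polynomial_matrix_power assms)
qed

lemma sample_polynomial_coeff_prod:
  fixes P :: "'s \<Rightarrow> (nat \<Rightarrow> real^'b^'a) \<Rightarrow> real poly"
  assumes "\<And>s i. sample_polynomial I (\<lambda>Y. coeff (P s Y) i)"
  shows "sample_polynomial I (\<lambda>Y. coeff (\<Prod>s\<in>S. P s Y) i)"
proof (induction S arbitrary: i rule: infinite_finite_induct)
  case (insert x S)
  then show ?case
    by (simp add: coeff_mult) (intro sample_polynomial_sum sample_polynomial.mult assms insert.IH)
qed (auto intro: sample_polynomial.const)

lemma sample_polynomial_coeff_charpoly: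
  fixes A :: "(nat \<Rightarrow> real^'b^'a) \<Rightarrow> real^'n^'n"
  assumes "\<And>x y. sample_polynomial I (\<lambda>Y. A Y $ x $ y)"
  shows "sample_polynomial I (\<lambda>Y. coeff (charpoly (A Y)) i)"
proof -
  have neg: "sample_polynomial I (\<lambda>Y. - (A Y $ x $ y))" for x y
    using sample_polynomial_diff[OF sample_polynomial.const[of I 0] assms] by simp
  have "sample_polynomial I (\<lambda>Y. coeff [:- (A Y $ x $ y), c:] j)" for x y j and c :: real
  proof (cases j)
    case 0
    then show ?thesis using neg by simp
  next
    case (Suc l)
    then show ?thesis by (cases l) (auto intro: sample_polynomial.const)
  qed
  then have "sample_polynomial I (\<lambda>Y. of_int (sign p) * coeff (\<Prod>x\<in>UNIV. [:- (A Y $ x $ p x), if x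
      = p x then 1 else 0:]) i)"
    for p
    by (intro sample_polynomial.mult sample_polynomial.const sample_polynomial_coeff_prod)
  then show ?thesis
    unfolding charpoly_def det_def coeff_sum vec_lambda_beta
    by (intro sample_polynomial_sum) (simp add: of_int_poly)
qed

lemma sample_polynomial_charpoly_deriv:
  fixes A :: "(nat \<Rightarrow> real^'b^'a) \<Rightarrow> real^'n^'n"
  assumes "\<And>x y. sample_polynomial I (\<lambda>Y. A Y $ x $ y)"
  shows "sample_polynomial I (\<lambda>Y. det (charpoly_deriv_at (A Y)))"
proof (rule sample_polynomial_det)
  show "sample_polynomial I (\<lambda>Y. charpoly_deriv_at (A Y) $ x $ y)" for x y
    unfolding charpoly_deriv_at_def sum_component vector_scaleR_component coeff_pderiv real_scaleR_def
    by (intro sample_polynomial_sum sample_polynomial.mult sample_polynomial.const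
        sample_polynomial_coeff_charpoly sample_polynomial_matrix_power assms)
qed

lemma charpoly_deriv_at_diagm:
  fixes d :: "'n::finite \<Rightarrow> real"
  assumes "inj d"
  shows "det (charpoly_deriv_at (diagm d)) \<noteq> 0"
proof -
  define p where "p = charpoly (diagm d)"
  have "(\<chi> i j. [:- (diagm d $ i $ j), if i = j then 1 else 0:]) = diagm (\<lambda>i. [:- d i, 1:])"
    by (simp add: vec_eq_iff diagm_nth)
  then have p: "p = (\<Prod>i\<in>UNIV. [:- d i, 1:])" by (simp add: p_def charpoly_def)
  have pow: "matrix_power (diagm d) i = diagm (\<lambda>a. d a ^ i)" for i
    by (induction i) (simp_all add: diagm_1 diagm_mult_diagm)
  have "degree (pderiv p) \<le> CARD('n)"
    using charpoly_monic(1)[of "diagm d"] degree_pderiv[of p] by (simp add: p_def)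
  then have "(\<Sum>i\<le>CARD('n). coeff (pderiv p) i * x ^ i) = poly (pderiv p) x" for x
    unfolding poly_altdef by (intro sum.mono_neutral_right) (auto simp: coeff_eq_0)
  then have "charpoly_deriv_at (diagm d) = diagm (\<lambda>a. poly (pderiv p) (d a))"
    by (simp add: charpoly_deriv_at_def p_def[symmetric] pow vec_eq_iff sum_component diagm_nth)
  moreover have "poly (pderiv p) (d a) \<noteq> 0" for a
  proof -
    define q where "q = (\<Prod>i\<in>UNIV - {a}. [:- d i, 1:])"
    have "p = [:- d a, 1:] * q" unfolding p q_def by (subst prod.remove[of _ a]) auto
    then have "poly (pderiv p) (d a) = poly q (d a)"
      by (simp only: pderiv_mult poly_add poly_mult) (simp add: pderiv_pCons)
    also have "\<dots> \<noteq> 0"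
      using assms by (auto simp: q_def poly_prod inj_eq)
    finally show ?thesis .
  qed
  ultimately show ?thesis by simp
qed

context row_blocks
begin

text \<open>The block \<open>j\<close> of \<open>adj(W) Y\<^sub>i\<close>, expressed by Cramer's rule so as to be polynomial in the
  sample.\<close>

definition adjugate_block :: "(nat \<Rightarrow> real^'m2^'m1) \<Rightarrow> nat \<Rightarrow> nat \<Rightarrow> real^'m2^'m2" where
  "adjugate_block Y i j = (\<chi> x y. det (\<chi> a q. if h q
      = (j, x) then Y i $ a $ y else Y (fst (h q)) $ a $ snd (h q)))"

lemma incl_transpose_mult_nth:
  assumes "h r = (j, x)"
  shows "(transpose (incl j) ** X) $ x $ y = X $ r $ y"
proof -
  have "h q = (j, x) \<longleftrightarrow> q = r" for q using h_inj[of q r] assms by simp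
  then have "(transpose (incl j) ** X) $ x $ y = (\<Sum>q\<in>UNIV. if q = r then X $ q $ y else 0)"
    unfolding matrix_matrix_mult_def transpose_def incl_def vec_lambda_beta by (intro sum.cong) auto
  then show ?thesis by simp
qed

lemma adjugate_block_eq:
  assumes LW: "L ** concat_samples Y = mat 1" and "j < k"
  shows "adjugate_block Y i j = det (concat_samples Y) *\<^sub>R (transpose (incl j) ** (L ** Y i))"
proof -
  define W where "W = concat_samples Y"
  have WL: "W ** L = mat 1" using LW by (simp add: W_def matrix_right_inverse_commute)
  have dW: "det W \<noteq> 0" using arg_cong[OF WL, of det] by (auto simp: det_mul)
  have "adjugate_block Y i j $ x $ y = det W * (transpose (incl j) ** (L ** Y i)) $ x $ y" for x y
  proof -
    obtain r where r: "h r = (j, x)" using h_index[OF assms(2)] by blast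
    have hq: "h q = (j, x) \<longleftrightarrow> q = r" for q using h_inj[of q r] r by simp
    have "W *v column y (L ** Y i) = column y (W ** L ** Y i)"
      by (simp add: vec_eq_iff matrix_vector_mult_def column_def matrix_matrix_mult_def[of W "L ** Y i"]
          matrix_mul_assoc[symmetric])
    then have "W *v column y (L ** Y i) = column y (Y i)" by (simp add: WL)
    then have "column y (L ** Y i) = (\<chi> q. det (\<chi> a q'. if q'
        = q then column y (Y i) $ a else W $ a $ q') / det W)"
      using cramer[OF dW] by blast
    then have "(L ** Y i) $ r $ y * det W = det (\<chi> a q'. if q'
        = r then column y (Y i) $ a else W $ a $ q')"
      using dW by (simp add: column_def vec_eq_iff)
    then show ?thesis
      unfolding incl_transpose_mult_nth[OF r] adjugate_block_def hq W_def concat_samples_nth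
        column_def vec_lambda_beta
      by (simp add: mult.commute)
  qed
  then show ?thesis by (simp add: vec_eq_iff W_def)
qed

lemma sample_polynomial_concat:
  assumes "{..<k} \<subseteq> I"
  shows "sample_polynomial I (\<lambda>Y. det (concat_samples Y))"
proof (rule sample_polynomial_det)
  show "sample_polynomial I (\<lambda>Y. concat_samples Y $ a $ q)" for a q
    unfolding concat_samples_nth using assms h_fst by (intro sample_polynomial.entry) auto
qed

lemma sample_polynomial_adjugate_block:
  assumes "{..<k} \<subseteq> I" "i \<in> I"
  shows "sample_polynomial I (\<lambda>Y. adjugate_block Y i j $ x $ y)"
  unfolding adjugate_block_def vec_lambda_beta
proof (rule sample_polynomial_det)
  fix a q
  show "sample_polynomial I (\<lambda>Y. (\<chi> a q. if h q
      = (j, x) then Y i $ a $ y else Y (fst (h q)) $ a $ snd (h q)) $ a $ q)"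
    using assms h_fst[of q] by (cases "h q = (j, x)") (auto intro: sample_polynomial.entry)
qed

lemma concat_samples_standard:
  assumes "\<And>j. j < k \<Longrightarrow> Y j = incl j"
  shows "concat_samples Y = mat 1"
  unfolding concat_samples_def incl_complete[symmetric] using assms by (intro sum.cong) auto

lemma AE_concat_invertible:
  assumes mu: "matrix_normal (mu :: (real^'m2^'m1) measure) \<Sigma>1 \<Sigma>2" and "k \<le> n"
  shows "AE Y in Pi\<^sub>M {..<n} (\<lambda>_. mu). det (concat_samples Y) \<noteq> 0"
proof (rule sample_polynomial_zero_one(1)[OF mu sample_polynomial_concat])
  show "\<exists>Y. det (concat_samples Y) \<noteq> 0"
    using concat_samples_standard[of incl] by (intro exI[of _ incl]) simp
qed (use assms in auto)

lemma AE_generating: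
  assumes mu: "matrix_normal (mu :: (real^'m2^'m1) measure) \<Sigma>1 \<Sigma>2" and i: "k \<le> i1" "i1 < n" "k
      \<le> i2" "i2 < n"
    and j: "j1 < k" "j2 < k" and ne: "(i1, j1) \<noteq> (i2, j2)"
  shows "AE Y in Pi\<^sub>M {..<n} (\<lambda>_. mu). matrix_algebra {adjugate_block Y i1 j1, adjugate_block Y i2
      j2} = UNIV"
proof -
  obtain e :: "'m2 \<Rightarrow> nat" where e: "bij_betw e UNIV {..<CARD('m2)}"
    using finite_same_card_bij[of "UNIV :: 'm2 set" "{..<CARD('m2)}"] by auto
  define F where "F Y = det (word_matrix e (adjugate_block Y i1 j1) (adjugate_block Y i2 j2))" for Y
  have F: "sample_polynomial {..<n} F"
    unfolding F_def
    by (intro sample_polynomial_word_matrix sample_polynomial_adjugate_block) (use i in auto)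
  \<comment> \<open>With \<open>W = 1\<close> the two blocks can be prescribed freely, even when both belong to the same
    observation.\<close>
  define Y where "Y i = (if i < k then incl i else
      (if i = i1 then incl j1 ** shift_matrix e else 0) + (if i = i2 then
          incl j2 ** transpose (shift_matrix e) else 0))" for i
  have W: "concat_samples Y = mat 1" by (rule concat_samples_standard) (simp add: Y_def)
  have "adjugate_block Y i1 j1 = shift_matrix e" "adjugate_block Y i2 j2 = transpose (shift_matrix e)"
    using i j ne
    by (auto simp: adjugate_block_eq[of "mat 1"] W Y_def matrix_add_ldistrib matrix_mul_assoc
        incl_orthonormal)
  then have "F Y \<noteq> 0" by (simp add: F_def word_matrix_shift[OF e])
  then have "AE Y in Pi\<^sub>M {..<n} (\<lambda>_. mu). F Y \<noteq> 0"
    by (intro sample_polynomial_zero_one(1)[OF mu F] exI)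
  then show ?thesis
    by eventually_elim (simp add: F_def generating_if_word_matrix_invertible)
qed

lemma AE_mle_exists_uniquely:
  assumes mu: "matrix_normal (mu :: (real^'m2^'m1) measure) \<Sigma>1 \<Sigma>2" and "k \<le> i1" "i1 < n" "k
      \<le> i2" "i2 < n"
    and j: "j1 < k" "j2 < k" and "(i1, j1) \<noteq> (i2, j2)"
  shows "AE Y in Pi\<^sub>M {..<n} (\<lambda>_. mu). mle_exists_uniquely n Y"
proof -
  have "k \<le> n" "n > 0" using assms by auto
  show ?thesis
    using AE_generating[OF assms] AE_concat_invertible[OF mu \<open>k \<le> n\<close>]
  proof eventually_elim
    case (elim Y)
    obtain L where L: "L ** concat_samples Y = mat 1" using invertible_obtain_inverse[OF elim(2)]
        by blast
    define G where "G = sample_blocks (\<lambda>i. L ** Y i) n"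
    have "transpose (incl j1) ** (L ** Y i1) \<in> G" "transpose (incl j2) ** (L ** Y i2) \<in> G"
      unfolding G_def sample_blocks_def using assms by auto
    then have "{adjugate_block Y i1 j1, adjugate_block Y i2 j2} \<subseteq> matrix_algebra G"
      using adjugate_block_eq[OF L j(1)] adjugate_block_eq[OF L j(2)]
      by (auto intro: matrix_algebra.scale matrix_algebra.gen)
    from matrix_algebra_subset[OF this] have "matrix_algebra G = UNIV" using elim(1) by blast
    then show ?case
      using mle_exists_uniquely_if_generating[OF \<open>k \<le> n\<close> \<open>n > 0\<close> L] by (simp add: G_def)
  qed
qed

lemma pair_normalisation:
  assumes k: "k = 1" and "det (concat_samples Y) \<noteq> 0"
  obtains L where "det L \<noteq> 0" "L ** Y 0 = det (concat_samples Y) *\<^sub>R incl 0"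
    "L ** Y 1 = incl 0 ** adjugate_block Y 1 0"
proof -
  obtain L where L: "L ** concat_samples Y = mat 1" "det L \<noteq> 0"
    using invertible_obtain_inverse[OF assms(2)] by blast
  define \<delta> where "\<delta> = det (concat_samples Y)"
  have "concat_samples Y ** incl 0 = Y 0" using concat_samples_incl[of 0 Y] k by simp
  then have "L ** Y 0 = incl 0" using L(1) by (metis matrix_mul_assoc matrix_mul_lid)
  moreover have "incl 0 ** transpose (incl 0) = mat 1" using incl_complete k by simp
  ultimately have "(\<delta> *\<^sub>R L) ** Y 0 = \<delta> *\<^sub>R incl 0" "(\<delta> *\<^sub>R L) ** Y 1 = incl 0 ** adjugate_block Y 1 0"
    using adjugate_block_eq[OF L(1), of 0 1] k by (simp_all add: matrix_mul_assoc \<delta>_def)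
  moreover have "det (\<delta> *\<^sub>R L) \<noteq> 0" using L(2) assms(2) by (simp add: det_scaleR \<delta>_def)
  ultimately show thesis using that unfolding \<delta>_def by blast
qed

lemma adjugate_block_pair:
  assumes k: "k = 1"
  shows "adjugate_block (\<lambda>i. if i = 0 then incl 0 else incl 0 ** M) 1 0 = M"
proof -
  define Y where "Y = (\<lambda>i :: nat. if i = 0 then incl 0 else incl 0 ** M)"
  have W: "concat_samples Y = mat 1" by (rule concat_samples_standard) (simp add: Y_def k)
  have "adjugate_block Y 1 0 = transpose (incl 0) ** (mat 1 ** Y 1)"
    using adjugate_block_eq[of "mat 1" Y 0 1] W k by simp
  also have "\<dots> = (transpose (incl 0) ** incl 0) ** M" by (simp add: Y_def matrix_mul_assoc)
  also have "\<dots> = M" using incl_orthonormal[of 0 0] k by simp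
  finally show ?thesis by (simp add: Y_def)
qed

text \<open>A diagonal block with distinct entries shows that the polynomial is not identically zero.\<close>

lemma AE_simple_spectrum:
  assumes mu: "matrix_normal (mu :: (real^'m2^'m1) measure) \<Sigma>1 \<Sigma>2" and k: "k = 1"
  shows "AE Y in Pi\<^sub>M {..<2} (\<lambda>_. mu). det (charpoly_deriv_at (adjugate_block Y 1 0)) \<noteq> 0"
proof (rule sample_polynomial_zero_one(1)[OF mu])
  show "sample_polynomial {..<2} (\<lambda>Y. det (charpoly_deriv_at (adjugate_block Y 1 0)))"
    using k by (intro sample_polynomial_charpoly_deriv sample_polynomial_adjugate_block) auto
  obtain e :: "'m2 \<Rightarrow> nat" where e: "bij_betw e UNIV {..<CARD('m2)}"
    using finite_same_card_bij[of "UNIV :: 'm2 set" "{..<CARD('m2)}"] by auto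
  then have "inj (\<lambda>x. real (e x))" by (auto simp: bij_betw_def inj_on_def)
  from charpoly_deriv_at_diagm[OF this]
  show "\<exists>Y. det (charpoly_deriv_at (adjugate_block Y 1 0)) \<noteq> 0"
    using adjugate_block_pair[OF k] by metis
qed

lemma AE_mle_exists:
  assumes mu: "matrix_normal (mu :: (real^'m2^'m1) measure) \<Sigma>1 \<Sigma>2" and "k > 0" "k \<le> n"
  shows "AE Y in Pi\<^sub>M {..<n} (\<lambda>_. mu). mle_exists n Y"
proof -
  consider "n = k" | "k = 1" "n = 2" | "k = 1" "n > 2" | "k \<ge> 2" "n > k" using assms by linarith
  then show ?thesis
  proof cases
    case 1
    show ?thesis
      using AE_concat_invertible[OF mu \<open>k \<le> n\<close>]
    proof eventually_elim
      case (elim Y)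
      then obtain \<Psi>1 where "likelihood_equations k Y \<Psi>1 (mat 1)"
        using likelihood_equations_square[OF _ mat_1_PD \<open>k > 0\<close>] by blast
      then show ?case unfolding 1 by (rule likelihood_equations_imp_exists)
    qed
  next
    case 2
    show ?thesis
      using AE_concat_invertible[OF mu \<open>k \<le> n\<close>] AE_simple_spectrum[OF mu \<open>k = 1\<close>, folded \<open>n = 2\<close>]
    proof eventually_elim
      case (elim Y)
      obtain L where "det L \<noteq> 0" "L ** Y 0 = det (concat_samples Y) *\<^sub>R incl 0"
        "L ** Y 1 = incl 0 ** adjugate_block Y 1 0"
        using pair_normalisation[OF \<open>k = 1\<close> elim(1)] by blast
      then show ?case unfolding \<open>n = 2\<close> using mle_exists_pair[OF \<open>k = 1\<close>] elim by blast
    qed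
  next
    case 3
    have "AE Y in Pi\<^sub>M {..<n} (\<lambda>_. mu). mle_exists_uniquely n Y"
      by (rule AE_mle_exists_uniquely[OF mu, of 1 n 2 0 0]) (use 3 in auto)
    then show ?thesis by eventually_elim (simp add: mle_exists_uniquely_def)
  next
    case 4
    have "AE Y in Pi\<^sub>M {..<n} (\<lambda>_. mu). mle_exists_uniquely n Y"
      by (rule AE_mle_exists_uniquely[OF mu, of k n k 0 1]) (use 4 in auto)
    then show ?thesis by eventually_elim (simp add: mle_exists_uniquely_def)
  qed
qed

lemma not_AE_unique_square:
  assumes mu: "matrix_normal (mu :: (real^'m2^'m1) measure) \<Sigma>1 \<Sigma>2" and "k > 0" "CARD('m2) \<ge> 2"
  shows "\<not> (AE Y in Pi\<^sub>M {..<k} (\<lambda>_. mu). mle_exists_uniquely k Y)"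
proof
  interpret P: prob_space "Pi\<^sub>M {..<k} (\<lambda>_. mu)"
    by (intro prob_space_PiM matrix_normal_prob_space(1)[OF mu])
  assume "AE Y in Pi\<^sub>M {..<k} (\<lambda>_. mu). mle_exists_uniquely k Y"
  with AE_concat_invertible[OF mu order_refl] have "AE Y in Pi\<^sub>M {..<k} (\<lambda>_. mu). False"
    by eventually_elim (use not_unique_square assms in blast)
  then show False by simp
qed

text \<open>Almost sure uniqueness would force \<open>det (adj(W) Y\<^sub>1) \<ge> 0\<close> almost surely, hence everywhere,
  since this is a polynomial condition; but the determinant takes negative values.\<close>

lemma not_AE_unique_pair:
  assumes mu: "matrix_normal (mu :: (real^'m2^'m1) measure) \<Sigma>1 \<Sigma>2" and k: "k = 1" and "CARD('m2) \<ge> 2"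
  shows "\<not> (AE Y in Pi\<^sub>M {..<2} (\<lambda>_. mu). mle_exists_uniquely 2 Y)"
proof
  assume "AE Y in Pi\<^sub>M {..<2} (\<lambda>_. mu). mle_exists_uniquely 2 Y"
  moreover have "AE Y in Pi\<^sub>M {..<2} (\<lambda>_. mu). det (concat_samples Y) \<noteq> 0"
    using AE_concat_invertible[OF mu, of 2] k by simp
  ultimately have "AE Y in Pi\<^sub>M {..<2} (\<lambda>_. mu). det (adjugate_block Y 1 0) \<ge> 0"
    using AE_simple_spectrum[OF mu k]
  proof eventually_elim
    case (elim Y)
    obtain L where "det L \<noteq> 0" "L ** Y 0 = det (concat_samples Y) *\<^sub>R incl 0"
      "L ** Y 1 = incl 0 ** adjugate_block Y 1 0"
      using pair_normalisation[OF k elim(2)] by blast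
    then show ?case
      using not_unique_pair[OF k _ _ _ elim(2,3)] elim(1) assms(3) by (meson not_less)
  qed
  moreover have "sample_polynomial {..<2} (\<lambda>Y. det (adjugate_block Y 1 0))"
    using k by (intro sample_polynomial_det sample_polynomial_adjugate_block) auto
  ultimately have nonneg: "det (adjugate_block Y 1 0) \<ge> 0" for Y
    using sample_polynomial_zero_one(2)[OF mu] by blast
  fix b :: 'm2
  define D where "D = diagm (\<lambda>x. if x = b then -1 else (1::real))"
  have "det D = -1" by (simp add: D_def prod.delta)
  then show False
    using nonneg[of "\<lambda>i. if i = 0 then incl 0 else incl 0 ** D"]
        by (simp only: adjugate_block_pair[OF k])
qed

lemma not_AE_bounded:
  assumes mu: "matrix_normal (mu :: (real^'m2^'m1) measure) \<Sigma>1 \<Sigma>2" and "0 < n" "n < k"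
  shows "\<not> (AE Y in Pi\<^sub>M {..<n} (\<lambda>_. mu). loglik_bounded n Y)"
proof
  interpret P: prob_space "Pi\<^sub>M {..<n} (\<lambda>_. mu)"
    by (intro prob_space_PiM matrix_normal_prob_space(1)[OF mu])
  assume "AE Y in Pi\<^sub>M {..<n} (\<lambda>_. mu). loglik_bounded n Y"
  then have "AE Y in Pi\<^sub>M {..<n} (\<lambda>_. mu). False"
  proof eventually_elim
    case (elim Y)
    have "\<not> loglik_bounded n Y"
      using assms by (intro unbounded_if_small_sample) (auto simp: card_rows)
    with elim show ?case by contradiction
  qed
  then show False by simp
qed

lemma mle_exists_threshold:
  assumes mu: "matrix_normal (mu :: (real^'m2^'m1) measure) \<Sigma>1 \<Sigma>2" and "k > 0" "n > 0"
  shows "(AE Y in Pi\<^sub>M {..<n} (\<lambda>_. mu). mle_exists n Y) \<longleftrightarrow> k \<le> n"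
    and "(AE Y in Pi\<^sub>M {..<n} (\<lambda>_. mu). loglik_bounded n Y) \<longleftrightarrow> k \<le> n"
proof -
  have "AE Y in Pi\<^sub>M {..<n} (\<lambda>_. mu). loglik_bounded n Y"
    if "AE Y in Pi\<^sub>M {..<n} (\<lambda>_. mu). mle_exists n Y"
    using that by eventually_elim (rule mle_exists_imp_bounded)
  then show "(AE Y in Pi\<^sub>M {..<n} (\<lambda>_. mu). mle_exists n Y) \<longleftrightarrow> k \<le> n"
    and "(AE Y in Pi\<^sub>M {..<n} (\<lambda>_. mu). loglik_bounded n Y) \<longleftrightarrow> k \<le> n"
    using AE_mle_exists[OF mu \<open>k > 0\<close>] not_AE_bounded[OF mu \<open>n > 0\<close>] not_less by metis+
qed

lemma mle_unique_threshold:
  assumes mu: "matrix_normal (mu :: (real^'m2^'m1) measure) \<Sigma>1 \<Sigma>2" and "k > 0" "n > 0" "CARD('m2) \<ge> 2"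
  shows "(AE Y in Pi\<^sub>M {..<n} (\<lambda>_. mu). mle_exists_uniquely n Y) \<longleftrightarrow> (if k = 1 then 3 else k + 1) \<le> n"
proof
  assume uniq: "AE Y in Pi\<^sub>M {..<n} (\<lambda>_. mu). mle_exists_uniquely n Y"
  then have "AE Y in Pi\<^sub>M {..<n} (\<lambda>_. mu). mle_exists n Y"
    by eventually_elim (simp add: mle_exists_uniquely_def)
  then have "k \<le> n" using mle_exists_threshold(1)[OF assms(1-3)] by blast
  moreover have "n \<noteq> k" using uniq not_AE_unique_square[OF mu assms(2,4)] by blast
  moreover have "n \<noteq> 2" if "k = 1" using uniq not_AE_unique_pair[OF mu that assms(4)] by blast
  ultimately show "(if k = 1 then 3 else k + 1) \<le> n" by auto
next
  assume n: "(if k = 1 then 3 else k + 1) \<le> n"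
  show "AE Y in Pi\<^sub>M {..<n} (\<lambda>_. mu). mle_exists_uniquely n Y"
  proof (cases "k = 1")
    case True
    then show ?thesis using n by (intro AE_mle_exists_uniquely[OF mu, of 1 n 2 0 0]) auto
  next
    case False
    then show ?thesis using n assms(2) by (intro AE_mle_exists_uniquely[OF mu, of k n k 0 1]) auto
  qed
qed

end

theorem theorem1p4:
  assumes "CARD('m1::finite) \<ge> CARD('m2::finite)"
    and "CARD('m2) \<ge> 2"
    and "CARD('m2) dvd CARD('m1)"
  shows "boundedness_threshold TYPE('m1) TYPE('m2) (CARD('m1) div CARD('m2)) \<and>
    existence_threshold TYPE('m1) TYPE('m2) (CARD('m1) div CARD('m2)) \<and>
    uniqueness_threshold TYPE('m1) TYPE('m2)
      (if CARD('m1) = CARD('m2) then 3 else CARD('m1) div CARD('m2) + 1)"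
proof -
  define k where "k = CARD('m1) div CARD('m2)"
  have card: "CARD('m1) = k * CARD('m2)" using assms(3) by (simp add: k_def)
  have "k > 0" using card by (metis mult_0 neq0_conv zero_less_card_finite less_irrefl)
  have k1: "CARD('m1) = CARD('m2) \<longleftrightarrow> k = 1" using card assms(2) by auto
  have "card ({..<k} \<times> (UNIV :: 'm2 set)) = CARD('m1)" by (simp add: card card_cartesian_product)
  then obtain h :: "'m1 \<Rightarrow> nat \<times> 'm2" where "bij_betw h UNIV ({..<k} \<times> UNIV)"
    using finite_same_card_bij[of "UNIV :: 'm1 set" "{..<k} \<times> (UNIV :: 'm2 set)"] by auto
  then interpret row_blocks h k by unfold_locales
  show ?thesis
    unfolding boundedness_threshold_def existence_threshold_def uniqueness_threshold_def
        is_threshold_def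
      k_def[symmetric] k1
    using mle_exists_threshold[OF _ \<open>k > 0\<close>] mle_unique_threshold[OF _ \<open>k > 0\<close> _ assms(2)] \<open>k > 0\<close>
    by auto
qed

end
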